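(* Let $r>0$ and let $H:\mathbb{R}\times\mathcal{P}_2\times\mathbb{R}\to\mathbb{R}$ be the Hamiltonian described in the context. Suppose that: (i) $H(x,\mu,y)$ is jointly continuous and all its second-order partial derivatives exist; (ii) there is a constant $\ell>0$ such that for all $(x,\mu,y),(x',\mu',y')\in\mathbb{R}\times\mathcal{P}_2\times\mathbb{R}$, $$|\partial_yH(x,\mu,y)-\partial_yH(x',\mu',y')|\le \ell\left(|x-x'|+|y-y'|+\mathcal{W}_2(\mu,\mu')\right),$$ $$|\partial_xH(x,\mu,y)-\partial_xH(x',\mu',y')|\le \ell\left(|x-x'|+|y-y'|+\mathcal{W}_2(\mu,\mu')\right);$$ (iii) there are constants $\kappa,C_0>0$ with $C_0+r/2<\kappa$ such that for all $(x,\mu,y),(x',\mu',y')$, $$-(x-x')\left[\partial_xH(x,\mu,y)-\partial_xH(x',\mu',y')\right]+(y-y')\left[\partial_yH(x,\mu,y)-\partial_yH(x',\mu',y')\right]\le-\kappa\left(|x-x'|^2+|y-y'|^2\right)+C_0\mathcal{W}_2^2(\mu,\mu').$$ Let $(X^{\xi},Y^{\xi},Z^{\xi})$ and $(X^{x,\xi},Y^{x,\xi},Z^{x,\xi})$ be the unique $L_r^2$ solutions of the two FBSDEs in the context. Then there exists a constant $C>0$ such that for all $x,x'\in\mathbb{R}$ and all $\xi,\xi'\in\mathbb{L}^2(\mathcal{F}_0)$, $$\mathbb{E}\left[|Y_0^{\xi}-Y_0^{\xi'}|^2\right]+\|X^{\xi}-X^{\xi'}\|_r^2+\|Y^{\xi}-Y^{\xi'}\|_r^2\le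 C\,\mathbb{E}\left[|\xi-\xi'|^2\right]$$ and $$|Y_0^{x,\xi}-Y_0^{x',\xi'}|^2+\|X^{x,\xi}-X^{x',\xi'}\|_r^2+\|Y^{x,\xi}-Y^{x',\xi'}\|_r^2\le C\left(|x-x'|^2+\mathbb{E}\left[|\xi-\xi'|^2\right]\right).$$
   Context: $(\Omega,\mathcal{F},\mathbb{P},\mathbb{F})$ is a filtered probability space with a real Brownian motion $B$; the filtration $\mathbb{F}=(\mathcal{F}_t)_{t\ge0}$ is that of $B$ augmented by all $\mathbb{P}$-null sets and a sub-$\sigma$-algebra $\mathcal{F}_0$ independent of $B$ and rich enough to support any probability measure on $\mathbb{R}$ with finite second moment. $\mathcal{P}_2$ is the set of probability measures on $\mathbb{R}$ with finite second moment, with the 2-Wasserstein distance $\mathcal{W}_2$; $\mathcal{L}_\xi$ is the law of $\xi$; $\mathbb{L}^2(\mathcal{F}_0)$ is the set of real $\mathcal{F}_0$-measurable square-integrable random variables. $L^2_r$ is the space of real adapted processes $v$ on $[0,\infty)$ with $\|v\|_r^2:=\mathbb{E}\left[\int_0^\infty e^{-rt}|v_t|^2dt\right]<\infty$. Hamiltonian: $H(x,\mu,y)=\min_{a\in\mathbb{R}}[b(x,\mu,a)y+f(x,\mu,a)]$, where $b(x,\mu,a)=b_0(x,\mu)+b_1(x,a)$ and $f(x,\mu,a)=f_0(x,\mu)+f_1(x,a)$ are real-valued; the minimizer $\hat\alpha(x,y)$ is unique, and $b,f$ are smooth enough that $\partial_yH(x,\mu,y)=b(x,\mu,\hat\alpha(x,y))$.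 FBSDEs on $[0,\infty)$, for $\xi\in\mathbb{L}^2(\mathcal{F}_0)$ and $x\in\mathbb{R}$: $$dX_t^{\xi}=\partial_yH(X_t^{\xi},\mathcal{L}_{X_t^{\xi}},Y_t^{\xi})dt+dB_t,\quad dY_t^{\xi}=-[\partial_xH(X_t^{\xi},\mathcal{L}_{X_t^{\xi}},Y_t^{\xi})-rY_t^{\xi}]dt+Z_t^{\xi}dB_t,\quad X_0^{\xi}=\xi,$$ $$dX_t^{x,\xi}=\partial_yH(X_t^{x,\xi},\mathcal{L}_{X_t^{\xi}},Y_t^{x,\xi})dt+dB_t,\quad dY_t^{x,\xi}=-[\partial_xH(X_t^{x,\xi},\mathcal{L}_{X_t^{\xi}},Y_t^{x,\xi})-rY_t^{x,\xi}]dt+Z_t^{x,\xi}dB_t,\quad X_0^{x,\xi}=x.$$ An $L_r^2$ solution is a triple of processes in $L_r^2$ satisfying the equations on every finite interval (no terminal condition is prescribed). Under (i)-(iii) both have unique solutions in $L_r^2$. $Y_0^{x,\xi}$ is a.s. constant and is regarded as a real number. *)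

theory Defs
  imports "HOL-Probability.Probability"
begin

section \<open>The Wasserstein space of order two over the reals\<close>

definition P2 :: "real measure set" where
  "P2 = {\<mu>. prob_space \<mu> \<and> sets \<mu> = sets borel \<and> integrable \<mu> (\<lambda>x. x\<^sup>2)}"

definition couplings :: "real measure \<Rightarrow> real measure \<Rightarrow> (real \<times> real) measure set" where
  "couplings \<mu> \<nu> = {\<pi>. sets \<pi> = sets (borel \<Otimes>\<^sub>M borel) \<and>
     distr \<pi> borel fst = \<mu> \<and> distr \<pi> borel snd = \<nu>}"

text \<open>Only used for arguments in \<open>P2\<close>, where every cost integral is finite and the
  infimum ranges over a nonempty set that is bounded below by \<open>0\<close>.\<close>

definition W2 :: "real measure \<Rightarrow> real measure \<Rightarrow> real" where
  "W2 \<mu> \<nu> = sqrt (INF \<pi>\<in>couplings \<mu> \<nu>. (\<integral>p. (fst p - snd p)\<^sup>2 \<partial>\<pi>))"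


section \<open>Brownian motion and its augmented filtration\<close>

definition generated_events ::
  "'a measure \<Rightarrow> (real \<Rightarrow> 'a \<Rightarrow> real) \<Rightarrow> real set \<Rightarrow> 'a set set" where
  "generated_events M B T =
     sigma_sets (space M) (\<Union>s\<in>T. {B s -` A \<inter> space M | A. A \<in> sets borel})"

locale brownian_motion = prob_space M for M :: "'a measure" +
  fixes B :: "real \<Rightarrow> 'a \<Rightarrow> real"
  assumes B_measurable: "t \<ge> 0 \<Longrightarrow> B t \<in> borel_measurable M"
    and B_start: "AE \<omega> in M. B 0 \<omega> = 0"
    and B_continuous: "AE \<omega> in M. continuous_on {0..} (\<lambda>t. B t \<omega>)"
    and B_normal: "0 \<le> s \<Longrightarrow> s < t \<Longrightarrow>
      distributed M lborel (\<lambda>\<omega>. B t \<omega> - B s \<omega>) (normal_density 0 (sqrt (t - s)))"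
    and B_indep: "0 \<le> s \<Longrightarrow> s < t \<Longrightarrow>
      indep_set {(\<lambda>\<omega>. B t \<omega> - B s \<omega>) -` A \<inter> space M | A. A \<in> sets borel}
                (generated_events M B {0..s})"

text \<open>The measure space \<open>G\<close> only serves to carry the initial sub-sigma-algebra \<open>sets G\<close>;
  its measure is irrelevant.\<close>

locale brownian_setting = brownian_motion M B
  for M :: "'a measure" and B :: "real \<Rightarrow> 'a \<Rightarrow> real" +
  fixes G :: "'a measure"
  assumes G_subalgebra: "subalgebra M G"
    and G_indep: "indep_set (sets G) (generated_events M B {0..})"
    and G_rich: "\<mu> \<in> P2 \<Longrightarrow> \<exists>\<xi>\<in>borel_measurable G. distr M borel \<xi> = \<mu>"

definition augmented_filtration ::
  "'a measure \<Rightarrow> (real \<Rightarrow> 'a \<Rightarrow> real) \<Rightarrow> 'a measure \<Rightarrow> real \<Rightarrow> 'a measure" where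
  "augmented_filtration M B G t =
     sigma (space M) (sets G \<union> generated_events M B {0..t} \<union> null_sets M)"

definition L2_rv :: "'a measure \<Rightarrow> 'a measure \<Rightarrow> ('a \<Rightarrow> real) set" where
  "L2_rv M F0 = {\<xi>\<in>borel_measurable F0. integrable M (\<lambda>\<omega>. (\<xi> \<omega>)\<^sup>2)}"


section \<open>The discounted space of processes\<close>

text \<open>Processes are indexed by all reals, but only times \<open>t \<ge> 0\<close> matter.  The squared norm is
  extended-real valued, so it is infinite (rather than undefined) outside the space.\<close>

definition sqnorm_r ::
  "'a measure \<Rightarrow> real \<Rightarrow> (real \<Rightarrow> 'a \<Rightarrow> real) \<Rightarrow> ennreal" where
  "sqnorm_r M r v =
     (\<integral>\<^sup>+\<omega>. (\<integral>\<^sup>+t\<in>{0..}. ennreal (exp (- r * t) * (v t \<omega>)\<^sup>2) \<partial>lborel) \<partial>M)"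

definition Lr2 ::
  "'a measure \<Rightarrow> (real \<Rightarrow> 'a measure) \<Rightarrow> real \<Rightarrow> (real \<Rightarrow> 'a \<Rightarrow> real) set" where
  "Lr2 M F r = {v. (\<forall>t\<ge>0. v t \<in> borel_measurable (F t)) \<and>
     (\<lambda>(t, \<omega>). v t \<omega>) \<in> borel_measurable (restrict_space borel {0..} \<Otimes>\<^sub>M M) \<and>
     sqnorm_r M r v < \<infinity>}"


section \<open>The Ito integral\<close>

text \<open>The data \<open>n\<close>, \<open>\<tau>\<close>, \<open>\<phi>\<close> encode the simple process that equals \<open>\<phi> i\<close> on the time
  interval from \<open>\<tau> i\<close> (excluded) to \<open>\<tau> (i + 1)\<close> (included), for \<open>i < n\<close>.\<close>

definition simple_process ::
  "(real \<Rightarrow> 'a measure) \<Rightarrow> nat \<Rightarrow> (nat \<Rightarrow> real) \<Rightarrow> (nat \<Rightarrow> 'a \<Rightarrow> real) \<Rightarrow> bool" where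
  "simple_process F n \<tau> \<phi> \<longleftrightarrow> 0 \<le> \<tau> 0 \<and> (\<forall>i<n. \<tau> i \<le> \<tau> (Suc i)) \<and>
     (\<forall>i<n. \<phi> i \<in> borel_measurable (F (\<tau> i)) \<and>
            (\<exists>K. \<forall>\<omega>\<in>space (F (\<tau> i)). \<bar>\<phi> i \<omega>\<bar> \<le> K))"

definition simple_value ::
  "nat \<Rightarrow> (nat \<Rightarrow> real) \<Rightarrow> (nat \<Rightarrow> 'a \<Rightarrow> real) \<Rightarrow> real \<Rightarrow> 'a \<Rightarrow> real" where
  "simple_value n \<tau> \<phi> s \<omega> = (\<Sum>i<n. \<phi> i \<omega> * indicator {\<tau> i<..\<tau> (Suc i)} s)"

definition simple_integral ::
  "(real \<Rightarrow> 'a \<Rightarrow> real) \<Rightarrow> nat \<Rightarrow> (nat \<Rightarrow> real) \<Rightarrow> (nat \<Rightarrow> 'a \<Rightarrow> real) \<Rightarrow> real \<Rightarrow> 'a \<Rightarrow> real" where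
  "simple_integral B n \<tau> \<phi> t \<omega> =
     (\<Sum>i<n. \<phi> i \<omega> * (B (min t (\<tau> (Suc i))) \<omega> - B (min t (\<tau> i)) \<omega>))"

text \<open>\<open>J\<close> is (a version of) the integral of \<open>Z\<close> against \<open>B\<close> over \<open>[0, t]\<close>, as the usual
  mean-square limit of integrals of simple processes.\<close>

definition ito_integral_at ::
  "'a measure \<Rightarrow> (real \<Rightarrow> 'a measure) \<Rightarrow> (real \<Rightarrow> 'a \<Rightarrow> real) \<Rightarrow> (real \<Rightarrow> 'a \<Rightarrow> real) \<Rightarrow>
   real \<Rightarrow> ('a \<Rightarrow> real) \<Rightarrow> bool" where
  "ito_integral_at M F B Z t J \<longleftrightarrow>
     (\<exists>n \<tau> \<phi>. (\<forall>k::nat. simple_process F (n k) (\<tau> k) (\<phi> k)) \<and>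
       (\<lambda>k. \<integral>\<^sup>+\<omega>. (\<integral>\<^sup>+s\<in>{0..t}.
          ennreal ((simple_value (n k) (\<tau> k) (\<phi> k) s \<omega> - Z s \<omega>)\<^sup>2) \<partial>lborel) \<partial>M)
         \<longlonglongrightarrow> 0 \<and>
       (\<lambda>k. \<integral>\<^sup>+\<omega>. ennreal ((simple_integral B (n k) (\<tau> k) (\<phi> k) t \<omega> - J \<omega>)\<^sup>2) \<partial>M)
         \<longlonglongrightarrow> 0)"

text \<open>\<open>I\<close> is the adapted, almost surely continuous version of the integral process.\<close>

definition ito_integral ::
  "'a measure \<Rightarrow> (real \<Rightarrow> 'a measure) \<Rightarrow> (real \<Rightarrow> 'a \<Rightarrow> real) \<Rightarrow> (real \<Rightarrow> 'a \<Rightarrow> real) \<Rightarrow>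
   (real \<Rightarrow> 'a \<Rightarrow> real) \<Rightarrow> bool" where
  "ito_integral M F B Z I \<longleftrightarrow>
     (\<forall>t\<ge>0. I t \<in> borel_measurable (F t) \<and> ito_integral_at M F B Z t (I t)) \<and>
     (AE \<omega> in M. continuous_on {0..} (\<lambda>t. I t \<omega>))"


section \<open>The Hamiltonian\<close>

text \<open>The third argument of \<open>b\<close> and \<open>f\<close> is the control; functions of a measure are only
  constrained on \<open>P2\<close>.\<close>

definition partial_x ::
  "(real \<Rightarrow> real measure \<Rightarrow> real \<Rightarrow> real) \<Rightarrow> real \<Rightarrow> real measure \<Rightarrow> real \<Rightarrow> real" where
  "partial_x H x \<mu> y = deriv (\<lambda>u. H u \<mu> y) x"

definition partial_y ::
  "(real \<Rightarrow> real measure \<Rightarrow> real \<Rightarrow> real) \<Rightarrow> real \<Rightarrow> real measure \<Rightarrow> real \<Rightarrow> real" where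
  "partial_y H x \<mu> y = deriv (\<lambda>v. H x \<mu> v) y"

definition has_partials :: "(real \<Rightarrow> real measure \<Rightarrow> real \<Rightarrow> real) \<Rightarrow> bool" where
  "has_partials H \<longleftrightarrow> (\<forall>x y. \<forall>\<mu>\<in>P2.
     (\<lambda>u. H u \<mu> y) differentiable (at x) \<and> (\<lambda>v. H x \<mu> v) differentiable (at y))"

definition has_second_partials :: "(real \<Rightarrow> real measure \<Rightarrow> real \<Rightarrow> real) \<Rightarrow> bool" where
  "has_second_partials H \<longleftrightarrow>
     has_partials H \<and> has_partials (partial_x H) \<and> has_partials (partial_y H)"

definition jointly_continuous :: "(real \<Rightarrow> real measure \<Rightarrow> real \<Rightarrow> real) \<Rightarrow> bool" where
  "jointly_continuous H \<longleftrightarrow> (\<forall>x y. \<forall>\<mu>\<in>P2. \<forall>\<epsilon>>0. \<exists>\<delta>>0. \<forall>x' y'. \<forall>\<mu>'\<in>P2.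
     \<bar>x' - x\<bar> < \<delta> \<and> W2 \<mu>' \<mu> < \<delta> \<and> \<bar>y' - y\<bar> < \<delta> \<longrightarrow> \<bar>H x' \<mu>' y' - H x \<mu> y\<bar> < \<epsilon>)"

definition is_hamiltonian ::
  "(real \<Rightarrow> real measure \<Rightarrow> real \<Rightarrow> real) \<Rightarrow> (real \<Rightarrow> real measure \<Rightarrow> real \<Rightarrow> real) \<Rightarrow>
   (real \<Rightarrow> real \<Rightarrow> real) \<Rightarrow> (real \<Rightarrow> real measure \<Rightarrow> real \<Rightarrow> real) \<Rightarrow> bool" where
  "is_hamiltonian b f \<alpha> H \<longleftrightarrow> (\<forall>x y. \<forall>\<mu>\<in>P2.
     (\<forall>a. is_arg_min (\<lambda>a. b x \<mu> a * y + f x \<mu> a) (\<lambda>_. True) a \<longleftrightarrow> a = \<alpha> x y) \<and>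
     H x \<mu> y = b x \<mu> (\<alpha> x y) * y + f x \<mu> (\<alpha> x y) \<and>
     ((\<lambda>v. H x \<mu> v) has_real_derivative b x \<mu> (\<alpha> x y)) (at y))"


section \<open>The forward-backward equations\<close>

text \<open>The system with a prescribed flow \<open>m\<close> of laws and initial value \<open>\<eta>\<close>.  The equations
  hold almost surely for all times simultaneously; integrability of the drifts is part of the
  notion of solution, since the Lebesgue integral is \<open>0\<close> by convention otherwise.\<close>

definition fbsde_solution ::
  "'a measure \<Rightarrow> (real \<Rightarrow> 'a \<Rightarrow> real) \<Rightarrow> 'a measure \<Rightarrow>
   (real \<Rightarrow> real measure \<Rightarrow> real \<Rightarrow> real) \<Rightarrow> real \<Rightarrow> (real \<Rightarrow> real measure) \<Rightarrow> ('a \<Rightarrow> real) \<Rightarrow>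
   (real \<Rightarrow> 'a \<Rightarrow> real) \<Rightarrow> (real \<Rightarrow> 'a \<Rightarrow> real) \<Rightarrow> (real \<Rightarrow> 'a \<Rightarrow> real) \<Rightarrow> bool" where
  "fbsde_solution M B G H r m \<eta> X Y Z \<longleftrightarrow>
     (let F = augmented_filtration M B G;
          p = (\<lambda>\<omega> s. partial_y H (X s \<omega>) (m s) (Y s \<omega>));
          q = (\<lambda>\<omega> s. partial_x H (X s \<omega>) (m s) (Y s \<omega>) - r * Y s \<omega>)
      in X \<in> Lr2 M F r \<and> Y \<in> Lr2 M F r \<and> Z \<in> Lr2 M F r \<and>
         (AE \<omega> in M. \<forall>t\<ge>0. set_integrable lborel {0..t} (p \<omega>) \<and>
            X t \<omega> = \<eta> \<omega> + (LINT s:{0..t}|lborel. p \<omega> s) + B t \<omega>) \<and>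
         (\<exists>I. ito_integral M F B Z I \<and>
            (AE \<omega> in M. \<forall>t\<ge>0. set_integrable lborel {0..t} (q \<omega>) \<and>
               Y t \<omega> = Y 0 \<omega> - (LINT s:{0..t}|lborel. q \<omega> s) + I t \<omega>)))"

definition law_flow :: "'a measure \<Rightarrow> (real \<Rightarrow> 'a \<Rightarrow> real) \<Rightarrow> real \<Rightarrow> real measure" where
  "law_flow M X t = distr M borel (X t)"

definition mkv_solution ::
  "'a measure \<Rightarrow> (real \<Rightarrow> 'a \<Rightarrow> real) \<Rightarrow> 'a measure \<Rightarrow>
   (real \<Rightarrow> real measure \<Rightarrow> real \<Rightarrow> real) \<Rightarrow> real \<Rightarrow> ('a \<Rightarrow> real) \<Rightarrow>
   (real \<Rightarrow> 'a \<Rightarrow> real) \<Rightarrow> (real \<Rightarrow> 'a \<Rightarrow> real) \<Rightarrow> (real \<Rightarrow> 'a \<Rightarrow> real) \<Rightarrow> bool" where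
  "mkv_solution M B G H r \<xi> X Y Z \<longleftrightarrow>
     fbsde_solution M B G H r (law_flow M X) \<xi> X Y Z"

text \<open>Here \<open>X\<xi>\<close> is the forward component of the solution started from \<open>\<xi>\<close>; it enters only
  through its flow of laws.\<close>

definition decoupled_solution ::
  "'a measure \<Rightarrow> (real \<Rightarrow> 'a \<Rightarrow> real) \<Rightarrow> 'a measure \<Rightarrow>
   (real \<Rightarrow> real measure \<Rightarrow> real \<Rightarrow> real) \<Rightarrow> real \<Rightarrow> (real \<Rightarrow> 'a \<Rightarrow> real) \<Rightarrow> real \<Rightarrow>
   (real \<Rightarrow> 'a \<Rightarrow> real) \<Rightarrow> (real \<Rightarrow> 'a \<Rightarrow> real) \<Rightarrow> (real \<Rightarrow> 'a \<Rightarrow> real) \<Rightarrow> bool" where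
  "decoupled_solution M B G H r X\<xi> x X Y Z \<longleftrightarrow>
     fbsde_solution M B G H r (law_flow M X\<xi>) (\<lambda>_. x) X Y Z"

end

theory Submission
  imports Defs
begin

text \<open>
  Let \<open>x\<close> and \<open>y\<close> be the differences of the forward and of the backward components of two solutions,
  with drifts \<open>p\<close> of \<open>x\<close> and \<open>- q\<close> of \<open>y\<close>.  The Brownian motions cancel in \<open>x\<close>, which is therefore
  pathwise absolutely continuous, so that no Ito formula is needed for the product of \<open>x\<close> and \<open>y\<close>:
  Fubini's theorem and the orthogonality of the increments of the martingale part of \<open>y\<close> to the past
  give the discounted product rule.  Its boundary term vanishes at infinity, which leaves

    \<open>E [x\<^sub>0 y\<^sub>0] + E [\<integral> exp (- r t) (p\<^sub>t y\<^sub>t - x\<^sub>t (q\<^sub>t + r y\<^sub>t)) dt] = 0\<close>.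

  By monotonicity the norms of \<open>x\<close> and \<open>y\<close> are then controlled by \<open>E [x\<^sub>0 y\<^sub>0]\<close> and the Wasserstein
  distance of the two flows, and \<open>E [y\<^sub>0\<^sup>2]\<close> is controlled by these norms, as \<open>y\<^sub>0\<close> is the conditional
  expectation of \<open>y\<^sub>t + \<integral> q\<close> for every \<open>t\<close>.  Young's inequality closes the estimate.  When the flow
  is frozen, everything may be restricted to an event of \<open>F\<^sub>0\<close>, which turns the bound on the mean of
  \<open>y\<^sub>0\<^sup>2\<close> into an almost sure one.
\<close>

subsection \<open>Square integrable functions\<close>

text \<open>Membership in \<open>Lr2\<close> gives second moments only for almost every time,
  whereas the product rule, the laws of the flow and the value at time 0 need them at each fixed
  time. The equations supply them: the forward one from a dominating function of the drift, the
  backward one from a single good time. A second obstacle is circular: measurability of the drifts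
  in time comes from continuity of the flow in \<open>W2\<close>, which is itself a property of the
  solution. It is obtained first, from a domination by mean-square distances, which are measurable
  in time by Fubini. In the coupled system the Wasserstein term is at most the mean-square distance
  of the forward components, so it is absorbed on the left since
  \<open>C\<^sub>0 < \<kappa>\<close>; this gives the first inequality. In the decoupled system the
  flows are fixed, and their distance, controlled by the first inequality, enters as a datum. Being
  deterministic, it scales with the probability of the event to which the estimate is restricted,
  just like a constant initial gap; the almost sure bound rests on this homogeneity.\<close>

definition sq_integrable :: "'a measure \<Rightarrow> ('a \<Rightarrow> real) \<Rightarrow> bool" where
  "sq_integrable M f \<longleftrightarrow> f \<in> borel_measurable M \<and> integrable M (\<lambda>x. (f x)\<^sup>2)"

lemma sq_integrable_measurable: "sq_integrable M f \<Longrightarrow> f \<in> borel_measurable M"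
  and sq_integrable_integrable_sq: "sq_integrable M f \<Longrightarrow> integrable M (\<lambda>x. (f x)\<^sup>2)"
  by (auto simp: sq_integrable_def)

lemma sum_sq_le: "(a + b)\<^sup>2 \<le> 2 * a\<^sup>2 + 2 * (b::real)\<^sup>2"
  using sum_squares_bound[of a b] by (simp add: power2_sum)

lemma abs_mult_le_sq: "\<bar>a * b\<bar> \<le> a\<^sup>2 + (b::real)\<^sup>2"
proof -
  have "2 * \<bar>a\<bar> * \<bar>b\<bar> \<le> a\<^sup>2 + b\<^sup>2" using sum_squares_bound[of "\<bar>a\<bar>" "\<bar>b\<bar>"] by simp
  moreover have "0 \<le> a\<^sup>2 + b\<^sup>2" by simp
  ultimately show ?thesis unfolding abs_mult by linarith
qed

lemma sq_integrable_bound: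
  assumes "sq_integrable M g" "f \<in> borel_measurable M" "AE x in M. \<bar>f x\<bar> \<le> \<bar>g x\<bar>"
  shows "sq_integrable M f"
  unfolding sq_integrable_def
proof
  show "integrable M (\<lambda>x. (f x)\<^sup>2)"
    by (rule Bochner_Integration.integrable_bound[OF sq_integrable_integrable_sq[OF assms(1)]])
      (use assms(2,3) in \<open>auto simp: abs_le_square_iff elim!: eventually_mono\<close>)
qed fact

lemma sq_integrable_mult:
  assumes "sq_integrable M f" "sq_integrable M g"
  shows "integrable M (\<lambda>x. f x * g x)"
  by (rule Bochner_Integration.integrable_bound[of M "\<lambda>x. (f x)\<^sup>2 + (g x)\<^sup>2"])
    (use assms abs_mult_le_sq in \<open>auto simp: sq_integrable_def\<close>)

lemma sq_integrable_add:
  assumes "sq_integrable M f" "sq_integrable M g"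
  shows "sq_integrable M (\<lambda>x. f x + g x)"
  unfolding sq_integrable_def
proof
  show "integrable M (\<lambda>x. (f x + g x)\<^sup>2)"
    by (rule Bochner_Integration.integrable_bound[of M "\<lambda>x. 2 * (f x)\<^sup>2 + 2 * (g x)\<^sup>2"])
      (use assms sum_sq_le in \<open>auto simp: sq_integrable_def\<close>)
qed (use assms in \<open>auto simp: sq_integrable_def\<close>)

lemma sq_integrable_cmult:
  assumes "sq_integrable M f"
  shows "sq_integrable M (\<lambda>x. c * f x)"
  using assms by (auto simp: sq_integrable_def power_mult_distrib)

lemma sq_integrable_diff:
  assumes "sq_integrable M f" "sq_integrable M g"
  shows "sq_integrable M (\<lambda>x. f x - g x)"
  using sq_integrable_add[OF assms(1) sq_integrable_cmult[OF assms(2), of "-1"]] by simp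

lemma sq_integrable_abs:
  assumes "sq_integrable M f"
  shows "sq_integrable M (\<lambda>x. \<bar>f x\<bar>)"
  using assms by (auto simp: sq_integrable_def)

lemma sq_integrable_cong:
  assumes "sq_integrable M f" "\<And>x. x \<in> space M \<Longrightarrow> f x = g x"
  shows "sq_integrable M g"
proof -
  have "g \<in> borel_measurable M \<longleftrightarrow> f \<in> borel_measurable M"
    by (rule measurable_cong) (simp add: assms)
  moreover have "integrable M (\<lambda>x. (g x)\<^sup>2) \<longleftrightarrow> integrable M (\<lambda>x. (f x)\<^sup>2)"
    by (rule Bochner_Integration.integrable_cong) (simp_all add: assms)
  ultimately show ?thesis using assms(1) by (simp add: sq_integrable_def)
qed

lemma sq_integrable_iff_nn:
  assumes "f \<in> borel_measurable M"
  shows "sq_integrable M f \<longleftrightarrow> (\<integral>\<^sup>+x. ennreal ((f x)\<^sup>2) \<partial>M) < \<infinity>"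
  using assms by (simp add: sq_integrable_def integrable_iff_bounded)

lemma (in finite_measure) sq_integrable_const: "sq_integrable M (\<lambda>_. c)"
  by (simp add: sq_integrable_def)

lemma (in finite_measure) sq_integrable_imp_integrable:
  assumes "sq_integrable M f"
  shows "integrable M f"
  using sq_integrable_mult[OF assms sq_integrable_const[of 1]] by simp

text \<open>Cauchy-Schwarz, read off from the nonnegative integral of the square of
  \<open>m * f x - I * g x\<close>. With \<open>m\<close> the squared norm of \<open>g\<close>, it
  equals \<open>m * (m * J - I\<^sup>2)\<close>; if \<open>m = 0\<close>, then \<open>g\<close>
  vanishes almost everywhere.\<close>

lemma sq_integral_mult_le:
  assumes "sq_integrable M f" "sq_integrable M g"
  shows "(\<integral>x. f x * g x \<partial>M)\<^sup>2 \<le> (\<integral>x. (f x)\<^sup>2 \<partial>M) * (\<integral>x. (g x)\<^sup>2 \<partial>M)"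
proof -
  define I J m where "I = (\<integral>x. f x * g x \<partial>M)" and "J = (\<integral>x. (f x)\<^sup>2 \<partial>M)" and "m = (\<integral>x. (g x)\<^sup>2 \<partial>M)"
  have int: "integrable M (\<lambda>x. f x * g x)" "integrable M (\<lambda>x. (f x)\<^sup>2)" "integrable M (\<lambda>x. (g x)\<^sup>2)"
    using sq_integrable_mult[OF assms] assms by (auto simp: sq_integrable_def)
  have "0 \<le> (\<integral>x. (m * f x - I * g x)\<^sup>2 \<partial>M)" by simp
  also have "(\<lambda>x. (m * f x - I * g x)\<^sup>2)
      = (\<lambda>x. m\<^sup>2 * (f x)\<^sup>2 - 2 * m * I * (f x * g x) + I\<^sup>2 * (g x)\<^sup>2)"
    by (auto simp: power2_eq_square algebra_simps)
  also have "(\<integral>x. m\<^sup>2 * (f x)\<^sup>2 - 2 * m * I * (f x * g x) + I\<^sup>2 * (g x)\<^sup>2 \<partial>M)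
      = m\<^sup>2 * J - 2 * m * I * I + I\<^sup>2 * m"
    using int by (simp add: I_def J_def m_def)
  also have "\<dots> = m * (m * J - I\<^sup>2)" by (simp add: power2_eq_square algebra_simps)
  finally have *: "0 \<le> m * (m * J - I\<^sup>2)" .
  have "0 \<le> m" by (simp add: m_def)
  show ?thesis
  proof (cases "m = 0")
    case True
    then have "AE x in M. (g x)\<^sup>2 = 0"
      using integral_nonneg_eq_0_iff_AE[OF int(3)] by (simp add: m_def)
    then have "AE x in M. f x * g x = 0" by eventually_elim simp
    then have "I = 0" unfolding I_def by (rule integral_eq_zero_AE)
    then show ?thesis using True by (simp add: I_def m_def)
  next
    case False
    then have "0 \<le> m * J - I\<^sup>2" using * \<open>0 \<le> m\<close> by (simp add: zero_le_mult_iff)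
    then show ?thesis by (simp add: I_def J_def m_def mult.commute)
  qed
qed

lemma (in finite_measure) sq_integral_le:
  assumes "sq_integrable M f"
  shows "(\<integral>x. f x \<partial>M)\<^sup>2 \<le> measure M (space M) * (\<integral>x. (f x)\<^sup>2 \<partial>M)"
  using sq_integral_mult_le[OF assms sq_integrable_const[of 1]] by (simp add: mult.commute)

text \<open>Convergence of the extended nonnegative distances makes one of them finite, and
  \<open>g\<close> differs from that \<open>f k\<close> by a square integrable function.
  Cauchy-Schwarz then gives weak convergence, the form in which mean-square limits of simple
  integrals are passed to expectations.\<close>

lemma sq_integrable_limit:
  assumes f: "\<And>k. sq_integrable M (f k)" and g: "g \<in> borel_measurable M"
    and lim: "(\<lambda>k::nat. \<integral>\<^sup>+x. ennreal ((f k x - g x)\<^sup>2) \<partial>M) \<longlonglongrightarrow> 0"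
  shows "sq_integrable M g"
    and "sq_integrable M \<phi> \<Longrightarrow> (\<lambda>k. \<integral>x. \<phi> x * f k x \<partial>M) \<longlonglongrightarrow> (\<integral>x. \<phi> x * g x \<partial>M)"
proof -
  note [measurable] = g
  have [measurable]: "f k \<in> borel_measurable M" for k using f by (simp add: sq_integrable_def)
  have "eventually (\<lambda>k. (\<integral>\<^sup>+x. ennreal ((f k x - g x)\<^sup>2) \<partial>M) < 1) sequentially"
    by (rule order_tendstoD(2)[OF lim]) simp
  then have ev: "eventually (\<lambda>k. sq_integrable M (\<lambda>x. f k x - g x)) sequentially"
    by eventually_elim (subst sq_integrable_iff_nn, auto intro: less_trans)
  then obtain k where "sq_integrable M (\<lambda>x. f k x - g x)" by (auto dest: eventually_happens)
  from sq_integrable_diff[OF f this, of k] show sq: "sq_integrable M g" by simp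
  assume \<phi>: "sq_integrable M \<phi>"
  have d: "sq_integrable M (\<lambda>x. f k x - g x)" for k by (rule sq_integrable_diff[OF f sq])
  have "(\<lambda>k. ennreal (\<integral>x. (f k x - g x)\<^sup>2 \<partial>M)) \<longlonglongrightarrow> ennreal 0"
    using lim d by (subst (asm) nn_integral_eq_integral) (auto simp: sq_integrable_def)
  then have "(\<lambda>k. \<integral>x. (f k x - g x)\<^sup>2 \<partial>M) \<longlonglongrightarrow> 0"
    by (subst (asm) tendsto_ennreal_iff) auto
  then have "(\<lambda>k. (\<integral>x. (\<phi> x)\<^sup>2 \<partial>M) * (\<integral>x. (f k x - g x)\<^sup>2 \<partial>M)) \<longlonglongrightarrow> 0"
    by (rule tendsto_mult_right_zero)
  then have "(\<lambda>k. (\<integral>x. \<phi> x * (f k x - g x) \<partial>M)\<^sup>2) \<longlonglongrightarrow> 0"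
    by (rule tendsto_sandwich[OF _ _ tendsto_const, rotated 2])
      (auto intro!: always_eventually sq_integral_mult_le \<phi> d)
  then have "(\<lambda>k. \<integral>x. \<phi> x * (f k x - g x) \<partial>M) \<longlonglongrightarrow> 0"
    using tendsto_real_sqrt[of _ 0] by (fastforce simp: tendsto_rabs_zero_iff)
  also have "(\<lambda>k. \<integral>x. \<phi> x * (f k x - g x) \<partial>M)
      = (\<lambda>k. (\<integral>x. \<phi> x * f k x \<partial>M) - (\<integral>x. \<phi> x * g x \<partial>M))"
    using sq_integrable_mult[OF \<phi> f] sq_integrable_mult[OF \<phi> sq] by (simp add: right_diff_distrib)
  finally show "(\<lambda>k. \<integral>x. \<phi> x * f k x \<partial>M) \<longlonglongrightarrow> (\<integral>x. \<phi> x * g x \<partial>M)"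
    by (simp add: LIM_zero_iff)
qed

lemma sq_integrable_snd:
  assumes "finite_measure U" "sigma_finite_measure M" "sq_integrable M f"
  shows "sq_integrable (U \<Otimes>\<^sub>M M) (\<lambda>(s, \<omega>). f \<omega>)"
proof -
  interpret U: finite_measure U by fact
  interpret M: sigma_finite_measure M by fact
  have [measurable]: "f \<in> borel_measurable M" using assms by (simp add: sq_integrable_def)
  have "(\<integral>\<^sup>+z. ennreal ((case z of (s, \<omega>) \<Rightarrow> f \<omega>)\<^sup>2) \<partial>(U \<Otimes>\<^sub>M M))
     = (\<integral>\<^sup>+s. \<integral>\<^sup>+\<omega>. ennreal ((f \<omega>)\<^sup>2) \<partial>M \<partial>U)"
    by (subst M.nn_integral_fst[symmetric]) auto
  also have "\<dots> = (\<integral>\<^sup>+\<omega>. ennreal ((f \<omega>)\<^sup>2) \<partial>M) * emeasure U (space U)" by simp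
  also have "\<dots> < \<infinity>"
    using assms(3) U.emeasure_finite[of "space U"]
    by (subst (asm) sq_integrable_iff_nn) (auto simp: ennreal_mult_eq_top_iff less_top[symmetric])
  finally show ?thesis by (subst sq_integrable_iff_nn) (auto simp: case_prod_unfold)
qed

text \<open>Fubini gives square integrable sections for almost every \<open>\<omega>\<close>, and
  Cauchy-Schwarz in time against the constant 1 gives the bound. The absolute value stays inside, so
  that integrals over all Borel sets of times are dominated at once.\<close>

lemma sq_integrable_section_integral:
  assumes "finite_measure U" "sigma_finite_measure M" "sq_integrable (U \<Otimes>\<^sub>M M) (case_prod f)"
  shows "sq_integrable M (\<lambda>\<omega>. \<integral>s. \<bar>f s \<omega>\<bar> \<partial>U)"
    and "(\<integral>\<omega>. (\<integral>s. \<bar>f s \<omega>\<bar> \<partial>U)\<^sup>2 \<partial>M)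
      \<le> measure U (space U) * (\<integral>(s, \<omega>). (f s \<omega>)\<^sup>2 \<partial>(U \<Otimes>\<^sub>M M))"
    and "AE \<omega> in M. sq_integrable U (\<lambda>s. f s \<omega>)"
proof -
  interpret U: finite_measure U by fact
  interpret M: sigma_finite_measure M by fact
  interpret UM: pair_sigma_finite U M ..
  have m[measurable]: "case_prod f \<in> borel_measurable (U \<Otimes>\<^sub>M M)"
    using assms by (simp add: sq_integrable_def)
  have int: "integrable (U \<Otimes>\<^sub>M M) (\<lambda>(s, \<omega>). (f s \<omega>)\<^sup>2)"
    using assms(3) by (simp add: sq_integrable_def case_prod_unfold)
  have "AE \<omega> in M. integrable U (\<lambda>s. (f s \<omega>)\<^sup>2)"
    by (rule UM.AE_integrable_snd) (use int in simp)
  then show AE: "AE \<omega> in M. sq_integrable U (\<lambda>s. f s \<omega>)"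
    using AE_space by eventually_elim (auto simp: sq_integrable_def)
  have int2: "integrable M (\<lambda>\<omega>. \<integral>s. (f s \<omega>)\<^sup>2 \<partial>U)"
    by (rule UM.integrable_snd) (use int in simp)
  have le: "AE \<omega> in M. (\<integral>s. \<bar>f s \<omega>\<bar> \<partial>U)\<^sup>2 \<le> measure U (space U) * (\<integral>s. (f s \<omega>)\<^sup>2 \<partial>U)"
    using AE
  proof eventually_elim
    case (elim \<omega>)
    then show ?case using U.sq_integral_le[OF sq_integrable_abs[OF elim]] by simp
  qed
  have m2[measurable]: "(\<lambda>\<omega>. \<integral>s. \<bar>f s \<omega>\<bar> \<partial>U) \<in> borel_measurable M"
    by measurable
  have int3: "integrable M (\<lambda>\<omega>. (\<integral>s. \<bar>f s \<omega>\<bar> \<partial>U)\<^sup>2)"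
    by (rule Bochner_Integration.integrable_bound[OF integrable_mult_right[OF int2, of "measure U (space U)"]])
      (use le in \<open>auto elim!: eventually_mono\<close>)
  then show "sq_integrable M (\<lambda>\<omega>. \<integral>s. \<bar>f s \<omega>\<bar> \<partial>U)" by (simp add: sq_integrable_def)
  have "(\<integral>\<omega>. (\<integral>s. \<bar>f s \<omega>\<bar> \<partial>U)\<^sup>2 \<partial>M) \<le> (\<integral>\<omega>. measure U (space U) * (\<integral>s. (f s \<omega>)\<^sup>2 \<partial>U) \<partial>M)"
    by (rule integral_mono_AE[OF int3 _ le]) (use int2 in auto)
  also have "\<dots> = measure U (space U) * (\<integral>(s, \<omega>). (f s \<omega>)\<^sup>2 \<partial>(U \<Otimes>\<^sub>M M))"
    by (subst UM.integral_snd[symmetric]) (use int int2 in auto)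
  finally show "(\<integral>\<omega>. (\<integral>s. \<bar>f s \<omega>\<bar> \<partial>U)\<^sup>2 \<partial>M)
      \<le> measure U (space U) * (\<integral>(s, \<omega>). (f s \<omega>)\<^sup>2 \<partial>(U \<Otimes>\<^sub>M M))" .
qed

subsection \<open>Time measures\<close>

text \<open>Both time measures live on the Borel sets of the whole line and give no mass to negative
  times. Joint measurability can thus always be taken over \<open>borel \<Otimes>\<^sub>M M\<close>,
  whichever time measure is in use.\<close>

definition time_upto :: "real \<Rightarrow> real measure" where
  "time_upto T = density lborel (\<lambda>s. ennreal (indicator {0..T} s))"

definition time_disc :: "real \<Rightarrow> real measure" where
  "time_disc r = density lborel (\<lambda>s. ennreal (indicator {0..} s * exp (- r * s)))"

abbreviation disc :: "real \<Rightarrow> 'a measure \<Rightarrow> (real \<times> 'a) measure" where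
  "disc r M \<equiv> time_disc r \<Otimes>\<^sub>M M"

lemma sets_time_upto[measurable_cong, simp]: "sets (time_upto T) = sets borel"
  and space_time_upto[simp]: "space (time_upto T) = UNIV"
  and sets_time_disc[measurable_cong, simp]: "sets (time_disc r) = sets borel"
  and space_time_disc[simp]: "space (time_disc r) = UNIV"
  by (auto simp: time_upto_def time_disc_def)

lemma measure_time_upto:
  assumes "0 \<le> T"
  shows "emeasure (time_upto T) UNIV = ennreal T" "measure (time_upto T) UNIV = T"
proof -
  have "emeasure (time_upto T) UNIV = (\<integral>\<^sup>+s. indicator {0..T} s \<partial>lborel)"
    unfolding time_upto_def by (subst emeasure_density) (auto simp: ennreal_indicator)
  then show "emeasure (time_upto T) UNIV = ennreal T" using assms by simp
  then show "measure (time_upto T) UNIV = T" using assms by (simp add: measure_def)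
qed

lemma finite_time_upto: "finite_measure (time_upto T)"
proof
  show "emeasure (time_upto T) (space (time_upto T)) \<noteq> \<infinity>"
  proof (cases "0 \<le> T")
    case False
    then show ?thesis unfolding time_upto_def by (subst emeasure_density) auto
  qed (simp add: measure_time_upto)
qed

text \<open>The density is \<open>1 / r\<close> times that of the exponential law of rate
  \<open>r\<close>.\<close>

lemma finite_time_disc:
  assumes "r > 0"
  shows "finite_measure (time_disc r)"
proof
  have "emeasure (time_disc r) UNIV = (\<integral>\<^sup>+s. ennreal (indicator {0..} s * exp (- r * s)) \<partial>lborel)"
    unfolding time_disc_def by (subst emeasure_density) auto
  also have "\<dots> = (\<integral>\<^sup>+s. ennreal (exponential_density r s) * ennreal (1 / r) \<partial>lborel)"
    using assms by (intro nn_integral_cong)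
      (auto simp: exponential_density_def mult.commute simp flip: ennreal_mult split: split_indicator)
  also have "\<dots> = (\<integral>\<^sup>+s. ennreal (exponential_density r s) \<partial>lborel) * ennreal (1 / r)"
    by (rule nn_integral_multc) auto
  also have "(\<integral>\<^sup>+s. ennreal (exponential_density r s) \<partial>lborel) = 1"
    using prob_space.emeasure_space_1[OF prob_space_exponential_density[OF assms]]
    by (simp add: emeasure_density)
  finally show "emeasure (time_disc r) (space (time_disc r)) \<noteq> \<infinity>" by simp
qed

lemma integrable_time_upto:
  assumes "f \<in> borel_measurable borel"
  shows "integrable (time_upto T) f \<longleftrightarrow> set_integrable lborel {0..T} (f :: real \<Rightarrow> real)"
  unfolding time_upto_def set_integrable_def using assms
  by (subst integrable_density) auto

lemma integral_time_upto:
  assumes "f \<in> borel_measurable borel"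
  shows "(\<integral>s. f s \<partial>time_upto T) = (LINT s:{0..T}|lborel. (f s :: real))"
  unfolding time_upto_def set_lebesgue_integral_def using assms
  by (subst integral_density) auto

lemma integral_time_upto_after:
  assumes "f \<in> borel_measurable borel" "0 \<le> s"
  shows "(\<integral>u. indicator {s..} u * f u \<partial>time_upto T) = (LINT u:{s..T}|lborel. (f u :: real))"
  using assms unfolding set_lebesgue_integral_def
  by (subst integral_time_upto)
    (auto simp: set_lebesgue_integral_def intro!: Bochner_Integration.integral_cong
      split: split_indicator)

lemma integral_time_upto_before:
  assumes "f \<in> borel_measurable borel" "s \<le> T"
  shows "(\<integral>u. indicator {..s} u * f u \<partial>time_upto T) = (LINT u:{0..s}|lborel. (f u :: real))"
  using assms unfolding set_lebesgue_integral_def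
  by (subst integral_time_upto)
    (auto simp: set_lebesgue_integral_def intro!: Bochner_Integration.integral_cong
      split: split_indicator)

lemma AE_time_upto: "(\<And>s. 0 \<le> s \<Longrightarrow> s \<le> T \<Longrightarrow> P s) \<Longrightarrow> AE s in time_upto T. P s"
  unfolding time_upto_def by (subst AE_density) (auto split: split_indicator)

lemma AE_time_disc: "(\<And>s. 0 \<le> s \<Longrightarrow> P s) \<Longrightarrow> AE s in time_disc r. P s"
  unfolding time_disc_def by (subst AE_density) (auto split: split_indicator)

lemma AE_time_disc_imp_lborel:
  assumes "AE s in time_disc r. P s"
  shows "AE s in lborel. 0 \<le> s \<longrightarrow> P s"
  using assms unfolding time_disc_def
  by (subst (asm) AE_density) (auto elim!: eventually_mono split: split_indicator_asm)

lemma sq_integrable_time_upto: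
  assumes "sigma_finite_measure M" "sq_integrable (disc r M) (case_prod f)" "r > 0"
  shows "sq_integrable (time_upto T \<Otimes>\<^sub>M M) (case_prod f)"
    and "(\<integral>(s, \<omega>). (f s \<omega>)\<^sup>2 \<partial>(time_upto T \<Otimes>\<^sub>M M))
      \<le> exp (r * T) * (\<integral>(s, \<omega>). (f s \<omega>)\<^sup>2 \<partial>disc r M)"
proof -
  interpret M: sigma_finite_measure M by fact
  have "case_prod f \<in> borel_measurable (disc r M)"
    using assms by (simp add: sq_integrable_def)
  then have m[measurable]: "case_prod f \<in> borel_measurable (borel \<Otimes>\<^sub>M M)" by simp
  define g where "g s = (\<integral>\<^sup>+\<omega>. ennreal ((f s \<omega>)\<^sup>2) \<partial>M)" for s
  have [measurable]: "g \<in> borel_measurable borel" unfolding g_def by measurable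
  have eq1: "(\<integral>\<^sup>+z. ennreal ((case z of (s, \<omega>) \<Rightarrow> f s \<omega>)\<^sup>2) \<partial>(U \<Otimes>\<^sub>M M)) = (\<integral>\<^sup>+s. g s \<partial>U)"
    if [measurable_cong]: "sets U = sets borel" for U :: "real measure"
    unfolding g_def by (subst M.nn_integral_fst[symmetric]) auto
  \<comment> \<open>On \<open>[0, T]\<close> the discount factor is at least
    \<open>exp (- r * T)\<close>, so removing it costs \<open>exp (r * T)\<close>.\<close>
  have *: "indicator {0..T} s \<le> exp (r * T) * (indicator {0..} s * exp (- r * s) :: real)" for s
    using assms(3) by (auto split: split_indicator simp flip: exp_add)
  have "(\<integral>\<^sup>+s. g s \<partial>time_upto T) = (\<integral>\<^sup>+s. ennreal (indicator {0..T} s) * g s \<partial>lborel)"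
    unfolding time_upto_def by (subst nn_integral_density) auto
  also have "\<dots> \<le> (\<integral>\<^sup>+s. ennreal (exp (r * T)) * (ennreal (indicator {0..} s * exp (- r * s)) * g s) \<partial>lborel)"
    using * by (intro nn_integral_mono)
      (auto simp flip: mult.assoc ennreal_mult intro!: mult_right_mono ennreal_leI)
  also have "\<dots> = ennreal (exp (r * T)) * (\<integral>\<^sup>+s. g s \<partial>time_disc r)"
    unfolding time_disc_def by (subst nn_integral_density) (auto simp: nn_integral_cmult)
  finally have **: "(\<integral>\<^sup>+s. g s \<partial>time_upto T) \<le> ennreal (exp (r * T)) * (\<integral>\<^sup>+s. g s \<partial>time_disc r)" .
  have fin: "(\<integral>\<^sup>+s. g s \<partial>time_disc r) < \<infinity>"
    using assms(2) by (subst (asm) sq_integrable_iff_nn) (auto simp: eq1)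
  then show sq: "sq_integrable (time_upto T \<Otimes>\<^sub>M M) (case_prod f)"
    by (subst sq_integrable_iff_nn)
      (use ** in \<open>auto simp: eq1 ennreal_mult_less_top intro: le_less_trans\<close>)
  have "ennreal (\<integral>(s, \<omega>). (f s \<omega>)\<^sup>2 \<partial>(time_upto T \<Otimes>\<^sub>M M)) = (\<integral>\<^sup>+s. g s \<partial>time_upto T)"
    using sq by (subst eq1[symmetric]) (auto simp: sq_integrable_def case_prod_unfold nn_integral_eq_integral)
  moreover have "ennreal (\<integral>(s, \<omega>). (f s \<omega>)\<^sup>2 \<partial>disc r M) = (\<integral>\<^sup>+s. g s \<partial>time_disc r)"
    using assms(2)
    by (subst eq1[symmetric]) (auto simp: sq_integrable_def case_prod_unfold nn_integral_eq_integral)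
  ultimately have "ennreal (\<integral>(s, \<omega>). (f s \<omega>)\<^sup>2 \<partial>(time_upto T \<Otimes>\<^sub>M M))
      \<le> ennreal (exp (r * T)) * ennreal (\<integral>(s, \<omega>). (f s \<omega>)\<^sup>2 \<partial>disc r M)"
    using ** by simp
  moreover have "0 \<le> (\<integral>(s, \<omega>). (f s \<omega>)\<^sup>2 \<partial>disc r M)"
    by (rule integral_nonneg_AE) auto
  ultimately show "(\<integral>(s, \<omega>). (f s \<omega>)\<^sup>2 \<partial>(time_upto T \<Otimes>\<^sub>M M))
      \<le> exp (r * T) * (\<integral>(s, \<omega>). (f s \<omega>)\<^sup>2 \<partial>disc r M)"
    by (subst (asm) ennreal_mult[symmetric]) (auto simp: ennreal_le_iff)
qed

subsection \<open>Brownian increments\<close>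

lemma Int_stable_preimages: "Int_stable {f -` A \<inter> \<Omega> | A. A \<in> sets N}"
proof (rule Int_stableI)
  fix a b assume "a \<in> {f -` A \<inter> \<Omega> | A. A \<in> sets N}" "b \<in> {f -` A \<inter> \<Omega> | A. A \<in> sets N}"
  then obtain A A' where "A \<in> sets N" "A' \<in> sets N" "a = f -` A \<inter> \<Omega>" "b = f -` A' \<inter> \<Omega>" by auto
  then show "a \<inter> b \<in> {f -` A \<inter> \<Omega> | A. A \<in> sets N}"
    by (intro CollectI exI[of _ "A \<inter> A'"]) auto
qed

context brownian_setting
begin

abbreviation "F \<equiv> augmented_filtration M B G"

lemma generated_events_mono: "S \<subseteq> T \<Longrightarrow> generated_events M B S \<subseteq> generated_events M B T"
  unfolding generated_events_def by (intro sigma_sets_mono') auto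

lemma generated_events_subset:
  assumes "T \<subseteq> {0..}"
  shows "generated_events M B T \<subseteq> sets M"
  unfolding generated_events_def
  using assms B_measurable by (intro sets.sigma_sets_subset) (auto intro: measurable_sets)

lemma F_generators_subset: "sets G \<union> generated_events M B {0..t} \<union> null_sets M \<subseteq> sets M"
  using G_subalgebra generated_events_subset[of "{0..t}"] by (auto simp: subalgebra_def)

lemma space_F [simp]: "space (F t) = space M"
  by (simp add: augmented_filtration_def space_measure_of_conv)

lemma sets_F:
  "sets (F t) = sigma_sets (space M) (sets G \<union> generated_events M B {0..t} \<union> null_sets M)"
  unfolding augmented_filtration_def
  by (rule sets_measure_of) (use F_generators_subset[of t] sets.sets_into_space in blast)

lemma subalgebra_F: "subalgebra M (F t)"
  unfolding subalgebra_def sets_F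
  using sets.sigma_sets_subset[OF F_generators_subset] by simp

lemma F_mono: "s \<le> t \<Longrightarrow> sets (F s) \<subseteq> sets (F t)"
  unfolding sets_F using generated_events_mono[of "{0..s}" "{0..t}"]
  by (intro sigma_sets_mono') auto

lemma F_measurable_mono:
  assumes "s \<le> t" "f \<in> borel_measurable (F s)"
  shows "f \<in> borel_measurable (F t)"
  by (rule measurable_from_subalg[OF _ assms(2)]) (simp add: subalgebra_def F_mono[OF assms(1)])

lemma F_measurable: "f \<in> borel_measurable (F s) \<Longrightarrow> f \<in> borel_measurable M"
  by (rule measurable_from_subalg[OF subalgebra_F])

lemma B_F_measurable:
  assumes "0 \<le> s" "s \<le> t"
  shows "B s \<in> borel_measurable (F t)"
proof (rule measurableI)
  fix A :: "real set" assume "A \<in> sets borel"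
  then have "B s -` A \<inter> space M \<in> generated_events M B {0..t}"
    unfolding generated_events_def using assms by (intro sigma_sets.Basic UN_I[of s]) auto
  then show "B s -` A \<inter> space (F t) \<in> sets (F t)"
    unfolding sets_F space_F by (intro sigma_sets.Basic) auto
qed simp

section \<open>Independence of the increments from the augmented filtration\<close>

lemma increment_generated:
  assumes "0 \<le> s" "s < t" "A \<in> sets borel"
  shows "(\<lambda>\<omega>. B t \<omega> - B s \<omega>) -` A \<inter> space M \<in> generated_events M B {0..}"
proof -
  define N where "N = sigma (space M) (\<Union>s\<in>{0..}. {B s -` A \<inter> space M | A. A \<in> sets borel})"
  have sets_N: "sets N = generated_events M B {0..}"
    unfolding N_def generated_events_def by (rule sets_measure_of) auto
  have [simp]: "space N = space M" by (simp add: N_def space_measure_of_conv)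
  have [measurable]: "B u \<in> borel_measurable N" if "0 \<le> u" for u
  proof (rule measurableI)
    fix A :: "real set" assume "A \<in> sets borel"
    then show "B u -` A \<inter> space N \<in> sets N"
      unfolding sets_N generated_events_def using that by (intro sigma_sets.Basic UN_I[of u]) auto
  qed simp
  have "0 \<le> t" using assms by simp
  then have "(\<lambda>\<omega>. B t \<omega> - B s \<omega>) \<in> borel_measurable N" using assms by measurable
  from measurable_sets[OF this assms(3)] show ?thesis by (simp add: sets_N)
qed

text \<open>For \<open>g\<close> in \<open>G\<close>, \<open>d\<close> in the past of
  \<open>B\<close> and \<open>e\<close> an event of the increment, the probability of the
  intersection factorises in two moves: \<open>G\<close> is independent of the whole path, which
  contains both \<open>d\<close> and \<open>e\<close>, and the increment is independent of the
  past.\<close>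

lemma F_indep_increment:
  assumes st: "0 \<le> s" "s < t" and "a \<in> sets (F s)" "A \<in> sets borel"
  shows "prob (a \<inter> ((\<lambda>\<omega>. B t \<omega> - B s \<omega>) -` A \<inter> space M))
    = prob a * prob ((\<lambda>\<omega>. B t \<omega> - B s \<omega>) -` A \<inter> space M)"
proof -
  define E where "E = {(\<lambda>\<omega>. B t \<omega> - B s \<omega>) -` A \<inter> space M | A. A \<in> sets borel}"
  \<comment> \<open>A pi-system that generates \<open>F s\<close>. The null sets are added as a
    separate family, since independence is trivial for them.\<close>
  define R where "R = {a \<inter> d | a d. a \<in> sets G \<and> d \<in> generated_events M B {0..s}} \<union> null_sets M"
  have GM: "sets G \<subseteq> sets M" "space G = space M" using G_subalgebra by (auto simp: subalgebra_def)
  have gen_M: "generated_events M B {0..s} \<subseteq> sets M" by (rule generated_events_subset) auto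
  interpret gen: sigma_algebra "space M" "generated_events M B {0..s}"
    unfolding generated_events_def by (rule sigma_algebra_sigma_sets) auto
  have R_M: "R \<subseteq> sets M" unfolding R_def using GM gen_M by auto
  have E_gen: "E \<subseteq> generated_events M B {0..}"
    unfolding E_def using increment_generated[OF st] by auto
  have gen0_M: "generated_events M B {0..} \<subseteq> sets M" by (rule generated_events_subset) auto
  interpret gen0: sigma_algebra "space M" "generated_events M B {0..}"
    unfolding generated_events_def by (rule sigma_algebra_sigma_sets) auto
  have gen_gen0: "generated_events M B {0..s} \<subseteq> generated_events M B {0..}"
    by (rule generated_events_mono) auto
  have "indep_set R E"
  proof (rule indep_setI)
    fix a e assume a: "a \<in> R" and e: "e \<in> E"
    show "prob (a \<inter> e) = prob a * prob e"
    proof (cases "a \<in> null_sets M")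
      case True
      moreover have "e \<in> sets M" using e E_gen gen0_M by auto
      ultimately have "a \<inter> e \<in> null_sets M" by (simp add: null_set_Int2)
      with True show ?thesis by (simp add: measure_def null_setsD1)
    next
      case False
      then obtain g d where g: "g \<in> sets G" and d: "d \<in> generated_events M B {0..s}" and "a = g \<inter> d"
        using a by (auto simp: R_def)
      moreover have "prob (g \<inter> (d \<inter> e)) = prob g * prob (d \<inter> e)"
        using indep_setD[OF G_indep g, of "d \<inter> e"] d e E_gen gen_gen0 by auto
      moreover have "prob (e \<inter> d) = prob e * prob d"
        using indep_setD[OF B_indep[OF st], of e d] d e by (auto simp: E_def)
      moreover have "prob (g \<inter> d) = prob g * prob d"
        using indep_setD[OF G_indep g, of d] d gen_gen0 by auto
      ultimately show ?thesis by (simp add: Int_commute Int_left_commute)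
    qed
  qed (use R_M E_gen gen0_M in auto)
  moreover have "Int_stable R"
  proof (rule Int_stableI)
    fix a b assume ab: "a \<in> R" "b \<in> R"
    show "a \<inter> b \<in> R"
    proof (cases "a \<in> null_sets M \<or> b \<in> null_sets M")
      case True
      then have "a \<inter> b \<in> null_sets M" using ab R_M by (auto intro: null_set_Int1 null_set_Int2)
      then show ?thesis by (simp add: R_def)
    next
      case False
      then obtain g d g' d' where "g \<in> sets G" "g' \<in> sets G" "d \<in> generated_events M B {0..s}"
        "d' \<in> generated_events M B {0..s}" "a = g \<inter> d" "b = g' \<inter> d'"
        using ab by (auto simp: R_def)
      moreover have "a \<inter> b = (g \<inter> g') \<inter> (d \<inter> d')" using calculation by auto
      ultimately show ?thesis unfolding R_def by blast
    qed
  qed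
  moreover have "Int_stable E" unfolding E_def by (rule Int_stable_preimages)
  ultimately have ind: "indep_set (sigma_sets (space M) R) (sigma_sets (space M) E)"
    by (rule indep_set_sigma_sets)
  have "sets G \<subseteq> R"
  proof
    fix g assume "g \<in> sets G"
    moreover have "g = g \<inter> space M" using sets.sets_into_space[OF \<open>g \<in> sets G\<close>] GM(2) by auto
    ultimately show "g \<in> R" unfolding R_def using gen.top by blast
  qed
  moreover have "generated_events M B {0..s} \<subseteq> R"
  proof
    fix d assume "d \<in> generated_events M B {0..s}"
    moreover have "d = space G \<inter> d" using gen.sets_into_space \<open>d \<in> generated_events M B {0..s}\<close> GM(2) by auto
    ultimately show "d \<in> R" unfolding R_def using sets.top[of G] by blast
  qed
  ultimately have "sets (F s) \<subseteq> sigma_sets (space M) R"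
    unfolding sets_F by (intro sigma_sets_mono') (auto simp: R_def)
  then show ?thesis
    using assms(3,4) by (intro indep_setD[OF ind]) (auto simp: E_def)
qed

text \<open>Preimages under \<open>f\<close> of Borel sets are Borel, so they reduce to events of
  the increment itself. The function is left general because both the increment and its square are
  needed.\<close>

lemma F_indep_var_increment:
  assumes st: "0 \<le> s" "s < t" and \<phi>: "\<phi> \<in> borel_measurable (F s)"
    and f: "(f :: real \<Rightarrow> real) \<in> borel_measurable borel"
  shows "indep_var borel \<phi> borel (\<lambda>\<omega>. f (B t \<omega> - B s \<omega>))"
proof -
  have [measurable]: "\<phi> \<in> borel_measurable M" by (rule F_measurable[OF \<phi>])
  have [measurable]: "B t \<in> borel_measurable M" "B s \<in> borel_measurable M"
    using st by (auto intro!: B_measurable)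
  note f[measurable]
  have m: "(\<lambda>\<omega>. f (B t \<omega> - B s \<omega>)) \<in> borel_measurable M" by measurable
  have "indep_set {\<phi> -` A \<inter> space M | A. A \<in> sets borel}
    {(\<lambda>\<omega>. f (B t \<omega> - B s \<omega>)) -` A \<inter> space M | A. A \<in> sets borel}"
  proof (rule indep_setI)
    fix a b assume "a \<in> {\<phi> -` A \<inter> space M | A. A \<in> sets borel}"
      and "b \<in> {(\<lambda>\<omega>. f (B t \<omega> - B s \<omega>)) -` A \<inter> space M | A. A \<in> sets borel}"
    then obtain A A' where A: "A \<in> sets borel" "a = \<phi> -` A \<inter> space M"
      and A': "A' \<in> sets borel" "b = (\<lambda>\<omega>. f (B t \<omega> - B s \<omega>)) -` A' \<inter> space M" by auto
    have "a \<in> sets (F s)" using measurable_sets[OF \<phi> A(1)] A(2) by simp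
    moreover have "f -` A' \<in> sets borel" using measurable_sets[OF f A'(1)] by simp
    moreover have "b = (\<lambda>\<omega>. B t \<omega> - B s \<omega>) -` (f -` A') \<inter> space M" using A'(2) by auto
    ultimately show "prob (a \<inter> b) = prob a * prob b" using F_indep_increment[OF st] by simp
  qed (use m in \<open>auto intro: measurable_sets\<close>)
  then show ?thesis unfolding indep_var_eq using m
    by (intro conjI indep_set_sigma_sets Int_stable_preimages) auto
qed

lemma increment_moments:
  assumes "0 \<le> s" "s \<le> t"
  shows "integrable M (\<lambda>\<omega>. B t \<omega> - B s \<omega>)" "integrable M (\<lambda>\<omega>. (B t \<omega> - B s \<omega>)\<^sup>2)"
    "expectation (\<lambda>\<omega>. B t \<omega> - B s \<omega>) = 0" "expectation (\<lambda>\<omega>. (B t \<omega> - B s \<omega>)\<^sup>2) = t - s"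
proof -
  have "integrable M (\<lambda>\<omega>. B t \<omega> - B s \<omega>) \<and> integrable M (\<lambda>\<omega>. (B t \<omega> - B s \<omega>)\<^sup>2)
    \<and> expectation (\<lambda>\<omega>. B t \<omega> - B s \<omega>) = 0 \<and> expectation (\<lambda>\<omega>. (B t \<omega> - B s \<omega>)\<^sup>2) = t - s"
  proof (cases "s = t")
    case False
    then have st: "s < t" using assms by simp
    let ?d = "normal_density 0 (sqrt (t - s))"
    have d: "distributed M lborel (\<lambda>\<omega>. B t \<omega> - B s \<omega>) ?d" by (rule B_normal[OF assms(1) st])
    have pos: "sqrt (t - s) > 0" using st by simp
    have i1: "integrable M (\<lambda>\<omega>. B t \<omega> - B s \<omega>)"
      using integrable_normal_moment[OF pos, of 0 1]
        distributed_integrable[OF d, of "\<lambda>x. x"] by simp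
    have i2: "integrable M (\<lambda>\<omega>. (B t \<omega> - B s \<omega>)\<^sup>2)"
      using integrable_normal_moment[OF pos, of 0 2]
        distributed_integrable[OF d, of "\<lambda>x. x\<^sup>2"] by simp
    have e: "expectation (\<lambda>\<omega>. B t \<omega> - B s \<omega>) = 0"
      by (rule normal_distributed_expectation[OF pos d])
    have "variance (\<lambda>\<omega>. B t \<omega> - B s \<omega>) = (sqrt (t - s))\<^sup>2"
      by (rule normal_distributed_variance[OF pos d])
    then show ?thesis using i1 i2 e st by simp
  qed simp
  then show "integrable M (\<lambda>\<omega>. B t \<omega> - B s \<omega>)" "integrable M (\<lambda>\<omega>. (B t \<omega> - B s \<omega>)\<^sup>2)"
    "expectation (\<lambda>\<omega>. B t \<omega> - B s \<omega>) = 0" "expectation (\<lambda>\<omega>. (B t \<omega> - B s \<omega>)\<^sup>2) = t - s"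
    by auto
qed

text \<open>Independence yields integrability of the products, even for a merely integrable
  \<open>\<phi>\<close>, and factors their expectations. The case \<open>s = t\<close> is degenerate
  and stands apart, since independence is available for \<open>s < t\<close>.\<close>

lemma increment_orthogonal:
  assumes st: "0 \<le> s" "s \<le> t" and \<phi>: "\<phi> \<in> borel_measurable (F s)" "integrable M \<phi>"
  shows "integrable M (\<lambda>\<omega>. \<phi> \<omega> * (B t \<omega> - B s \<omega>))"
    "expectation (\<lambda>\<omega>. \<phi> \<omega> * (B t \<omega> - B s \<omega>)) = 0"
    "integrable M (\<lambda>\<omega>. \<phi> \<omega> * (B t \<omega> - B s \<omega>)\<^sup>2)"
    "expectation (\<lambda>\<omega>. \<phi> \<omega> * (B t \<omega> - B s \<omega>)\<^sup>2) = (t - s) * expectation \<phi>"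
proof -
  note m = increment_moments[OF st]
  have "integrable M (\<lambda>\<omega>. \<phi> \<omega> * (B t \<omega> - B s \<omega>))
    \<and> expectation (\<lambda>\<omega>. \<phi> \<omega> * (B t \<omega> - B s \<omega>)) = 0
    \<and> integrable M (\<lambda>\<omega>. \<phi> \<omega> * (B t \<omega> - B s \<omega>)\<^sup>2)
    \<and> expectation (\<lambda>\<omega>. \<phi> \<omega> * (B t \<omega> - B s \<omega>)\<^sup>2) = (t - s) * expectation \<phi>"
  proof (cases "s = t")
    case False
    then have st': "s < t" using st by simp
    have 1: "indep_var borel \<phi> borel (\<lambda>\<omega>. B t \<omega> - B s \<omega>)"
      using F_indep_var_increment[OF st(1) st' \<phi>(1), of "\<lambda>x. x"] by simp
    have 2: "indep_var borel \<phi> borel (\<lambda>\<omega>. (B t \<omega> - B s \<omega>)\<^sup>2)"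
      using F_indep_var_increment[OF st(1) st' \<phi>(1), of "\<lambda>x. x\<^sup>2"] by simp
    show ?thesis
      using indep_var_integrable[OF 1 \<phi>(2) m(1)] indep_var_lebesgue_integral[OF 1 \<phi>(2) m(1)]
        indep_var_integrable[OF 2 \<phi>(2) m(2)] indep_var_lebesgue_integral[OF 2 \<phi>(2) m(2)] m by simp
  qed simp
  then show "integrable M (\<lambda>\<omega>. \<phi> \<omega> * (B t \<omega> - B s \<omega>))"
    "expectation (\<lambda>\<omega>. \<phi> \<omega> * (B t \<omega> - B s \<omega>)) = 0"
    "integrable M (\<lambda>\<omega>. \<phi> \<omega> * (B t \<omega> - B s \<omega>)\<^sup>2)"
    "expectation (\<lambda>\<omega>. \<phi> \<omega> * (B t \<omega> - B s \<omega>)\<^sup>2) = (t - s) * expectation \<phi>" by auto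
qed

text \<open>With \<open>a \<le> c\<close>, the increments are cut at \<open>c\<close> and at the
  smaller right end point. In each mixed term the later increment is orthogonal to the past, as
  \<open>\<zeta> = \<phi> * \<psi>\<close> is known at time \<open>c\<close>; only the square over
  the common interval survives.\<close>

lemma increment_covariance_ordered:
  assumes ab: "0 \<le> a" "a \<le> b" and cd: "a \<le> c" "c \<le> d"
    and \<phi>: "\<phi> \<in> borel_measurable (F a)" "\<And>\<omega>. \<omega> \<in> space M \<Longrightarrow> \<bar>\<phi> \<omega>\<bar> \<le> K"
    and \<psi>: "\<psi> \<in> borel_measurable (F c)" "\<And>\<omega>. \<omega> \<in> space M \<Longrightarrow> \<bar>\<psi> \<omega>\<bar> \<le> K'"
  shows "has_bochner_integral M (\<lambda>\<omega>. (\<phi> \<omega> * (B b \<omega> - B a \<omega>)) * (\<psi> \<omega> * (B d \<omega> - B c \<omega>)))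
    (max 0 (min b d - max a c) * expectation (\<lambda>\<omega>. \<phi> \<omega> * \<psi> \<omega>))"
proof -
  have c0: "0 \<le> c" using ab cd by simp
  have \<phi>c[measurable]: "\<phi> \<in> borel_measurable (F c)" by (rule F_measurable_mono[OF cd(1) \<phi>(1)])
  note \<psi>(1)[measurable]
  define \<zeta> where "\<zeta> \<omega> = \<phi> \<omega> * \<psi> \<omega>" for \<omega>
  have \<zeta>c[measurable]: "\<zeta> \<in> borel_measurable (F c)" unfolding \<zeta>_def by measurable
  have \<zeta>M[measurable]: "\<zeta> \<in> borel_measurable M" by (rule F_measurable[OF \<zeta>c])
  have \<zeta>K: "\<bar>\<zeta> \<omega>\<bar> \<le> K * K'" if "\<omega> \<in> space M" for \<omega>
    unfolding \<zeta>_def abs_mult using \<phi>(2)[OF that] \<psi>(2)[OF that] by (intro mult_mono) auto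
  have \<zeta>i: "integrable M (\<lambda>\<omega>. \<zeta> \<omega> * f \<omega>)" if "integrable M f" for f :: "'a \<Rightarrow> real"
  proof (rule Bochner_Integration.integrable_bound[OF integrable_mult_right[OF that, of "K * K'"]])
    show "AE \<omega> in M. norm (\<zeta> \<omega> * f \<omega>) \<le> norm (K * K' * f \<omega>)"
    proof (rule AE_I2)
      fix \<omega> assume "\<omega> \<in> space M"
      from \<zeta>K[OF this] have "\<bar>\<zeta> \<omega>\<bar> \<le> \<bar>K * K'\<bar>" by linarith
      then show "norm (\<zeta> \<omega> * f \<omega>) \<le> norm (K * K' * f \<omega>)"
        unfolding real_norm_def abs_mult[of "\<zeta> \<omega>"] abs_mult[of "K * K'"] by (rule mult_right_mono) simp
    qed
  qed (use that in measurable)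
  have \<zeta>int: "integrable M \<zeta>" using \<zeta>i[of "\<lambda>_. 1"] by simp
  have Fm: "(\<lambda>\<omega>. \<zeta> \<omega> * (B v \<omega> - B u \<omega>)) \<in> borel_measurable (F w)"
    if "0 \<le> u" "u \<le> w" "0 \<le> v" "v \<le> w" "c \<le> w" for u v w
  proof -
    have [measurable]: "\<zeta> \<in> borel_measurable (F w)" "B u \<in> borel_measurable (F w)" "B v \<in> borel_measurable (F w)"
      using that by (auto intro: F_measurable_mono[OF _ \<zeta>c] B_F_measurable)
    show ?thesis by measurable
  qed
  have zero: "has_bochner_integral M (\<lambda>\<omega>. (\<zeta> \<omega> * (B v \<omega> - B u \<omega>)) * (B w' \<omega> - B w \<omega>)) 0"
    if "0 \<le> u" "u \<le> v" "v \<le> w" "c \<le> w" "w \<le> w'" for u v w w'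
    using increment_orthogonal[of w w', OF _ _ Fm[of u w v] \<zeta>i[OF increment_moments(1)[of u v]]] that c0
    by (auto simp: has_bochner_integral_iff)
  have diag: "has_bochner_integral M (\<lambda>\<omega>. \<zeta> \<omega> * (B w \<omega> - B c \<omega>)\<^sup>2) ((w - c) * expectation \<zeta>)"
    if "c \<le> w" for w
    using increment_orthogonal[OF c0 that \<zeta>c \<zeta>int] by (simp add: has_bochner_integral_iff)
  have "has_bochner_integral M (\<lambda>\<omega>. (\<phi> \<omega> * (B b \<omega> - B a \<omega>)) * (\<psi> \<omega> * (B d \<omega> - B c \<omega>)))
    (max 0 (min b d - max a c) * expectation \<zeta>)"
  proof -
    consider "b \<le> c" | "c \<le> b" "b \<le> d" | "c \<le> b" "d \<le> b" by linarith
    then show ?thesis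
    proof cases
      case 1
      have "has_bochner_integral M (\<lambda>\<omega>. (\<zeta> \<omega> * (B b \<omega> - B a \<omega>)) * (B d \<omega> - B c \<omega>)) 0"
        by (rule zero) (use ab cd 1 in auto)
      moreover have "max 0 (min b d - max a c) = 0" using 1 cd by auto
      ultimately show ?thesis by (simp add: \<zeta>_def mult_ac)
    next
      case 2
      have "has_bochner_integral M (\<lambda>\<omega>. (\<zeta> \<omega> * (B c \<omega> - B a \<omega>)) * (B d \<omega> - B c \<omega>)
          + \<zeta> \<omega> * (B b \<omega> - B c \<omega>)\<^sup>2 + (\<zeta> \<omega> * (B b \<omega> - B c \<omega>)) * (B d \<omega> - B b \<omega>))
          (0 + (b - c) * expectation \<zeta> + 0)"
        by (intro has_bochner_integral_add zero diag) (use ab cd c0 2 in auto)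
      moreover have mm: "max 0 (min b d - max a c) = b - c" using 2 cd by auto
      ultimately show ?thesis unfolding mm
        by (simp add: \<zeta>_def algebra_simps power2_eq_square)
    next
      case 3
      have "has_bochner_integral M (\<lambda>\<omega>. (\<zeta> \<omega> * (B c \<omega> - B a \<omega>)) * (B d \<omega> - B c \<omega>)
          + \<zeta> \<omega> * (B d \<omega> - B c \<omega>)\<^sup>2 + (\<zeta> \<omega> * (B d \<omega> - B c \<omega>)) * (B b \<omega> - B d \<omega>))
          (0 + (d - c) * expectation \<zeta> + 0)"
        by (intro has_bochner_integral_add zero diag) (use ab cd c0 3 in auto)
      moreover have mm: "max 0 (min b d - max a c) = d - c" using 3 cd by auto
      ultimately show ?thesis unfolding mm
        by (simp add: \<zeta>_def algebra_simps power2_eq_square)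
    qed
  qed
  then show ?thesis by (simp add: \<zeta>_def[abs_def])
qed

text \<open>Reduction to the ordered case: if \<open>t\<close> lies before one of the left end
  points, that increment and the overlap both vanish; otherwise stopping at \<open>t\<close> only
  shortens the right ends, and the two increments may be exchanged.\<close>

lemma increment_covariance:
  assumes ab: "0 \<le> a" "a \<le> b" and cd: "0 \<le> c" "c \<le> d" and "0 \<le> t"
    and \<phi>: "\<phi> \<in> borel_measurable (F a)" "\<And>\<omega>. \<omega> \<in> space M \<Longrightarrow> \<bar>\<phi> \<omega>\<bar> \<le> K"
    and \<psi>: "\<psi> \<in> borel_measurable (F c)" "\<And>\<omega>. \<omega> \<in> space M \<Longrightarrow> \<bar>\<psi> \<omega>\<bar> \<le> K'"
  shows "has_bochner_integral M (\<lambda>\<omega>. (\<phi> \<omega> * (B (min t b) \<omega> - B (min t a) \<omega>))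
      * (\<psi> \<omega> * (B (min t d) \<omega> - B (min t c) \<omega>)))
    (max 0 (min (min t b) (min t d) - max a c) * expectation (\<lambda>\<omega>. \<phi> \<omega> * \<psi> \<omega>))"
proof (cases "t < a \<or> t < c")
  case True
  then have "max 0 (min (min t b) (min t d) - max a c) = 0" by auto
  moreover have "min t b = t \<and> min t a = t \<or> min t d = t \<and> min t c = t" using True ab cd by auto
  then have "(\<lambda>\<omega>. (\<phi> \<omega> * (B (min t b) \<omega> - B (min t a) \<omega>))
      * (\<psi> \<omega> * (B (min t d) \<omega> - B (min t c) \<omega>))) = (\<lambda>_. 0)" by auto
  ultimately show ?thesis by (simp add: has_bochner_integral_zero)
next
  case False
  then have m: "min t a = a" "min t c = c" by auto
  show ?thesis unfolding m
  proof (cases "a \<le> c")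
    case True
    show "has_bochner_integral M (\<lambda>\<omega>. (\<phi> \<omega> * (B (min t b) \<omega> - B a \<omega>))
        * (\<psi> \<omega> * (B (min t d) \<omega> - B c \<omega>)))
      (max 0 (min (min t b) (min t d) - max a c) * expectation (\<lambda>\<omega>. \<phi> \<omega> * \<psi> \<omega>))"
      by (rule increment_covariance_ordered[OF _ _ _ _ \<phi> \<psi>]) (use ab cd False True in auto)
  next
    case ac: False
    have "has_bochner_integral M (\<lambda>\<omega>. (\<psi> \<omega> * (B (min t d) \<omega> - B c \<omega>))
        * (\<phi> \<omega> * (B (min t b) \<omega> - B a \<omega>)))
      (max 0 (min (min t d) (min t b) - max c a) * expectation (\<lambda>\<omega>. \<psi> \<omega> * \<phi> \<omega>))"
      by (rule increment_covariance_ordered[OF _ _ _ _ \<psi> \<phi>]) (use ab cd False ac in auto)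
    then show "has_bochner_integral M (\<lambda>\<omega>. (\<phi> \<omega> * (B (min t b) \<omega> - B a \<omega>))
        * (\<psi> \<omega> * (B (min t d) \<omega> - B c \<omega>)))
      (max 0 (min (min t b) (min t d) - max a c) * expectation (\<lambda>\<omega>. \<phi> \<omega> * \<psi> \<omega>))"
      by (simp add: mult.commute min.commute max.commute)
  qed
qed

end

subsection \<open>The martingale property of the Ito integral\<close>

context brownian_setting
begin

text \<open>Both sides expand into the same double sum of the means of \<open>c i * c j\<close>,
  weighted by the length \<open>l i j\<close> of the overlap of two intervals within
  \<open>[0, t]\<close>. The intervals may overlap and the index set is any finite set, so that the
  isometry also covers differences of integrals over unrelated partitions.\<close>

lemma elementary_integral_isometry:
  fixes a b :: "'i \<Rightarrow> real" and c :: "'i \<Rightarrow> 'a \<Rightarrow> real"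
  assumes I: "finite I" and ab: "\<And>i. i \<in> I \<Longrightarrow> 0 \<le> a i \<and> a i \<le> b i" and "0 \<le> t"
    and c: "\<And>i. i \<in> I \<Longrightarrow> c i \<in> borel_measurable (F (a i))"
      "\<And>i. i \<in> I \<Longrightarrow> \<exists>K. \<forall>\<omega>\<in>space M. \<bar>c i \<omega>\<bar> \<le> K"
  defines "R \<equiv> \<lambda>\<omega>. \<Sum>i\<in>I. c i \<omega> * (B (min t (b i)) \<omega> - B (min t (a i)) \<omega>)"
  shows "sq_integrable M R"
    and "(\<integral>\<^sup>+\<omega>. ennreal ((R \<omega>)\<^sup>2) \<partial>M)
      = (\<integral>\<^sup>+\<omega>. (\<integral>\<^sup>+s\<in>{0..t}. ennreal ((\<Sum>i\<in>I. c i \<omega> * indicator {a i<..b i} s)\<^sup>2) \<partial>lborel) \<partial>M)"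
proof -
  define l where "l i j = max 0 (min (min t (b i)) (min t (b j)) - max (a i) (a j))" for i j
  have cM[measurable]: "c i \<in> borel_measurable M" if "i \<in> I" for i
    by (rule F_measurable[OF c(1)[OF that]])
  have R2: "(R \<omega>)\<^sup>2 = (\<Sum>i\<in>I. \<Sum>j\<in>I. (c i \<omega> * (B (min t (b i)) \<omega> - B (min t (a i)) \<omega>))
      * (c j \<omega> * (B (min t (b j)) \<omega> - B (min t (a j)) \<omega>)))" for \<omega>
    unfolding R_def power2_eq_square sum_product ..
  have hR: "has_bochner_integral M (\<lambda>\<omega>. (R \<omega>)\<^sup>2)
      (\<Sum>i\<in>I. \<Sum>j\<in>I. l i j * expectation (\<lambda>\<omega>. c i \<omega> * c j \<omega>))"
    unfolding R2 l_def
  proof (intro has_bochner_integral_sum)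
    fix i j assume ij: "i \<in> I" "j \<in> I"
    from c(2)[OF ij(1)] c(2)[OF ij(2)] obtain K K' where
      "\<And>\<omega>. \<omega> \<in> space M \<Longrightarrow> \<bar>c i \<omega>\<bar> \<le> K" "\<And>\<omega>. \<omega> \<in> space M \<Longrightarrow> \<bar>c j \<omega>\<bar> \<le> K'" by auto
    with ij ab c(1) \<open>0 \<le> t\<close> show "has_bochner_integral M
        (\<lambda>\<omega>. (c i \<omega> * (B (min t (b i)) \<omega> - B (min t (a i)) \<omega>))
          * (c j \<omega> * (B (min t (b j)) \<omega> - B (min t (a j)) \<omega>)))
        (max 0 (min (min t (b i)) (min t (b j)) - max (a i) (a j)) * expectation (\<lambda>\<omega>. c i \<omega> * c j \<omega>))"
      by (intro increment_covariance) auto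
  qed
  have cc: "integrable M (\<lambda>\<omega>. c i \<omega> * c j \<omega>)" if ij: "i \<in> I" "j \<in> I" for i j
  proof -
    from c(2)[OF ij(1)] c(2)[OF ij(2)] obtain K K' where
      K: "\<And>\<omega>. \<omega> \<in> space M \<Longrightarrow> \<bar>c i \<omega>\<bar> \<le> K" "\<And>\<omega>. \<omega> \<in> space M \<Longrightarrow> \<bar>c j \<omega>\<bar> \<le> K'" by auto
    show ?thesis
    proof (rule integrable_const_bound[of _ "K * K'"])
      show "AE \<omega> in M. norm (c i \<omega> * c j \<omega>) \<le> K * K'"
      proof (rule AE_I2)
        fix \<omega> assume "\<omega> \<in> space M"
        then show "norm (c i \<omega> * c j \<omega>) \<le> K * K'"
          unfolding real_norm_def abs_mult using K[of \<omega>] by (intro mult_mono) auto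
      qed
    qed (use ij in measurable)
  qed
  have hC: "has_bochner_integral M (\<lambda>\<omega>. \<Sum>i\<in>I. \<Sum>j\<in>I. l i j * (c i \<omega> * c j \<omega>))
      (\<Sum>i\<in>I. \<Sum>j\<in>I. l i j * expectation (\<lambda>\<omega>. c i \<omega> * c j \<omega>))"
    by (intro has_bochner_integral_sum has_bochner_integral_mult_right)
      (simp add: has_bochner_integral_iff cc)
  have hl: "has_bochner_integral lborel (indicator {u<..v} :: real \<Rightarrow> real) (max 0 (v - u))" for u v :: real
  proof (cases "u \<le> v")
    case True
    then show ?thesis
      using has_bochner_integral_real_indicator[of "{u<..v}" lborel] by (simp add: max_def)
  next
    case False
    then have "(indicator {u<..v} :: real \<Rightarrow> real) = (\<lambda>_. 0)" by (auto simp: indicator_def)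
    with False show ?thesis by (simp add: max_def has_bochner_integral_zero)
  qed
  have hpath: "has_bochner_integral lborel
      (\<lambda>s. indicator {0..t} s * (\<Sum>i\<in>I. c i \<omega> * indicator {a i<..b i} s)\<^sup>2)
      (\<Sum>i\<in>I. \<Sum>j\<in>I. l i j * (c i \<omega> * c j \<omega>))" for \<omega>
  proof -
    have eq: "indicator {0..t} s * (\<Sum>i\<in>I. c i \<omega> * indicator {a i<..b i} s)\<^sup>2
        = (\<Sum>i\<in>I. \<Sum>j\<in>I. indicator {max (a i) (a j)<..min (min t (b i)) (min t (b j))} s
            * (c i \<omega> * c j \<omega>))" for s
      unfolding power2_eq_square sum_product unfolding sum_distrib_left
    proof (rule sum.cong[OF refl], rule sum.cong[OF refl])
      fix i j assume "i \<in> I" "j \<in> I"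
      with ab[of i] show "indicator {0..t} s * (c i \<omega> * indicator {a i<..b i} s
            * (c j \<omega> * indicator {a j<..b j} s))
          = indicator {max (a i) (a j)<..min (min t (b i)) (min t (b j))} s * (c i \<omega> * c j \<omega>)"
        by (auto split: split_indicator)
    qed
    show ?thesis unfolding eq l_def
      by (intro has_bochner_integral_sum has_bochner_integral_mult_left hl)
  qed
  have path: "(\<integral>\<^sup>+s\<in>{0..t}. ennreal ((\<Sum>i\<in>I. c i \<omega> * indicator {a i<..b i} s)\<^sup>2) \<partial>lborel)
      = ennreal (\<Sum>i\<in>I. \<Sum>j\<in>I. l i j * (c i \<omega> * c j \<omega>))" for \<omega>
  proof -
    have "(\<integral>\<^sup>+s. ennreal (indicator {0..t} s * (\<Sum>i\<in>I. c i \<omega> * indicator {a i<..b i} s)\<^sup>2) \<partial>lborel)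
        = ennreal (\<Sum>i\<in>I. \<Sum>j\<in>I. l i j * (c i \<omega> * c j \<omega>))"
      using hpath[of \<omega>] by (subst nn_integral_eq_integral) (auto simp: has_bochner_integral_iff)
    moreover have "(\<integral>\<^sup>+s\<in>{0..t}. ennreal ((\<Sum>i\<in>I. c i \<omega> * indicator {a i<..b i} s)\<^sup>2) \<partial>lborel)
        = (\<integral>\<^sup>+s. ennreal (indicator {0..t} s * (\<Sum>i\<in>I. c i \<omega> * indicator {a i<..b i} s)\<^sup>2) \<partial>lborel)"
    proof (rule nn_integral_cong)
      fix s
      show "ennreal ((\<Sum>i\<in>I. c i \<omega> * indicator {a i<..b i} s)\<^sup>2) * indicator {0..t} s
          = ennreal (indicator {0..t} s * (\<Sum>i\<in>I. c i \<omega> * indicator {a i<..b i} s)\<^sup>2)"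
        by (cases "s \<in> {0..t}") simp_all
    qed
    ultimately show ?thesis by simp
  qed
  have [measurable]: "B u \<in> borel_measurable M" if "0 \<le> u" for u using that by (rule B_measurable)
  have Rm: "R \<in> borel_measurable M" unfolding R_def
    by (rule borel_measurable_sum) (use \<open>0 \<le> t\<close> ab in \<open>auto intro!: borel_measurable_times borel_measurable_diff B_measurable cM\<close>, force)
  then show "sq_integrable M R" using hR by (auto simp: sq_integrable_def has_bochner_integral_iff)
  have "(\<integral>\<^sup>+\<omega>. ennreal ((R \<omega>)\<^sup>2) \<partial>M) = ennreal (\<Sum>i\<in>I. \<Sum>j\<in>I. l i j * expectation (\<lambda>\<omega>. c i \<omega> * c j \<omega>))"
    using hR by (subst nn_integral_eq_integral) (auto simp: has_bochner_integral_iff)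
  also have "\<dots> = (\<integral>\<^sup>+\<omega>. ennreal (\<Sum>i\<in>I. \<Sum>j\<in>I. l i j * (c i \<omega> * c j \<omega>)) \<partial>M)"
  proof (subst nn_integral_eq_integral)
    show "AE \<omega> in M. 0 \<le> (\<Sum>i\<in>I. \<Sum>j\<in>I. l i j * (c i \<omega> * c j \<omega>))"
    proof (rule AE_I2)
      fix \<omega>
      \<comment> \<open>The double sum is nonnegative because it is the time integral of a square
        along the path.\<close>
      have "0 \<le> (\<integral>s. indicator {0..t} s * (\<Sum>i\<in>I. c i \<omega> * indicator {a i<..b i} s)\<^sup>2 \<partial>lborel)"
        by (rule integral_nonneg_AE) auto
      then show "0 \<le> (\<Sum>i\<in>I. \<Sum>j\<in>I. l i j * (c i \<omega> * c j \<omega>))"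
        using hpath[of \<omega>] by (simp only: has_bochner_integral_iff)
    qed
  qed (use hC in \<open>auto simp: has_bochner_integral_iff\<close>)
  finally show "(\<integral>\<^sup>+\<omega>. ennreal ((R \<omega>)\<^sup>2) \<partial>M)
      = (\<integral>\<^sup>+\<omega>. (\<integral>\<^sup>+s\<in>{0..t}. ennreal ((\<Sum>i\<in>I. c i \<omega> * indicator {a i<..b i} s)\<^sup>2) \<partial>lborel) \<partial>M)"
    unfolding path .
qed

section \<open>Isometry and martingale property for simple processes\<close>

lemma simple_process_nonneg:
  assumes "simple_process F n \<tau> \<phi>" "i \<le> n"
  shows "0 \<le> \<tau> i"
  using assms(2) assms(1)
  by (induction i) (auto simp: simple_process_def intro: order_trans)

lemma simple_processD:
  assumes "simple_process F n \<tau> \<phi>" "i < n"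
  shows "0 \<le> \<tau> i" "\<tau> i \<le> \<tau> (Suc i)" "\<phi> i \<in> borel_measurable (F (\<tau> i))"
    "\<exists>K. \<forall>\<omega>\<in>space M. \<bar>\<phi> i \<omega>\<bar> \<le> K"
  using assms simple_process_nonneg[OF assms(1), of i] by (auto simp: simple_process_def)

lemma simple_integral_sq_integrable:
  assumes "simple_process F n \<tau> \<phi>" "0 \<le> t"
  shows "sq_integrable M (simple_integral B n \<tau> \<phi> t)"
  unfolding simple_integral_def
  by (rule elementary_integral_isometry(1)) (use assms simple_processD[OF assms(1)] in auto)

text \<open>The difference is a single elementary sum over a disjoint union of index sets, the
  second family with reversed sign. This takes the place of a common refinement of the two
  partitions.\<close>

lemma simple_integral_diff_isometry:
  assumes P: "simple_process F n \<tau> \<phi>" and Q: "simple_process F m \<sigma> \<psi>" and "0 \<le> t"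
  shows "(\<integral>\<^sup>+\<omega>. ennreal ((simple_integral B n \<tau> \<phi> t \<omega> - simple_integral B m \<sigma> \<psi> t \<omega>)\<^sup>2) \<partial>M)
    = (\<integral>\<^sup>+\<omega>. (\<integral>\<^sup>+s\<in>{0..t}. ennreal ((simple_value n \<tau> \<phi> s \<omega> - simple_value m \<sigma> \<psi> s \<omega>)\<^sup>2) \<partial>lborel) \<partial>M)"
proof -
  define a b c where "a = case_sum \<tau> \<sigma>" and "b = case_sum (\<lambda>i. \<tau> (Suc i)) (\<lambda>i. \<sigma> (Suc i))"
    and "c = case_sum \<phi> (\<lambda>i \<omega>. - \<psi> i \<omega>)"
  let ?I = "{..<n} <+> {..<m}"
  have "(\<integral>\<^sup>+\<omega>. ennreal ((\<Sum>i\<in>?I. c i \<omega> * (B (min t (b i)) \<omega> - B (min t (a i)) \<omega>))\<^sup>2) \<partial>M)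
      = (\<integral>\<^sup>+\<omega>. (\<integral>\<^sup>+s\<in>{0..t}. ennreal ((\<Sum>i\<in>?I. c i \<omega> * indicator {a i<..b i} s)\<^sup>2) \<partial>lborel) \<partial>M)"
    by (rule elementary_integral_isometry(2))
      (use \<open>0 \<le> t\<close> simple_processD[OF P] simple_processD[OF Q] in \<open>auto simp: a_def b_def c_def\<close>)
  then show ?thesis unfolding sum.Plus[OF finite_lessThan finite_lessThan]
    by (simp add: a_def b_def c_def simple_integral_def simple_value_def sum_negf)
qed

lemma simple_integral_orthogonal:
  assumes P: "simple_process F n \<tau> \<phi>" and sT: "0 \<le> s" "s \<le> T"
    and \<psi>: "\<psi> \<in> borel_measurable (F s)" "sq_integrable M \<psi>"
  shows "expectation (\<lambda>\<omega>. \<psi> \<omega> * (simple_integral B n \<tau> \<phi> T \<omega> - simple_integral B n \<tau> \<phi> s \<omega>)) = 0"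
proof -
  have eq: "\<psi> \<omega> * (simple_integral B n \<tau> \<phi> T \<omega> - simple_integral B n \<tau> \<phi> s \<omega>)
    = (\<Sum>i<n. \<psi> \<omega> * (\<phi> i \<omega> * (B (min T (\<tau> (Suc i))) \<omega> - B (min T (\<tau> i)) \<omega>
        - B (min s (\<tau> (Suc i))) \<omega> + B (min s (\<tau> i)) \<omega>)))" for \<omega>
    by (simp add: simple_integral_def sum_distrib_left sum_subtractf[symmetric] algebra_simps)
  have "has_bochner_integral M
      (\<lambda>\<omega>. \<psi> \<omega> * (simple_integral B n \<tau> \<phi> T \<omega> - simple_integral B n \<tau> \<phi> s \<omega>)) (\<Sum>i<n. 0)"
    unfolding eq
  proof (rule has_bochner_integral_sum)
    fix i assume "i \<in> {..<n}"
    then have i: "i < n" by simp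
    note pr = simple_processD[OF P i]
    \<comment> \<open>The partition points clamped to \<open>[s, T]\<close>: for
      \<open>s \<le> T\<close> the difference \<open>B (min T z) - B (min s z)\<close> equals
      \<open>B (max s (min T z)) - B s\<close>.\<close>
    define u v where "u = max s (min T (\<tau> i))" and "v = max s (min T (\<tau> (Suc i)))"
    show "has_bochner_integral M (\<lambda>\<omega>. \<psi> \<omega> * (\<phi> i \<omega> * (B (min T (\<tau> (Suc i))) \<omega> - B (min T (\<tau> i)) \<omega>
        - B (min s (\<tau> (Suc i))) \<omega> + B (min s (\<tau> i)) \<omega>))) 0"
    \<comment> \<open>If \<open>T < \<tau> i\<close>, the clamped interval is a point lying before
      the time at which \<open>\<phi> i\<close> is known, so orthogonality could not be applied at
      \<open>u\<close>; but then the term is zero.\<close>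
    proof (cases "T < \<tau> i")
      case True
      then have "min T (\<tau> (Suc i)) = T" "min T (\<tau> i) = T" "min s (\<tau> (Suc i)) = s" "min s (\<tau> i) = s"
        using pr sT by auto
      then show ?thesis by (simp add: has_bochner_integral_zero)
    next
      case False
      have u: "0 \<le> u" "u \<le> v" "s \<le> u" "\<tau> i \<le> u" using pr sT False by (auto simp: u_def v_def)
      have eq2: "B (min T (\<tau> (Suc i))) \<omega> - B (min T (\<tau> i)) \<omega> - B (min s (\<tau> (Suc i))) \<omega> + B (min s (\<tau> i)) \<omega>
          = B v \<omega> - B u \<omega>" for \<omega>
        using pr sT False by (auto simp: u_def v_def min_def max_def)
      have [measurable]: "\<psi> \<in> borel_measurable (F u)" "\<phi> i \<in> borel_measurable (F u)"
        using F_measurable_mono[OF u(3) \<psi>(1)] F_measurable_mono[OF u(4) pr(3)] by auto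
      have m: "(\<lambda>\<omega>. \<psi> \<omega> * \<phi> i \<omega>) \<in> borel_measurable (F u)" by measurable
      obtain K where K: "\<And>\<omega>. \<omega> \<in> space M \<Longrightarrow> \<bar>\<phi> i \<omega>\<bar> \<le> K" using pr(4) by auto
      have "sq_integrable M (\<phi> i)"
        by (rule sq_integrable_bound[OF sq_integrable_const[of K] F_measurable[OF pr(3)]])
          (use K in \<open>force intro!: AE_I2\<close>)
      then have "integrable M (\<lambda>\<omega>. \<psi> \<omega> * \<phi> i \<omega>)" by (rule sq_integrable_mult[OF \<psi>(2)])
      from increment_orthogonal(1,2)[OF u(1,2) m this] show ?thesis
        by (simp add: eq2 has_bochner_integral_iff mult.assoc)
    qed
  qed
  then show ?thesis by (simp add: has_bochner_integral_iff)
qed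

text \<open>The simple processes witnessing the integrals at the times \<open>s\<close> and \<open>T\<close> are unrelated.  By the
  isometry, those for \<open>T\<close>, stopped at \<open>s\<close>, have the same limit as those for \<open>s\<close>.\<close>

lemma ito_integral_orthogonal:
  assumes Z: "(\<lambda>(t, \<omega>). Z t \<omega>) \<in> borel_measurable (restrict_space borel {0..} \<Otimes>\<^sub>M M)"
    and J: "ito_integral M F B Z J" and sT: "0 \<le> s" "s \<le> T"
  shows "sq_integrable M (J T)"
    and "\<lbrakk>\<psi> \<in> borel_measurable (F s); sq_integrable M \<psi>\<rbrakk>
      \<Longrightarrow> expectation (\<lambda>\<omega>. \<psi> \<omega> * (J T \<omega> - J s \<omega>)) = 0"
proof -
  have J_at: "J t \<in> borel_measurable M" "ito_integral_at M F B Z t (J t)" if "0 \<le> t" for t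
    using J that F_measurable[of "J t" t] by (auto simp: ito_integral_def)
  have T0: "0 \<le> T" using sT by simp
  obtain n \<tau> \<phi> where P: "\<And>k. simple_process F (n k) (\<tau> k) (\<phi> k)"
    and PZ: "(\<lambda>k. \<integral>\<^sup>+\<omega>. (\<integral>\<^sup>+u\<in>{0..T}. ennreal ((simple_value (n k) (\<tau> k) (\<phi> k) u \<omega> - Z u \<omega>)\<^sup>2) \<partial>lborel) \<partial>M)
         \<longlonglongrightarrow> 0"
    and PJ: "(\<lambda>k. \<integral>\<^sup>+\<omega>. ennreal ((simple_integral B (n k) (\<tau> k) (\<phi> k) T \<omega> - J T \<omega>)\<^sup>2) \<partial>M) \<longlonglongrightarrow> 0"
    using J_at(2)[OF T0] unfolding ito_integral_at_def by blast
  obtain n' \<tau>' \<phi>' where P': "\<And>k. simple_process F (n' k) (\<tau>' k) (\<phi>' k)"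
    and PZ': "(\<lambda>k. \<integral>\<^sup>+\<omega>. (\<integral>\<^sup>+u\<in>{0..s}. ennreal ((simple_value (n' k) (\<tau>' k) (\<phi>' k) u \<omega> - Z u \<omega>)\<^sup>2) \<partial>lborel) \<partial>M)
         \<longlonglongrightarrow> 0"
    and PJ': "(\<lambda>k. \<integral>\<^sup>+\<omega>. ennreal ((simple_integral B (n' k) (\<tau>' k) (\<phi>' k) s \<omega> - J s \<omega>)\<^sup>2) \<partial>M) \<longlonglongrightarrow> 0"
    using J_at(2)[OF sT(1)] unfolding ito_integral_at_def by blast
  define S S' where "S k = simple_integral B (n k) (\<tau> k) (\<phi> k)" and "S' k = simple_integral B (n' k) (\<tau>' k) (\<phi>' k)" for k
  define V V' where "V k = simple_value (n k) (\<tau> k) (\<phi> k)" and "V' k = simple_value (n' k) (\<tau>' k) (\<phi>' k)" for k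
  note PJ = PJ[folded S_def] and PJ' = PJ'[folded S'_def] and PZ = PZ[folded V_def] and PZ' = PZ'[folded V'_def]
  have SI: "sq_integrable M (S k t)"
    "sq_integrable M (S' k t)" if "0 \<le> t" for k t
    using simple_integral_sq_integrable[OF P that] simple_integral_sq_integrable[OF P' that] by (auto simp: S_def S'_def)
  show "sq_integrable M (J T)"
    by (rule sq_integrable_limit(1)[OF SI(1)[OF T0] J_at(1)[OF T0] PJ])
  assume \<psi>: "\<psi> \<in> borel_measurable (F s)" "sq_integrable M \<psi>"
  \<comment> \<open>\<open>Z\<close> is measurable over nonnegative times only. Composition with
    \<open>max 0\<close> extends it to the line without changing its integrals over
    \<open>[0, t]\<close>.\<close>
  have "(\<lambda>z. (max 0 (fst z) :: real, snd z)) \<in> measurable (lborel \<Otimes>\<^sub>M M) (restrict_space borel {0..} \<Otimes>\<^sub>M M)"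
    by (rule measurable_Pair) (auto intro!: measurable_restrict_space2)
  from measurable_compose[OF this Z]
  have Zm[measurable]: "(\<lambda>z. Z (max 0 (fst z)) (snd z)) \<in> borel_measurable (lborel \<Otimes>\<^sub>M M)" by simp
  have Vm[measurable]: "(\<lambda>z. V k (fst z) (snd z)) \<in> borel_measurable (lborel \<Otimes>\<^sub>M M)"
    "(\<lambda>z. V' k (fst z) (snd z)) \<in> borel_measurable (lborel \<Otimes>\<^sub>M M)" for k
  proof -
    have [measurable]: "\<phi> k i \<in> borel_measurable M" if "i < n k" for i
      using simple_processD(3)[OF P that] by (rule F_measurable)
    have [measurable]: "\<phi>' k i \<in> borel_measurable M" if "i < n' k" for i
      using simple_processD(3)[OF P' that] by (rule F_measurable)
    show "(\<lambda>z. V k (fst z) (snd z)) \<in> borel_measurable (lborel \<Otimes>\<^sub>M M)"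
      "(\<lambda>z. V' k (fst z) (snd z)) \<in> borel_measurable (lborel \<Otimes>\<^sub>M M)"
      unfolding V_def V'_def simple_value_def by measurable
  qed
  \<comment> \<open>The squared distance of two integrands, in mean square over time up to
    \<open>t\<close> and over \<open>\<omega>\<close>.\<close>
  define d where "d f g t = (\<integral>\<^sup>+\<omega>. (\<integral>\<^sup>+u\<in>{0..t}. ennreal ((f u \<omega> - g u \<omega>)\<^sup>2) \<partial>lborel) \<partial>M)"
    for f g :: "real \<Rightarrow> 'a \<Rightarrow> real" and t
  have d_Z: "d f Z t = d f (\<lambda>u. Z (max 0 u)) t" for f t
    unfolding d_def by (intro nn_integral_cong) (auto split: split_indicator)
  have d_tri: "d (V k) (V' k) s \<le> 2 * d (V k) Z T + 2 * d (V' k) Z s" for k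
  proof -
    note [measurable (raw)] = measurable_compose[OF measurable_Pair, of _ _ _ _ _ "\<lambda>z. V k (fst z) (snd z)", simplified]
      measurable_compose[OF measurable_Pair, of _ _ _ _ _ "\<lambda>z. V' k (fst z) (snd z)", simplified]
      measurable_compose[OF measurable_Pair, of _ _ _ _ _ "\<lambda>z. Z (max 0 (fst z)) (snd z)", simplified]
    have "d (V k) (V' k) s \<le> (\<integral>\<^sup>+\<omega>. (\<integral>\<^sup>+u.
        2 * (ennreal ((V k u \<omega> - Z (max 0 u) \<omega>)\<^sup>2) * indicator {0..T} u)
        + 2 * (ennreal ((V' k u \<omega> - Z (max 0 u) \<omega>)\<^sup>2) * indicator {0..s} u) \<partial>lborel) \<partial>M)"
      unfolding d_def
    proof (intro nn_integral_mono)
      fix u \<omega>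
      have "(V k u \<omega> - V' k u \<omega>)\<^sup>2 \<le> 2 * (V k u \<omega> - Z (max 0 u) \<omega>)\<^sup>2 + 2 * (V' k u \<omega> - Z (max 0 u) \<omega>)\<^sup>2"
        using sum_sq_le[of "V k u \<omega> - Z (max 0 u) \<omega>" "Z (max 0 u) \<omega> - V' k u \<omega>"]
        by (simp add: power2_commute)
      then have "ennreal ((V k u \<omega> - V' k u \<omega>)\<^sup>2)
          \<le> 2 * ennreal ((V k u \<omega> - Z (max 0 u) \<omega>)\<^sup>2) + 2 * ennreal ((V' k u \<omega> - Z (max 0 u) \<omega>)\<^sup>2)"
        by (simp add: ennreal_leI flip: ennreal_mult' ennreal_plus ennreal_numeral)
      then show "ennreal ((V k u \<omega> - V' k u \<omega>)\<^sup>2) * indicator {0..s} u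
          \<le> 2 * (ennreal ((V k u \<omega> - Z (max 0 u) \<omega>)\<^sup>2) * indicator {0..T} u)
            + 2 * (ennreal ((V' k u \<omega> - Z (max 0 u) \<omega>)\<^sup>2) * indicator {0..s} u)"
        using sT by (auto split: split_indicator)
    qed
    also have "\<dots> = (\<integral>\<^sup>+\<omega>. 2 * (\<integral>\<^sup>+u\<in>{0..T}. ennreal ((V k u \<omega> - Z (max 0 u) \<omega>)\<^sup>2) \<partial>lborel)
        + 2 * (\<integral>\<^sup>+u\<in>{0..s}. ennreal ((V' k u \<omega> - Z (max 0 u) \<omega>)\<^sup>2) \<partial>lborel) \<partial>M)"
    proof (rule nn_integral_cong)
      fix \<omega> assume \<omega>: "\<omega> \<in> space M"
      have [measurable]: "(\<lambda>u. V k u \<omega>) \<in> borel_measurable lborel"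
        "(\<lambda>u. V' k u \<omega>) \<in> borel_measurable lborel"
        "(\<lambda>u. Z (max 0 u) \<omega>) \<in> borel_measurable lborel"
        using measurable_Pair1[OF Vm(1)[of k] \<omega>] measurable_Pair1[OF Vm(2)[of k] \<omega>]
          measurable_Pair1[OF Zm \<omega>] by simp_all
      show "(\<integral>\<^sup>+u. 2 * (ennreal ((V k u \<omega> - Z (max 0 u) \<omega>)\<^sup>2) * indicator {0..T} u)
          + 2 * (ennreal ((V' k u \<omega> - Z (max 0 u) \<omega>)\<^sup>2) * indicator {0..s} u) \<partial>lborel)
        = 2 * (\<integral>\<^sup>+u\<in>{0..T}. ennreal ((V k u \<omega> - Z (max 0 u) \<omega>)\<^sup>2) \<partial>lborel)
        + 2 * (\<integral>\<^sup>+u\<in>{0..s}. ennreal ((V' k u \<omega> - Z (max 0 u) \<omega>)\<^sup>2) \<partial>lborel)"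
        by (subst nn_integral_add) (auto simp: nn_integral_cmult)
    qed
    also have "\<dots> = 2 * d (V k) Z T + 2 * d (V' k) Z s"
      unfolding d_Z unfolding d_def
      by (subst nn_integral_add) (auto simp: nn_integral_cmult)
    finally show ?thesis .
  qed
  define e where "e k = (\<integral>\<^sup>+\<omega>. ennreal ((S k s \<omega> - J s \<omega>)\<^sup>2) \<partial>M)" for k
  define e' where "e' k = (\<integral>\<^sup>+\<omega>. ennreal ((S' k s \<omega> - J s \<omega>)\<^sup>2) \<partial>M)" for k
  have d_S: "d (V k) (V' k) s = (\<integral>\<^sup>+\<omega>. ennreal ((S k s \<omega> - S' k s \<omega>)\<^sup>2) \<partial>M)" for k
    unfolding d_def V_def V'_def S_def S'_def simple_integral_diff_isometry[OF P P' sT(1)] ..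
  have e_le: "e k \<le> 2 * (2 * d (V k) Z T + 2 * d (V' k) Z s) + 2 * e' k" for k
  proof -
    note [measurable] = J_at(1)[OF sT(1)] SI[OF sT(1), THEN sq_integrable_measurable]
    have "e k \<le> (\<integral>\<^sup>+\<omega>. 2 * ennreal ((S k s \<omega> - S' k s \<omega>)\<^sup>2)
        + 2 * ennreal ((S' k s \<omega> - J s \<omega>)\<^sup>2) \<partial>M)"
      unfolding e_def
    proof (intro nn_integral_mono)
      fix \<omega>
      show "ennreal ((S k s \<omega> - J s \<omega>)\<^sup>2)
        \<le> 2 * ennreal ((S k s \<omega> - S' k s \<omega>)\<^sup>2)
        + 2 * ennreal ((S' k s \<omega> - J s \<omega>)\<^sup>2)"
        using sum_sq_le[of "S k s \<omega> - S' k s \<omega>"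
          "S' k s \<omega> - J s \<omega>"]
        by (simp add: ennreal_leI flip: ennreal_mult' ennreal_plus ennreal_numeral)
    qed
    also have "\<dots> = 2 * d (V k) (V' k) s + 2 * e' k"
      unfolding e'_def d_S by (simp add: nn_integral_add nn_integral_cmult)
    also have "\<dots> \<le> 2 * (2 * d (V k) Z T + 2 * d (V' k) Z s) + 2 * e' k"
      by (intro add_right_mono mult_left_mono d_tri) simp
    finally show ?thesis .
  qed
  have "(\<lambda>k. 2 * (2 * d (V k) Z T + 2 * d (V' k) Z s) + 2 * e' k) \<longlonglongrightarrow> 2 * (2 * 0 + 2 * 0) + 2 * 0"
    using PZ PZ' PJ' unfolding d_def e'_def
    by (intro tendsto_add ennreal_tendsto_cmult) auto
  then have lim: "(\<lambda>k. 2 * (2 * d (V k) Z T + 2 * d (V' k) Z s) + 2 * e' k) \<longlonglongrightarrow> 0" by simp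
  have "e \<longlonglongrightarrow> 0"
    by (rule tendsto_sandwich[OF _ _ tendsto_const lim]; rule always_eventually; rule allI)
      (simp, rule e_le)
  then have PJs: "(\<lambda>k. \<integral>\<^sup>+\<omega>. ennreal ((S k s \<omega> - J s \<omega>)\<^sup>2) \<partial>M) \<longlonglongrightarrow> 0"
    by (simp add: e_def[abs_def])
  \<comment> \<open>Both limits run along the same simple integrals \<open>S k\<close>, and for each
    \<open>k\<close> their increment from \<open>s\<close> to \<open>T\<close> is orthogonal to
    \<open>\<psi>\<close>.\<close>
  have "(\<lambda>k. expectation (\<lambda>\<omega>. \<psi> \<omega> * S k T \<omega>)
      - expectation (\<lambda>\<omega>. \<psi> \<omega> * S k s \<omega>))
    \<longlonglongrightarrow> expectation (\<lambda>\<omega>. \<psi> \<omega> * J T \<omega>) - expectation (\<lambda>\<omega>. \<psi> \<omega> * J s \<omega>)"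
    by (intro tendsto_diff sq_integrable_limit(2)[OF _ _ _ \<psi>(2)] SI J_at T0 sT PJ PJs)
  moreover have "expectation (\<lambda>\<omega>. \<psi> \<omega> * S k T \<omega>)
      - expectation (\<lambda>\<omega>. \<psi> \<omega> * S k s \<omega>) = 0" for k
    using simple_integral_orthogonal[OF P[of k] sT \<psi>, folded S_def]
      sq_integrable_mult[OF \<psi>(2) SI(1)[OF T0, of k]] sq_integrable_mult[OF \<psi>(2) SI(1)[OF sT(1), of k]]
    by (simp add: right_diff_distrib)
  ultimately have "expectation (\<lambda>\<omega>. \<psi> \<omega> * J T \<omega>) - expectation (\<lambda>\<omega>. \<psi> \<omega> * J s \<omega>) = 0"
    by (simp add: LIMSEQ_const_iff)
  moreover have "sq_integrable M (J s)"
    by (rule sq_integrable_limit(1)[OF SI(2)[OF sT(1)] J_at(1)[OF sT(1)] PJ'])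
  ultimately show "expectation (\<lambda>\<omega>. \<psi> \<omega> * (J T \<omega> - J s \<omega>)) = 0"
    using sq_integrable_mult[OF \<psi>(2) \<open>sq_integrable M (J T)\<close>] sq_integrable_mult[OF \<psi>(2), of "J s"]
    by (simp add: right_diff_distrib)
qed

end

subsection \<open>The product rule\<close>

lemma indicator_ray_mult:
  "indicator {s..} u * c = (if s \<le> u then c else (0::real))"
  "indicator {..s} u * c = (if u \<le> s then c else (0::real))"
  by (auto simp: indicator_def)

text \<open>Fubini on the triangle \<open>s \<le> u\<close>, where \<open>indicator {s..} u\<close>
  and \<open>indicator {..u} s\<close> coincide. It plays the part of integration by parts.\<close>

lemma integral_triangle_swap:
  fixes p q :: "real \<Rightarrow> real"
  assumes U: "finite_measure U" "sets U = sets borel" and p: "integrable U p" and q: "integrable U q"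
  shows "(\<integral>s. p s * (\<integral>u. indicator {s..} u * q u \<partial>U) \<partial>U)
    = (\<integral>u. (\<integral>s. indicator {..u} s * p s \<partial>U) * q u \<partial>U)"
proof -
  interpret U: finite_measure U by fact
  interpret UU: pair_sigma_finite U U ..
  note U(2)[measurable_cong]
  note [measurable] = borel_measurable_integrable[OF p] borel_measurable_integrable[OF q]
  have pq: "integrable (U \<Otimes>\<^sub>M U) (\<lambda>z. p (fst z) * q (snd z))"
  proof (rule UU.Fubini_integrable)
    show "integrable U (\<lambda>s. \<integral>u. norm (p (fst (s, u)) * q (snd (s, u))) \<partial>U)"
      using p by (simp add: abs_mult)
    show "AE s in U. integrable U (\<lambda>u. p (fst (s, u)) * q (snd (s, u)))"
      using q by simp
  qed measurable
  have "integrable (U \<Otimes>\<^sub>M U) (\<lambda>(s, u). p s * (indicator {s..} u * q u))"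
    unfolding indicator_ray_mult
    by (rule Bochner_Integration.integrable_bound[OF pq]) (auto simp: case_prod_unfold)
  from UU.Fubini_integral[OF this]
  have "(\<integral>s. \<integral>u. p s * (indicator {s..} u * q u) \<partial>U \<partial>U)
      = (\<integral>u. \<integral>s. p s * (indicator {s..} u * q u) \<partial>U \<partial>U)" by simp
  also have "\<dots> = (\<integral>u. \<integral>s. (indicator {..u} s * p s) * q u \<partial>U \<partial>U)"
    by (intro Bochner_Integration.integral_cong refl) (auto split: split_indicator)
  finally show ?thesis by (simp only: integral_mult_right_zero integral_mult_left_zero)
qed

text \<open>The product rule for \<open>exp (- r * t)\<close> and an absolutely continuous path.
  Swapping a triangle avoids almost everywhere derivatives of \<open>x\<close>; only the exponential
  is differentiated. The second form writes the integral up to \<open>s\<close> over the fixed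
  measure \<open>time_upto t\<close>, which is the shape that \<open>product_expectation\<close>
  works with.\<close>

lemma discounted_primitive:
  assumes p: "set_integrable lborel {0..t} p" and pm: "p \<in> borel_measurable borel"
    and t: "0 \<le> t" and x: "\<And>s. 0 \<le> s \<Longrightarrow> s \<le> t \<Longrightarrow> x s = x 0 + (LINT u:{0..s}|lborel. p u)"
    and xm: "x \<in> borel_measurable borel" and r: "r > 0"
  shows "exp (- r * t) * x t = x 0 + (\<integral>s. exp (- r * s) * (p s - r * x s) \<partial>time_upto t)"
    and "\<And>s. 0 \<le> s \<Longrightarrow> s \<le> t \<Longrightarrow>
      exp (- r * s) * x s = x 0 + (\<integral>u. indicator {..s} u * (exp (- r * u) * (p u - r * x u)) \<partial>time_upto t)"
proof -
  \<comment> \<open>The end point is generalised because the second claim uses the identity at every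
    \<open>s \<le> t\<close>.\<close>
  have main: "exp (- r * t) * x t = x 0 + (\<integral>s. exp (- r * s) * (p s - r * x s) \<partial>time_upto t)"
    if p: "set_integrable lborel {0..t} p" and t: "0 \<le> t"
      and x: "\<And>s. 0 \<le> s \<Longrightarrow> s \<le> t \<Longrightarrow> x s = x 0 + (LINT u:{0..s}|lborel. p u)" for t
  proof -
    note [measurable] = pm xm
    let ?U = "time_upto t"
    interpret U: finite_measure ?U by (rule finite_time_upto)
    have pU: "integrable ?U p" using p by (simp add: integrable_time_upto[OF pm])
    have FTC: "(LINT u:{s..t}|lborel. r * exp (- r * u)) = exp (- r * s) - exp (- r * t)" if "s \<le> t" for s
    proof -
      have "(\<integral>u. (r * exp (- r * u)) * indicator {s..t} u \<partial>lborel) = - exp (- r * t) - (- exp (- r * s))"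
        by (rule integral_FTC_Icc_real[OF that]) (auto intro!: derivative_eq_intros)
      moreover have "(LINT u:{s..t}|lborel. r * exp (- r * u)) = (\<integral>u. (r * exp (- r * u)) * indicator {s..t} u \<partial>lborel)"
        unfolding set_lebesgue_integral_def by (rule Bochner_Integration.integral_cong) auto
      ultimately show ?thesis by simp
    qed
    have eU: "integrable ?U (\<lambda>s. f s * exp (- r * s))" if "integrable ?U f" for f
    proof (rule Bochner_Integration.integrable_bound[OF that])
      show "AE s in ?U. norm (f s * exp (- r * s)) \<le> norm (f s)"
        using r by (intro AE_time_upto) (auto simp: abs_mult mult_left_le)
    qed (use borel_measurable_integrable[OF that] in measurable)
    define P where "P s = (\<integral>u. indicator {..s} u * p u \<partial>?U)" for s
    have P: "P s = (LINT u:{0..s}|lborel. p u)" if "s \<le> t" for s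
      unfolding P_def by (rule integral_time_upto_before[OF pm that])
    have Pm[measurable]: "P \<in> borel_measurable borel" unfolding P_def indicator_ray_mult by measurable
    have PU: "integrable ?U P"
    proof (rule U.integrable_const_bound[of _ "\<integral>u. \<bar>p u\<bar> \<partial>?U"])
      show "AE s in ?U. norm (P s) \<le> (\<integral>u. \<bar>p u\<bar> \<partial>?U)"
      proof (rule AE_I2)
        fix s
        have "norm (P s) \<le> (\<integral>u. norm (indicator {..s} u * p u) \<partial>?U)"
          unfolding P_def by (rule integral_norm_bound)
        also have "\<dots> \<le> (\<integral>u. \<bar>p u\<bar> \<partial>?U)"
          using pU by (intro integral_mono') (auto split: split_indicator)
        finally show "norm (P s) \<le> (\<integral>u. \<bar>p u\<bar> \<partial>?U)" .
      qed
    qed measurable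
    have "(\<integral>u. P u * (r * exp (- r * u)) \<partial>?U) = (\<integral>s. p s * (\<integral>u. indicator {s..} u * (r * exp (- r * u)) \<partial>?U) \<partial>?U)"
      unfolding P_def
      by (rule integral_triangle_swap[symmetric, OF finite_time_upto _ pU])
        (use eU[of "\<lambda>_. r"] in auto)
    also have "\<dots> = (\<integral>s. p s * (exp (- r * s) - exp (- r * t)) \<partial>?U)"
    proof (rule integral_cong_AE)
      have "(\<integral>u. indicator {s..} u * (r * exp (- r * u)) \<partial>?U) = exp (- r * s) - exp (- r * t)"
        if "0 \<le> s" "s \<le> t" for s
        by (rule trans[OF integral_time_upto_after FTC]) (use that in auto)
      then show "AE s in ?U. p s * (\<integral>u. indicator {s..} u * (r * exp (- r * u)) \<partial>?U)
          = p s * (exp (- r * s) - exp (- r * t))"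
        by (intro AE_time_upto) simp
    qed (unfold indicator_ray_mult, measurable)
    also have "\<dots> = (\<integral>s. p s * exp (- r * s) \<partial>?U) - exp (- r * t) * P t"
      using eU[OF pU] pU by (simp add: right_diff_distrib P integral_time_upto)
    finally have 1: "(\<integral>u. P u * (r * exp (- r * u)) \<partial>?U)
        = (\<integral>s. p s * exp (- r * s) \<partial>?U) - exp (- r * t) * P t" .
    have 2: "(\<integral>u. r * exp (- r * u) \<partial>?U) = 1 - exp (- r * t)"
      using FTC[OF t] by (subst integral_time_upto) auto
    have "(\<integral>s. exp (- r * s) * (p s - r * x s) \<partial>?U)
        = (\<integral>s. p s * exp (- r * s) - (x 0 * (r * exp (- r * s)) + P s * (r * exp (- r * s))) \<partial>?U)"
    proof (rule integral_cong_AE)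
      have "exp (- r * s) * (p s - r * x s) = p s * exp (- r * s)
          - (x 0 * (r * exp (- r * s)) + P s * (r * exp (- r * s)))" if "0 \<le> s" "s \<le> t" for s
        unfolding x[OF that] P[OF that(2), symmetric] by (simp add: algebra_simps)
      then show "AE s in ?U. exp (- r * s) * (p s - r * x s) = p s * exp (- r * s)
          - (x 0 * (r * exp (- r * s)) + P s * (r * exp (- r * s)))"
        by (rule AE_time_upto)
    qed measurable
    also have "\<dots> = (\<integral>s. p s * exp (- r * s) \<partial>?U)
        - (x 0 * (\<integral>u. r * exp (- r * u) \<partial>?U) + (\<integral>u. P u * (r * exp (- r * u)) \<partial>?U))"
      using eU[OF pU] eU[of "\<lambda>_. r"] eU[OF integrable_mult_left[OF PU, of r]]
      by (simp add: mult.assoc)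
    also have "\<dots> = exp (- r * t) * P t - x 0 * (1 - exp (- r * t))" unfolding 1 2 by simp
    finally show ?thesis using x[OF t] P[of t] by (simp add: algebra_simps)
  qed
  show "exp (- r * t) * x t = x 0 + (\<integral>s. exp (- r * s) * (p s - r * x s) \<partial>time_upto t)"
    by (rule main[OF p t x])
  fix s assume s: "0 \<le> s" "s \<le> t"
  note [measurable] = pm xm
  have "exp (- r * s) * x s = x 0 + (\<integral>s. exp (- r * s) * (p s - r * x s) \<partial>time_upto s)"
    by (rule main[OF set_integrable_subset[OF p] s(1) x]) (use s in auto)
  also have "(\<integral>s. exp (- r * s) * (p s - r * x s) \<partial>time_upto s)
      = (\<integral>u. indicator {..s} u * (exp (- r * u) * (p u - r * x u)) \<partial>time_upto t)"
    by (subst integral_time_upto_before) (use s in \<open>auto simp: integral_time_upto\<close>)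
  finally show "exp (- r * s) * x s
    = x 0 + (\<integral>u. indicator {..s} u * (exp (- r * u) * (p u - r * x u)) \<partial>time_upto t)" .
qed

text \<open>A nonzero limit would keep \<open>\<bar>h\<bar>\<close> above
  \<open>\<bar>l\<bar> / 2\<close> on a whole ray, which has infinite measure.\<close>

lemma integrable_tendsto_zero:
  fixes h :: "real \<Rightarrow> real"
  assumes "set_integrable lborel {0..} h" and lim: "(h \<longlongrightarrow> l) at_top"
  shows "l = 0"
proof (rule ccontr)
  assume "l \<noteq> 0"
  then have "eventually (\<lambda>T. \<bar>l\<bar> / 2 < \<bar>h T\<bar>) at_top"
    by (intro order_tendstoD(1)[OF tendsto_rabs[OF lim]]) auto
  then obtain T0 where T0: "\<And>T. T0 \<le> T \<Longrightarrow> \<bar>l\<bar> / 2 < \<bar>h T\<bar>" by (auto simp: eventually_at_top_linorder)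
  have "set_integrable lborel {max 0 T0..} (\<lambda>_. \<bar>l\<bar> / 2)"
    unfolding set_integrable_def
  proof (rule Bochner_Integration.integrable_bound[OF assms(1)[unfolded set_integrable_def]])
    show "AE T in lborel. norm (indicator {max 0 T0..} T *\<^sub>R (\<bar>l\<bar> / 2)) \<le> norm (indicator {0..} T *\<^sub>R h T)"
      using T0 by (auto split: split_indicator intro!: less_imp_le AE_I2)
  qed measurable
  then have int: "integrable lborel (\<lambda>T. \<bar>l\<bar> / 2 * indicator {max 0 T0..} T)"
    by (simp add: set_integrable_def mult.commute)
  then have "integrable lborel (indicator {max 0 T0..} :: real \<Rightarrow> real)"
    using integrable_mult_right[OF int, of "2 / \<bar>l\<bar>"] \<open>l \<noteq> 0\<close>
    by simp
  then have "emeasure lborel {max 0 T0..} < \<infinity>"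
    by (simp add: integrable_indicator_iff)
  moreover have "emeasure lborel {max 0 T0..} = \<infinity>"
  proof -
    have "ennreal (real n) \<le> emeasure lborel {max 0 T0..}" for n
    proof -
      have "ennreal (real n) = emeasure lborel {max 0 T0..max 0 T0 + real n}" by simp
      also have "\<dots> \<le> emeasure lborel {max 0 T0..}" by (intro emeasure_mono) auto
      finally show ?thesis .
    qed
    then show ?thesis
      by (metis ennreal_of_nat_eq_real_of_nat infinity_ennreal_def ennreal_Ex_less_of_nat
          leD less_top)
  qed
  ultimately show False by simp
qed

text \<open>Orthogonality at time \<open>s\<close> replaces \<open>yT\<close>, tested against
  \<open>p s\<close>, by \<open>y s\<close> minus the integral of \<open>q\<close> after
  \<open>s\<close>. Exchanging the triangle moves this tail of \<open>q\<close> into the running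
  integral of \<open>p\<close>. Only expectations occur, so \<open>y\<close> may carry a martingale
  part without pathwise calculus.\<close>

lemma (in prob_space) product_expectation:
  fixes T :: real and p q y :: "real \<Rightarrow> 'a \<Rightarrow> real"
  defines "U \<equiv> time_upto T"
  assumes p: "sq_integrable (U \<Otimes>\<^sub>M M) (case_prod p)"
    and q: "sq_integrable (U \<Otimes>\<^sub>M M) (case_prod q)"
    and y: "sq_integrable (U \<Otimes>\<^sub>M M) (case_prod y)"
    and x0: "sq_integrable M x0" and y0: "sq_integrable M y0" and yT: "sq_integrable M yT"
    and orth0: "expectation (\<lambda>\<omega>. x0 \<omega> * (yT \<omega> - y0 \<omega> + (\<integral>u. q u \<omega> \<partial>U))) = 0"
    and orth: "\<And>s. 0 \<le> s \<Longrightarrow> s \<le> T \<Longrightarrow> sq_integrable M (p s) \<Longrightarrow>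
      expectation (\<lambda>\<omega>. p s \<omega> * (yT \<omega> - y s \<omega> + (\<integral>u. indicator {s..} u * q u \<omega> \<partial>U))) = 0"
  shows "expectation (\<lambda>\<omega>. (x0 \<omega> + (\<integral>u. p u \<omega> \<partial>U)) * yT \<omega>) = expectation (\<lambda>\<omega>. x0 \<omega> * y0 \<omega>)
    + (\<integral>s. expectation (\<lambda>\<omega>. p s \<omega> * y s \<omega>
        - (x0 \<omega> + (\<integral>u. indicator {..s} u * p u \<omega> \<partial>U)) * q s \<omega>) \<partial>U)"
proof -
  interpret U: finite_measure U unfolding U_def by (rule finite_time_upto)
  interpret UM: pair_sigma_finite U M ..
  let ?N = "U \<Otimes>\<^sub>M M"
  have sU[measurable_cong]: "sets U = sets borel" by (simp add: U_def)
  have [measurable]: "case_prod p \<in> borel_measurable ?N" "case_prod q \<in> borel_measurable ?N"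
    "case_prod y \<in> borel_measurable ?N" using p q y by (auto simp: sq_integrable_def)
  have pm: "case_prod p \<in> borel_measurable (borel \<Otimes>\<^sub>M M)" "case_prod q \<in> borel_measurable (borel \<Otimes>\<^sub>M M)"
    "case_prod y \<in> borel_measurable (borel \<Otimes>\<^sub>M M)" by measurable
  note [measurable] = pm sq_integrable_measurable[OF x0] sq_integrable_measurable[OF y0]
    sq_integrable_measurable[OF yT]
  have fm: "finite_measure U" "sigma_finite_measure M" by unfold_locales
  note sp = sq_integrable_section_integral[OF fm p] and sq = sq_integrable_section_integral[OF fm q]
  define R where "R s \<omega> = (\<integral>u. indicator {s..} u * q u \<omega> \<partial>U)" for s \<omega>
  define P where "P s \<omega> = (\<integral>u. indicator {..s} u * p u \<omega> \<partial>U)" for s \<omega>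
  have Rm[measurable]: "case_prod R \<in> borel_measurable ?N" "case_prod P \<in> borel_measurable ?N"
    unfolding R_def P_def indicator_ray_mult by measurable
  \<comment> \<open>One null set serves all Borel sets, hence all times \<open>s\<close>
    simultaneously.\<close>
  have absq: "AE \<omega> in M. \<forall>A\<in>sets borel. \<bar>\<integral>u. indicator A u * q u \<omega> \<partial>U\<bar> \<le> (\<integral>u. \<bar>q u \<omega>\<bar> \<partial>U)"
    and absp: "AE \<omega> in M. \<forall>A\<in>sets borel. \<bar>\<integral>u. indicator A u * p u \<omega> \<partial>U\<bar> \<le> (\<integral>u. \<bar>p u \<omega>\<bar> \<partial>U)"
  proof -
    have *: "\<bar>\<integral>u. indicator A u * f u \<partial>U\<bar> \<le> (\<integral>u. \<bar>f u\<bar> \<partial>U)" if "sq_integrable U f" for f and A :: "real set"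
    proof -
      have "\<bar>\<integral>u. indicator A u * f u \<partial>U\<bar> \<le> (\<integral>u. norm (indicator A u * f u) \<partial>U)"
        using integral_norm_bound[of U "\<lambda>u. indicator A u * f u"] by simp
      also have "\<dots> \<le> (\<integral>u. \<bar>f u\<bar> \<partial>U)"
        using U.sq_integrable_imp_integrable[OF that] by (intro integral_mono') (auto split: split_indicator)
      finally show ?thesis .
    qed
    show "AE \<omega> in M. \<forall>A\<in>sets borel. \<bar>\<integral>u. indicator A u * q u \<omega> \<partial>U\<bar> \<le> (\<integral>u. \<bar>q u \<omega>\<bar> \<partial>U)"
      using sq(3) by eventually_elim (use * in blast)
    show "AE \<omega> in M. \<forall>A\<in>sets borel. \<bar>\<integral>u. indicator A u * p u \<omega> \<partial>U\<bar> \<le> (\<integral>u. \<bar>p u \<omega>\<bar> \<partial>U)"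
      using sp(3) by eventually_elim (use * in blast)
  qed
  \<comment> \<open>A bound by a function of \<open>\<omega>\<close> alone, uniform in time, passes
    to the product because the time measure is finite; it is applied to \<open>R\<close> and
    \<open>P\<close>.\<close>
  have dom: "sq_integrable ?N (case_prod g)"
    if "AE \<omega> in M. \<forall>s. \<bar>g s \<omega>\<bar> \<le> f \<omega>" "sq_integrable M f" "case_prod g \<in> borel_measurable ?N" for g f
  proof (rule sq_integrable_bound[OF sq_integrable_snd[OF fm that(2)] that(3)])
    note [measurable] = that(3) sq_integrable_measurable[OF that(2)]
    have gm: "(\<lambda>z. g (fst z) (snd z)) \<in> borel_measurable ?N" using that(3) by (simp add: case_prod_unfold)
    note [measurable] = gm
    show "AE z in ?N. \<bar>case_prod g z\<bar> \<le> \<bar>case z of (s, \<omega>) \<Rightarrow> f \<omega>\<bar>"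
    proof (rule UM.AE_pair_measure)
      show "AE s in U. AE \<omega> in M. \<bar>case (s, \<omega>) of (s, \<omega>) \<Rightarrow> g s \<omega>\<bar> \<le> \<bar>case (s, \<omega>) of (s, \<omega>) \<Rightarrow> f \<omega>\<bar>"
      proof (rule AE_I2)
        fix s
        show "AE \<omega> in M. \<bar>case (s, \<omega>) of (s, \<omega>) \<Rightarrow> g s \<omega>\<bar> \<le> \<bar>case (s, \<omega>) of (s, \<omega>) \<Rightarrow> f \<omega>\<bar>"
          using that(1) by eventually_elim (auto intro: order_trans[OF _ abs_ge_self])
      qed
    qed (simp add: case_prod_unfold)
  qed
  have Rs: "sq_integrable ?N (case_prod R)" "sq_integrable ?N (case_prod P)"
  proof -
    show "sq_integrable ?N (case_prod R)"
      by (rule dom[OF _ sq(1) Rm(1)]) (use absq in \<open>eventually_elim, auto simp: R_def\<close>)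
    show "sq_integrable ?N (case_prod P)"
      by (rule dom[OF _ sp(1) Rm(2)]) (use absp in \<open>eventually_elim, auto simp: P_def\<close>)
  qed
  have x0N: "sq_integrable ?N (\<lambda>(s, \<omega>). x0 \<omega>)" "sq_integrable ?N (\<lambda>(s, \<omega>). yT \<omega>)"
    by (rule sq_integrable_snd[OF fm] x0 yT)+
  have prod: "integrable ?N (\<lambda>(s, \<omega>). f s \<omega> * g s \<omega>)"
    if "sq_integrable ?N (case_prod f)" "sq_integrable ?N (case_prod g)" for f g
    using sq_integrable_mult[OF that] by (simp add: case_prod_unfold)
  note int = prod[OF p y] prod[OF p x0N(2)] prod[OF p Rs(1)] prod[OF Rs(2) q] prod[OF x0N(1) q]
  note expU = UM.integrable_fst[OF int(1)] UM.integrable_fst[OF int(2)] UM.integrable_fst[OF int(3)]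
    UM.integrable_fst[OF int(4)] UM.integrable_fst[OF int(5)]
  note AEU = UM.AE_integrable_fst[OF int(1)] UM.AE_integrable_fst[OF int(2)] UM.AE_integrable_fst[OF int(3)]
    UM.AE_integrable_fst[OF int(4)] UM.AE_integrable_fst[OF int(5)]
  have ip: "sq_integrable M (\<lambda>\<omega>. \<integral>u. p u \<omega> \<partial>U)"
    by (rule sq_integrable_bound[OF sp(1)]) (use absp in \<open>auto elim!: eventually_mono dest!: bspec[of _ _ UNIV]\<close>)
  have iq: "sq_integrable M (\<lambda>\<omega>. \<integral>u. q u \<omega> \<partial>U)"
    by (rule sq_integrable_bound[OF sq(1)]) (use absq in \<open>auto elim!: eventually_mono dest!: bspec[of _ _ UNIV]\<close>)
  have e1: "expectation (\<lambda>\<omega>. (x0 \<omega> + (\<integral>u. p u \<omega> \<partial>U)) * yT \<omega>)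
      = expectation (\<lambda>\<omega>. x0 \<omega> * yT \<omega>) + expectation (\<lambda>\<omega>. (\<integral>u. p u \<omega> \<partial>U) * yT \<omega>)"
    using sq_integrable_mult[OF x0 yT] sq_integrable_mult[OF ip yT] by (simp add: distrib_right)
  have e2: "expectation (\<lambda>\<omega>. x0 \<omega> * yT \<omega>)
      = expectation (\<lambda>\<omega>. x0 \<omega> * y0 \<omega>) - expectation (\<lambda>\<omega>. x0 \<omega> * (\<integral>u. q u \<omega> \<partial>U))"
    using orth0 sq_integrable_mult[OF x0 yT] sq_integrable_mult[OF x0 y0] sq_integrable_mult[OF x0 iq]
    by (simp add: algebra_simps)
  have e3: "expectation (\<lambda>\<omega>. x0 \<omega> * (\<integral>u. q u \<omega> \<partial>U)) = (\<integral>s. expectation (\<lambda>\<omega>. x0 \<omega> * q s \<omega>) \<partial>U)"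
    using UM.Fubini_integral[OF int(5)] by simp
  have e4: "expectation (\<lambda>\<omega>. (\<integral>u. p u \<omega> \<partial>U) * yT \<omega>) = (\<integral>s. expectation (\<lambda>\<omega>. p s \<omega> * yT \<omega>) \<partial>U)"
    using UM.Fubini_integral[OF int(2)] by simp
  \<comment> \<open>Orthogonality is assumed only where \<open>p s\<close> is square integrable; by
    Fubini this is almost every \<open>s\<close>.\<close>
  have pM: "AE s in U. sq_integrable M (p s)"
  proof -
    have "AE s in U. integrable M (\<lambda>\<omega>. (p s \<omega>)\<^sup>2)"
      by (rule UM.AE_integrable_fst) (use p in \<open>simp add: sq_integrable_def case_prod_unfold\<close>)
    then show ?thesis by eventually_elim (auto simp: sq_integrable_def)
  qed
  have U_AE: "AE s in U. 0 \<le> s \<and> s \<le> T" unfolding U_def by (rule AE_time_upto) auto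
  have "(\<integral>s. expectation (\<lambda>\<omega>. p s \<omega> * yT \<omega>) \<partial>U)
      = (\<integral>s. expectation (\<lambda>\<omega>. p s \<omega> * y s \<omega>) - expectation (\<lambda>\<omega>. p s \<omega> * R s \<omega>) \<partial>U)"
  proof (rule integral_cong_AE)
    show "AE s in U. expectation (\<lambda>\<omega>. p s \<omega> * yT \<omega>)
        = expectation (\<lambda>\<omega>. p s \<omega> * y s \<omega>) - expectation (\<lambda>\<omega>. p s \<omega> * R s \<omega>)"
      using pM U_AE AEU(1,2,3)
    proof eventually_elim
      case (elim s)
      then have "expectation (\<lambda>\<omega>. p s \<omega> * (yT \<omega> - y s \<omega> + R s \<omega>)) = 0"
        using orth[of s] by (simp add: R_def)
      with elim(3-5) show ?case by (simp add: distrib_left right_diff_distrib)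
    qed
  qed measurable
  also have "\<dots> = (\<integral>s. expectation (\<lambda>\<omega>. p s \<omega> * y s \<omega>) \<partial>U) - (\<integral>s. expectation (\<lambda>\<omega>. p s \<omega> * R s \<omega>) \<partial>U)"
    by (rule Bochner_Integration.integral_diff[OF expU(1,3)])
  also have "(\<integral>s. expectation (\<lambda>\<omega>. p s \<omega> * R s \<omega>) \<partial>U) = expectation (\<lambda>\<omega>. \<integral>s. p s \<omega> * R s \<omega> \<partial>U)"
    by (rule UM.Fubini_integral[symmetric, OF int(3)])
  \<comment> \<open>The triangle is exchanged path by path, which is legitimate for almost every
    \<open>\<omega>\<close>: square integrable sections are integrable over the finite measure
    \<open>U\<close>.\<close>
  also have "\<dots> = expectation (\<lambda>\<omega>. \<integral>s. P s \<omega> * q s \<omega> \<partial>U)"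
  proof (rule integral_cong_AE)
    show "AE \<omega> in M. (\<integral>s. p s \<omega> * R s \<omega> \<partial>U) = (\<integral>s. P s \<omega> * q s \<omega> \<partial>U)"
      using sp(3) sq(3)
    proof eventually_elim
      case (elim \<omega>)
      then show ?case
        unfolding R_def P_def
        by (intro integral_triangle_swap U.sq_integrable_imp_integrable fm sU)
    qed
  qed measurable
  also have "\<dots> = (\<integral>s. expectation (\<lambda>\<omega>. P s \<omega> * q s \<omega>) \<partial>U)"
    by (rule UM.Fubini_integral[OF int(4)])
  finally have e5: "(\<integral>s. expectation (\<lambda>\<omega>. p s \<omega> * yT \<omega>) \<partial>U)
    = (\<integral>s. expectation (\<lambda>\<omega>. p s \<omega> * y s \<omega>) \<partial>U) - (\<integral>s. expectation (\<lambda>\<omega>. P s \<omega> * q s \<omega>) \<partial>U)" .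
  have "(\<integral>s. expectation (\<lambda>\<omega>. p s \<omega> * y s \<omega> - (x0 \<omega> + P s \<omega>) * q s \<omega>) \<partial>U)
      = (\<integral>s. expectation (\<lambda>\<omega>. p s \<omega> * y s \<omega>)
          - (expectation (\<lambda>\<omega>. x0 \<omega> * q s \<omega>) + expectation (\<lambda>\<omega>. P s \<omega> * q s \<omega>)) \<partial>U)"
  proof (rule integral_cong_AE)
    show "AE s in U. expectation (\<lambda>\<omega>. p s \<omega> * y s \<omega> - (x0 \<omega> + P s \<omega>) * q s \<omega>)
        = expectation (\<lambda>\<omega>. p s \<omega> * y s \<omega>)
          - (expectation (\<lambda>\<omega>. x0 \<omega> * q s \<omega>) + expectation (\<lambda>\<omega>. P s \<omega> * q s \<omega>))"
      using AEU(1,4,5) by eventually_elim (simp add: distrib_right)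
  qed measurable
  also have "\<dots> = (\<integral>s. expectation (\<lambda>\<omega>. p s \<omega> * y s \<omega>) \<partial>U)
      - ((\<integral>s. expectation (\<lambda>\<omega>. x0 \<omega> * q s \<omega>) \<partial>U) + (\<integral>s. expectation (\<lambda>\<omega>. P s \<omega> * q s \<omega>) \<partial>U))"
    using expU by simp
  finally show ?thesis using e1 e2 e3 e4 e5 unfolding P_def by linarith
qed

lemma AE_time_fst:
  assumes "sigma_finite_measure M"
  shows "AE z in time_upto T \<Otimes>\<^sub>M M. 0 \<le> fst z \<and> fst z \<le> T"
    and "r > 0 \<Longrightarrow> AE z in disc r M. 0 \<le> fst z"
proof -
  interpret M: sigma_finite_measure M by fact
  interpret U: finite_measure "time_upto T" by (rule finite_time_upto)
  interpret UM: pair_sigma_finite "time_upto T" M ..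
  show "AE z in time_upto T \<Otimes>\<^sub>M M. 0 \<le> fst z \<and> fst z \<le> T"
    by (rule UM.AE_pair_measure) (measurable, auto intro!: AE_time_upto)
  assume "r > 0"
  interpret D: finite_measure "time_disc r" by (rule finite_time_disc) fact
  interpret DM: pair_sigma_finite "time_disc r" M ..
  show "AE z in disc r M. 0 \<le> fst z"
    by (rule DM.AE_pair_measure) (measurable, auto intro!: AE_time_disc)
qed

lemma time_disc_integral:
  assumes "f \<in> borel_measurable borel"
  shows "integrable (time_disc r) f \<longleftrightarrow> set_integrable lborel {0..} (\<lambda>s. exp (- r * s) * (f s :: real))"
    and "(\<integral>s. f s \<partial>time_disc r) = (LINT s:{0..}|lborel. exp (- r * s) * f s)"
  unfolding time_disc_def set_integrable_def set_lebesgue_integral_def using assms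
  by (subst integrable_density integral_density; auto simp: mult.assoc)+

subsection \<open>Estimates for a pair of differences\<close>

text \<open>\<open>orth\<close> says that \<open>y\<close> plus the running integral of
  \<open>q\<close> is a martingale, expressed as orthogonality of its increments to square
  integrable functions of the past. This is all that remains of the Ito integral in what
  follows.\<close>

locale discounted_pair = prob_space M for M :: "'a measure" +
  fixes Fl :: "real \<Rightarrow> 'a measure" and r :: real and x y p q :: "real \<Rightarrow> 'a \<Rightarrow> real"
  assumes r_pos: "r > 0"
    and x_disc: "sq_integrable (disc r M) (case_prod x)"
    and y_disc: "sq_integrable (disc r M) (case_prod y)"
    and p_disc: "sq_integrable (disc r M) (case_prod p)"
    and q_disc: "sq_integrable (disc r M) (case_prod q)"
    and x_adapted: "0 \<le> t \<Longrightarrow> x t \<in> borel_measurable (Fl t)"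
    and p_adapted: "0 \<le> t \<Longrightarrow> p t \<in> borel_measurable (Fl t)"
    and y_adapted: "0 \<le> t \<Longrightarrow> y t \<in> borel_measurable (Fl t)"
    and x_sq: "0 \<le> t \<Longrightarrow> sq_integrable M (x t)"
    and y_sq: "0 \<le> t \<Longrightarrow> sq_integrable M (y t)"
    and x_eq: "AE \<omega> in M. \<forall>t\<ge>0. set_integrable lborel {0..t} (\<lambda>s. p s \<omega>) \<and>
      x t \<omega> = x 0 \<omega> + (LINT s:{0..t}|lborel. p s \<omega>)"
    and orth: "\<lbrakk>0 \<le> s; s \<le> t; \<phi> \<in> borel_measurable (Fl s); sq_integrable M \<phi>\<rbrakk> \<Longrightarrow>
      expectation (\<lambda>\<omega>. \<phi> \<omega> * (y t \<omega> - y s \<omega> + (LINT u:{s..t}|lborel. q u \<omega>))) = 0"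
begin

sublocale time: finite_measure "time_disc r" by (rule finite_time_disc[OF r_pos])
sublocale tp: pair_sigma_finite "time_disc r" M ..

lemma sigma_finite: "sigma_finite_measure M" ..

lemma joint_measurable [measurable]:
  "case_prod x \<in> borel_measurable (borel \<Otimes>\<^sub>M M)" "case_prod y \<in> borel_measurable (borel \<Otimes>\<^sub>M M)"
  "case_prod p \<in> borel_measurable (borel \<Otimes>\<^sub>M M)" "case_prod q \<in> borel_measurable (borel \<Otimes>\<^sub>M M)"
  using x_disc y_disc p_disc q_disc by (auto simp: sq_integrable_def cong: measurable_cong_sets)

lemma disc_prod:
  assumes "sq_integrable (disc r M) (case_prod f)" "sq_integrable (disc r M) (case_prod g)"
  shows "integrable (disc r M) (\<lambda>(s, \<omega>). f s \<omega> * g s \<omega>)"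
  using sq_integrable_mult[OF assms] by (simp add: case_prod_unfold)

lemma drift_integrable: "integrable (disc r M) (\<lambda>(s, \<omega>). p s \<omega> * y s \<omega> - x s \<omega> * (q s \<omega> + r * y s \<omega>))"
proof -
  have "integrable (disc r M) (\<lambda>z. (case z of (s, \<omega>) \<Rightarrow> p s \<omega> * y s \<omega>)
      - ((case z of (s, \<omega>) \<Rightarrow> x s \<omega> * q s \<omega>) + r * (case z of (s, \<omega>) \<Rightarrow> x s \<omega> * y s \<omega>)))"
    by (intro Bochner_Integration.integrable_diff Bochner_Integration.integrable_add
        integrable_mult_right disc_prod x_disc y_disc p_disc q_disc)
  then show ?thesis by (simp add: case_prod_unfold algebra_simps)
qed

lemma discounted_product:
  assumes T: "0 \<le> T"
  shows "exp (- r * T) * expectation (\<lambda>\<omega>. x T \<omega> * y T \<omega>) = expectation (\<lambda>\<omega>. x 0 \<omega> * y 0 \<omega>)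
    + (\<integral>s. exp (- r * s) * expectation (\<lambda>\<omega>. p s \<omega> * y s \<omega> - x s \<omega> * (q s \<omega> + r * y s \<omega>)) \<partial>time_upto T)"
proof -
  \<comment> \<open>The discount is attached to \<open>x\<close> alone: \<open>P\<close> is the
    drift of \<open>exp (- r * s) * x s\<close>, while \<open>y\<close> stays undiscounted, so that
    \<open>orth\<close> applies to it unchanged.\<close>
  define P where "P s \<omega> = exp (- r * s) * (p s \<omega> - r * x s \<omega>)" for s \<omega>
  let ?U = "time_upto T"
  interpret U: finite_measure ?U by (rule finite_time_upto)
  note up = sq_integrable_time_upto(1)[OF sigma_finite _ r_pos, of _ T]
  have sec: "(\<lambda>s. x s \<omega>) \<in> borel_measurable borel" "(\<lambda>s. p s \<omega>) \<in> borel_measurable borel"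
    "(\<lambda>s. q s \<omega>) \<in> borel_measurable borel" if "\<omega> \<in> space M" for \<omega>
    using that by measurable
  have [measurable]: "case_prod P \<in> borel_measurable (borel \<Otimes>\<^sub>M M)" unfolding P_def by measurable
  have P: "sq_integrable (?U \<Otimes>\<^sub>M M) (case_prod P)"
  proof (rule sq_integrable_bound[OF sq_integrable_diff[OF up[OF p_disc] sq_integrable_cmult[OF up[OF x_disc], of r]]])
    show "AE z in ?U \<Otimes>\<^sub>M M. \<bar>case z of (s, \<omega>) \<Rightarrow> P s \<omega>\<bar>
        \<le> \<bar>(case z of (s, \<omega>) \<Rightarrow> p s \<omega>) - r * (case z of (s, \<omega>) \<Rightarrow> x s \<omega>)\<bar>"
      using AE_time_fst(1)[OF sigma_finite]
    proof eventually_elim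
      case (elim z)
      then have "\<bar>exp (- r * fst z)\<bar> \<le> 1" using r_pos by simp
      then show ?case by (simp add: P_def case_prod_unfold abs_mult mult_left_le_one_le)
    qed
  qed measurable
  have aux: "expectation (\<lambda>\<omega>. \<phi> \<omega> * (y T \<omega> - y s \<omega> + (\<integral>u. indicator {s..} u * q u \<omega> \<partial>?U))) = 0"
    if s: "0 \<le> s" "s \<le> T" and \<phi>: "\<phi> \<in> borel_measurable (Fl s)" "sq_integrable M \<phi>" for s \<phi>
  proof -
    have "expectation (\<lambda>\<omega>. \<phi> \<omega> * (y T \<omega> - y s \<omega> + (\<integral>u. indicator {s..} u * q u \<omega> \<partial>?U)))
        = expectation (\<lambda>\<omega>. \<phi> \<omega> * (y T \<omega> - y s \<omega> + (LINT u:{s..T}|lborel. q u \<omega>)))"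
      by (intro Bochner_Integration.integral_cong refl) (simp add: integral_time_upto_after sec s)
    then show ?thesis using orth[OF s \<phi>] by simp
  qed
  have "expectation (\<lambda>\<omega>. (x 0 \<omega> + (\<integral>u. P u \<omega> \<partial>?U)) * y T \<omega>) = expectation (\<lambda>\<omega>. x 0 \<omega> * y 0 \<omega>)
    + (\<integral>s. expectation (\<lambda>\<omega>. P s \<omega> * y s \<omega>
        - (x 0 \<omega> + (\<integral>u. indicator {..s} u * P u \<omega> \<partial>?U)) * q s \<omega>) \<partial>?U)"
  proof (rule product_expectation[OF P up[OF q_disc] up[OF y_disc]])
    have "expectation (\<lambda>\<omega>. x 0 \<omega> * (y T \<omega> - y 0 \<omega> + (\<integral>u. q u \<omega> \<partial>?U)))
        = expectation (\<lambda>\<omega>. x 0 \<omega> * (y T \<omega> - y 0 \<omega> + (LINT u:{0..T}|lborel. q u \<omega>)))"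
      by (intro Bochner_Integration.integral_cong refl) (simp add: integral_time_upto sec)
    then show "expectation (\<lambda>\<omega>. x 0 \<omega> * (y T \<omega> - y 0 \<omega> + (\<integral>u. q u \<omega> \<partial>?U))) = 0"
      using orth[of 0 T "x 0"] T x_adapted[of 0] x_sq[of 0] by simp
    fix s assume s: "0 \<le> s" "s \<le> T" "sq_integrable M (P s)"
    have "P s \<in> borel_measurable (Fl s)"
      unfolding P_def using x_adapted[OF s(1)] p_adapted[OF s(1)] by measurable
    then show "expectation (\<lambda>\<omega>. P s \<omega> * (y T \<omega> - y s \<omega> + (\<integral>u. indicator {s..} u * q u \<omega> \<partial>?U))) = 0"
      by (intro aux s)
  qed (use T x_sq y_sq in auto)
  moreover have x_disc_eq: "AE \<omega> in M. exp (- r * T) * x T \<omega> = x 0 \<omega> + (\<integral>u. P u \<omega> \<partial>?U) \<and>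
      (\<forall>s. 0 \<le> s \<and> s \<le> T \<longrightarrow> exp (- r * s) * x s \<omega> = x 0 \<omega> + (\<integral>u. indicator {..s} u * P u \<omega> \<partial>?U))"
    using x_eq AE_space
  proof eventually_elim
    case (elim \<omega>)
    have i: "set_integrable lborel {0..T} (\<lambda>s. p s \<omega>)" using elim T by simp
    have e: "x s \<omega> = x 0 \<omega> + (LINT u:{0..s}|lborel. p u \<omega>)" if "0 \<le> s" "s \<le> T" for s
      using elim(1) that by blast
    show ?case
      using discounted_primitive[where x = "\<lambda>s. x s \<omega>", OF i sec(2)[OF elim(2)] T e sec(1)[OF elim(2)] r_pos]
      unfolding P_def by blast
  qed
  have "expectation (\<lambda>\<omega>. (x 0 \<omega> + (\<integral>u. P u \<omega> \<partial>?U)) * y T \<omega>)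
      = expectation (\<lambda>\<omega>. exp (- r * T) * (x T \<omega> * y T \<omega>))"
  proof (rule integral_cong_AE)
    show "AE \<omega> in M. (x 0 \<omega> + (\<integral>u. P u \<omega> \<partial>?U)) * y T \<omega> = exp (- r * T) * (x T \<omega> * y T \<omega>)"
      using x_disc_eq by eventually_elim (simp flip: mult.assoc)
  qed (use T x_sq y_sq in \<open>auto simp: sq_integrable_def\<close>)
  moreover have "(\<integral>s. expectation (\<lambda>\<omega>. P s \<omega> * y s \<omega>
        - (x 0 \<omega> + (\<integral>u. indicator {..s} u * P u \<omega> \<partial>?U)) * q s \<omega>) \<partial>?U)
    = (\<integral>s. exp (- r * s) * expectation (\<lambda>\<omega>. p s \<omega> * y s \<omega> - x s \<omega> * (q s \<omega> + r * y s \<omega>)) \<partial>?U)"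
  proof (rule integral_cong_AE)
    show "AE s in ?U. expectation (\<lambda>\<omega>. P s \<omega> * y s \<omega>
        - (x 0 \<omega> + (\<integral>u. indicator {..s} u * P u \<omega> \<partial>?U)) * q s \<omega>)
      = exp (- r * s) * expectation (\<lambda>\<omega>. p s \<omega> * y s \<omega> - x s \<omega> * (q s \<omega> + r * y s \<omega>))"
    proof (rule AE_time_upto)
      fix s assume s: "0 \<le> s" "s \<le> T"
      have [measurable]: "x 0 \<in> borel_measurable M" using x_sq[of 0] by (simp add: sq_integrable_def)
      have "expectation (\<lambda>\<omega>. P s \<omega> * y s \<omega>
          - (x 0 \<omega> + (\<integral>u. indicator {..s} u * P u \<omega> \<partial>?U)) * q s \<omega>)
        = expectation (\<lambda>\<omega>. exp (- r * s) * (p s \<omega> * y s \<omega> - x s \<omega> * (q s \<omega> + r * y s \<omega>)))"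
      proof (rule integral_cong_AE)
        show "AE \<omega> in M. P s \<omega> * y s \<omega> - (x 0 \<omega> + (\<integral>u. indicator {..s} u * P u \<omega> \<partial>?U)) * q s \<omega>
            = exp (- r * s) * (p s \<omega> * y s \<omega> - x s \<omega> * (q s \<omega> + r * y s \<omega>))"
          using x_disc_eq
        proof eventually_elim
          case (elim \<omega>)
          then have "x 0 \<omega> + (\<integral>u. indicator {..s} u * P u \<omega> \<partial>?U) = exp (- r * s) * x s \<omega>"
            using s by auto
          then show ?case by (simp add: P_def algebra_simps)
        qed
      qed (unfold indicator_ray_mult, measurable)
      then show "expectation (\<lambda>\<omega>. P s \<omega> * y s \<omega>
          - (x 0 \<omega> + (\<integral>u. indicator {..s} u * P u \<omega> \<partial>?U)) * q s \<omega>)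
        = exp (- r * s) * expectation (\<lambda>\<omega>. p s \<omega> * y s \<omega> - x s \<omega> * (q s \<omega> + r * y s \<omega>))" by simp
    qed
    have [measurable]: "x 0 \<in> borel_measurable M" using x_sq[of 0] by (simp add: sq_integrable_def)
    show "(\<lambda>s. expectation (\<lambda>\<omega>. P s \<omega> * y s \<omega>
        - (x 0 \<omega> + (\<integral>u. indicator {..s} u * P u \<omega> \<partial>?U)) * q s \<omega>)) \<in> borel_measurable ?U"
      unfolding indicator_ray_mult by measurable
  qed measurable
  ultimately show ?thesis by simp
qed

text \<open>The discounted product \<open>exp (- r * T) * E [x\<^sub>T y\<^sub>T]\<close> converges as \<open>T\<close> tends to infinity, and it is an
  integrable function of \<open>T\<close>; hence its limit is \<open>0\<close>.\<close>

lemma product_identity: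
  "expectation (\<lambda>\<omega>. x 0 \<omega> * y 0 \<omega>)
    + (\<integral>(s, \<omega>). p s \<omega> * y s \<omega> - x s \<omega> * (q s \<omega> + r * y s \<omega>) \<partial>disc r M) = 0"
proof -
  define k where "k s = expectation (\<lambda>\<omega>. p s \<omega> * y s \<omega> - x s \<omega> * (q s \<omega> + r * y s \<omega>))" for s
  have [measurable]: "k \<in> borel_measurable borel" unfolding k_def by measurable
  have "integrable (time_disc r) k" unfolding k_def by (rule tp.integrable_fst[OF drift_integrable])
  then have k: "integrable lborel (\<lambda>s. indicator {0..} s * (exp (- r * s) * k s))"
    by (simp add: time_disc_integral set_integrable_def)
  have "((\<lambda>T. \<integral>s. indicator {..T} s *\<^sub>R (indicator {0..} s * (exp (- r * s) * k s)) \<partial>lborel)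
      \<longlongrightarrow> (\<integral>s. indicator {0..} s * (exp (- r * s) * k s) \<partial>lborel)) at_top"
    by (rule tendsto_integral_at_top[OF _ k]) simp
  also have "(\<integral>s. indicator {0..} s * (exp (- r * s) * k s) \<partial>lborel) = (\<integral>s. k s \<partial>time_disc r)"
    by (simp add: time_disc_integral set_lebesgue_integral_def)
  also have "\<dots> = (\<integral>(s, \<omega>). p s \<omega> * y s \<omega> - x s \<omega> * (q s \<omega> + r * y s \<omega>) \<partial>disc r M)"
    unfolding k_def by (rule tp.integral_fst[OF drift_integrable])
  also have "(\<lambda>T. \<integral>s. indicator {..T} s *\<^sub>R (indicator {0..} s * (exp (- r * s) * k s)) \<partial>lborel)
      = (\<lambda>T. \<integral>s. exp (- r * s) * k s \<partial>time_upto T)"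
    by (subst integral_time_upto)
      (auto simp: set_lebesgue_integral_def intro!: Bochner_Integration.integral_cong split: split_indicator)
  finally have "((\<lambda>T. expectation (\<lambda>\<omega>. x 0 \<omega> * y 0 \<omega>) + (\<integral>s. exp (- r * s) * k s \<partial>time_upto T))
    \<longlongrightarrow> expectation (\<lambda>\<omega>. x 0 \<omega> * y 0 \<omega>)
      + (\<integral>(s, \<omega>). p s \<omega> * y s \<omega> - x s \<omega> * (q s \<omega> + r * y s \<omega>) \<partial>disc r M)) at_top"
    by (intro tendsto_add tendsto_const)
  then have lim: "((\<lambda>T. exp (- r * T) * expectation (\<lambda>\<omega>. x T \<omega> * y T \<omega>))
    \<longlongrightarrow> expectation (\<lambda>\<omega>. x 0 \<omega> * y 0 \<omega>)
      + (\<integral>(s, \<omega>). p s \<omega> * y s \<omega> - x s \<omega> * (q s \<omega> + r * y s \<omega>) \<partial>disc r M)) at_top"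
  proof (rule Lim_transform_eventually)
    show "eventually (\<lambda>T. expectation (\<lambda>\<omega>. x 0 \<omega> * y 0 \<omega>) + (\<integral>s. exp (- r * s) * k s \<partial>time_upto T)
        = exp (- r * T) * expectation (\<lambda>\<omega>. x T \<omega> * y T \<omega>)) at_top"
      using eventually_ge_at_top[of 0] by eventually_elim (simp only: discounted_product k_def)
  qed
  have "integrable (time_disc r) (\<lambda>s. expectation (\<lambda>\<omega>. x s \<omega> * y s \<omega>))"
    by (rule tp.integrable_fst[OF disc_prod[OF x_disc y_disc]])
  then have "set_integrable lborel {0..} (\<lambda>T. exp (- r * T) * expectation (\<lambda>\<omega>. x T \<omega> * y T \<omega>))"
    by (subst (asm) time_disc_integral) auto
  from integrable_tendsto_zero[OF this lim] show ?thesis .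
qed

definition "S = (\<integral>(s, \<omega>). (x s \<omega>)\<^sup>2 \<partial>disc r M) + (\<integral>(s, \<omega>). (y s \<omega>)\<^sup>2 \<partial>disc r M)"

lemma sq_disc: "sq_integrable (disc r M) (case_prod f) \<Longrightarrow> integrable (disc r M) (\<lambda>(s, \<omega>). (f s \<omega>)\<^sup>2)" for f
  by (simp add: sq_integrable_def case_prod_unfold)

text \<open>By the product identity the drift integral is minus the mean of
  \<open>x 0 * y 0\<close>; the pointwise bound is integrated into it. The weight \<open>v\<close>
  may depend on \<open>\<omega>\<close>, so that it can carry the indicator of an event.\<close>

lemma monotone_estimate:
  assumes v: "integrable (disc r M) (case_prod v)"
    and le: "\<And>s \<omega>. 0 \<le> s \<Longrightarrow> \<omega> \<in> space M \<Longrightarrow> p s \<omega> * y s \<omega> - x s \<omega> * (q s \<omega> + r * y s \<omega>)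
      \<le> - \<kappa> * ((x s \<omega>)\<^sup>2 + (y s \<omega>)\<^sup>2) + c * v s \<omega>"
  shows "\<kappa> * S \<le> expectation (\<lambda>\<omega>. x 0 \<omega> * y 0 \<omega>) + c * (\<integral>(s, \<omega>). v s \<omega> \<partial>disc r M)"
proof -
  note ints = sq_disc[OF x_disc] sq_disc[OF y_disc] v
  have "(\<integral>(s, \<omega>). p s \<omega> * y s \<omega> - x s \<omega> * (q s \<omega> + r * y s \<omega>) \<partial>disc r M)
    \<le> (\<integral>z. - \<kappa> * ((case z of (s, \<omega>) \<Rightarrow> (x s \<omega>)\<^sup>2) + (case z of (s, \<omega>) \<Rightarrow> (y s \<omega>)\<^sup>2))
        + c * (case z of (s, \<omega>) \<Rightarrow> v s \<omega>) \<partial>disc r M)"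
  proof (rule integral_mono_AE[OF drift_integrable])
    show "integrable (disc r M) (\<lambda>z. - \<kappa> * ((case z of (s, \<omega>) \<Rightarrow> (x s \<omega>)\<^sup>2) + (case z of (s, \<omega>) \<Rightarrow> (y s \<omega>)\<^sup>2))
        + c * (case z of (s, \<omega>) \<Rightarrow> v s \<omega>))"
      using ints by (intro Bochner_Integration.integrable_add integrable_mult_right)
    show "AE z in disc r M. (case z of (s, \<omega>) \<Rightarrow> p s \<omega> * y s \<omega> - x s \<omega> * (q s \<omega> + r * y s \<omega>))
      \<le> - \<kappa> * ((case z of (s, \<omega>) \<Rightarrow> (x s \<omega>)\<^sup>2) + (case z of (s, \<omega>) \<Rightarrow> (y s \<omega>)\<^sup>2))
        + c * (case z of (s, \<omega>) \<Rightarrow> v s \<omega>)"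
      using AE_time_fst(2)[OF sigma_finite r_pos] AE_space
    proof eventually_elim
      case (elim z)
      then show ?case using le[of "fst z" "snd z"]
        by (auto simp: space_pair_measure case_prod_unfold mem_Times_iff)
    qed
  qed
  also have "\<dots> = - \<kappa> * S + c * (\<integral>(s, \<omega>). v s \<omega> \<partial>disc r M)"
    using ints by (simp add: S_def del: mult_minus_left)
  finally show ?thesis using product_identity by simp
qed

text \<open>The discounted norm does not control the second moment of \<open>y T\<close> at a fixed
  \<open>T\<close>, so the bound in terms of \<open>y T\<close> is averaged over \<open>T\<close> in
  \<open>[0, 1]\<close>. Undoing the discount up to time 1 costs \<open>exp r\<close>; the factor 2
  comes from squaring a sum.\<close>

lemma initial_estimate:
  "expectation (\<lambda>\<omega>. (y 0 \<omega>)\<^sup>2) \<le> 2 * exp r * ((\<integral>(s, \<omega>). (y s \<omega>)\<^sup>2 \<partial>disc r M) + (\<integral>(s, \<omega>). (q s \<omega>)\<^sup>2 \<partial>disc r M))"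
proof -
  let ?U = "time_upto 1"
  interpret U: finite_measure ?U by (rule finite_time_upto)
  interpret UM: pair_sigma_finite ?U M ..
  have m1: "measure ?U (space ?U) = 1" by (simp add: measure_time_upto)
  define Q where "Q \<omega> = (\<integral>u. \<bar>q u \<omega>\<bar> \<partial>?U)" for \<omega>
  note upq = sq_integrable_time_upto[OF sigma_finite q_disc r_pos, of 1]
  note upy = sq_integrable_time_upto[OF sigma_finite y_disc r_pos, of 1]
  note sec = sq_integrable_section_integral[OF finite_time_upto sigma_finite upq(1)]
  have Q: "sq_integrable M Q" unfolding Q_def by (rule sec(1))
  have Q2: "expectation (\<lambda>\<omega>. (Q \<omega>)\<^sup>2) \<le> exp r * (\<integral>(s, \<omega>). (q s \<omega>)\<^sup>2 \<partial>disc r M)"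
    using sec(2) upq(2) unfolding Q_def m1 by simp
  have step: "expectation (\<lambda>\<omega>. (y 0 \<omega>)\<^sup>2) \<le> 2 * expectation (\<lambda>\<omega>. (y T \<omega>)\<^sup>2) + 2 * expectation (\<lambda>\<omega>. (Q \<omega>)\<^sup>2)"
    if T: "0 \<le> T" "T \<le> 1" for T
  proof -
    define R where "R \<omega> = (LINT u:{0..T}|lborel. q u \<omega>)" for \<omega>
    have R: "R \<omega> = (\<integral>u. indicator {..T} u * q u \<omega> \<partial>?U)" if "\<omega> \<in> space M" for \<omega>
      unfolding R_def by (subst integral_time_upto_before) (use T that in auto)
    have Rm: "R \<in> borel_measurable M"
      by (subst measurable_cong[OF R]) (auto simp: indicator_ray_mult)
    have RQ: "AE \<omega> in M. \<bar>R \<omega>\<bar> \<le> \<bar>Q \<omega>\<bar>"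
      using sec(3) AE_space
    proof eventually_elim
      case (elim \<omega>)
      have "\<bar>R \<omega>\<bar> \<le> (\<integral>u. norm (indicator {..T} u * q u \<omega>) \<partial>?U)"
        unfolding R[OF elim(2)] real_norm_def[symmetric] by (rule integral_norm_bound)
      also have "\<dots> \<le> Q \<omega>"
        unfolding Q_def using U.sq_integrable_imp_integrable[OF elim(1)]
        by (intro integral_mono') (auto split: split_indicator)
      finally show ?case by simp
    qed
    have Rsq: "sq_integrable M R" by (rule sq_integrable_bound[OF Q Rm RQ])
    note sqs = y_sq[OF T(1)] y_sq[OF order_refl] Rsq
    have prods: "integrable M (\<lambda>\<omega>. y 0 \<omega> * y T \<omega>)" "integrable M (\<lambda>\<omega>. y 0 \<omega> * y 0 \<omega>)"
      "integrable M (\<lambda>\<omega>. y 0 \<omega> * R \<omega>)" "integrable M (\<lambda>\<omega>. (y 0 \<omega>)\<^sup>2)"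
      "integrable M (\<lambda>\<omega>. (y T \<omega>)\<^sup>2)" "integrable M (\<lambda>\<omega>. (Q \<omega>)\<^sup>2)"
      using sqs Q by (auto intro!: sq_integrable_mult simp: sq_integrable_integrable_sq)
    \<comment> \<open>The martingale property is tested with \<open>y 0\<close> itself. After
      Young's inequality, one of the two copies of its second moment is absorbed.\<close>
    have "expectation (\<lambda>\<omega>. y 0 \<omega> * (y T \<omega> - y 0 \<omega> + R \<omega>)) = 0"
      unfolding R_def using T by (intro orth y_adapted y_sq) auto
    then have "2 * expectation (\<lambda>\<omega>. (y 0 \<omega>)\<^sup>2) = expectation (\<lambda>\<omega>. 2 * (y 0 \<omega> * y T \<omega>) + 2 * (y 0 \<omega> * R \<omega>))"
      using prods by (simp add: distrib_left right_diff_distrib power2_eq_square)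
    also have "\<dots> \<le> expectation (\<lambda>\<omega>. (y 0 \<omega>)\<^sup>2 + 2 * (y T \<omega>)\<^sup>2 + 2 * (Q \<omega>)\<^sup>2)"
    proof (rule integral_mono_AE)
      show "AE \<omega> in M. 2 * (y 0 \<omega> * y T \<omega>) + 2 * (y 0 \<omega> * R \<omega>) \<le> (y 0 \<omega>)\<^sup>2 + 2 * (y T \<omega>)\<^sup>2 + 2 * (Q \<omega>)\<^sup>2"
        using RQ
      proof eventually_elim
        case (elim \<omega>)
        then have "(R \<omega>)\<^sup>2 \<le> (Q \<omega>)\<^sup>2" by (simp add: abs_le_square_iff)
        moreover have "2 * (y 0 \<omega> * (y T \<omega> + R \<omega>)) \<le> (y 0 \<omega>)\<^sup>2 + (y T \<omega> + R \<omega>)\<^sup>2"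
          using sum_squares_bound[of "y 0 \<omega>" "y T \<omega> + R \<omega>"] by simp
        ultimately show ?case using sum_sq_le[of "y T \<omega>" "R \<omega>"] by (simp add: distrib_left)
      qed
    qed (use prods in auto)
    also have "\<dots> = expectation (\<lambda>\<omega>. (y 0 \<omega>)\<^sup>2) + 2 * expectation (\<lambda>\<omega>. (y T \<omega>)\<^sup>2) + 2 * expectation (\<lambda>\<omega>. (Q \<omega>)\<^sup>2)"
      using prods by simp
    finally show ?thesis by simp
  qed
  have yi: "integrable (?U \<Otimes>\<^sub>M M) (\<lambda>(s, \<omega>). (y s \<omega>)\<^sup>2)"
    using upy(1) by (simp add: sq_integrable_def case_prod_unfold)
  note yi' = UM.integrable_fst[OF yi]
  \<comment> \<open>\<open>time_upto 1\<close> is a probability measure, so averaging over it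
    preserves the left side.\<close>
  have "expectation (\<lambda>\<omega>. (y 0 \<omega>)\<^sup>2) = (\<integral>T. expectation (\<lambda>\<omega>. (y 0 \<omega>)\<^sup>2) \<partial>?U)" using m1 by simp
  also have "\<dots> \<le> (\<integral>T. 2 * expectation (\<lambda>\<omega>. (y T \<omega>)\<^sup>2) + 2 * expectation (\<lambda>\<omega>. (Q \<omega>)\<^sup>2) \<partial>?U)"
    by (rule integral_mono_AE) (use yi' step in \<open>auto intro!: AE_time_upto\<close>)
  also have "\<dots> = 2 * (\<integral>T. expectation (\<lambda>\<omega>. (y T \<omega>)\<^sup>2) \<partial>?U) + 2 * expectation (\<lambda>\<omega>. (Q \<omega>)\<^sup>2)"
    using yi' m1 by simp
  also have "(\<integral>T. expectation (\<lambda>\<omega>. (y T \<omega>)\<^sup>2) \<partial>?U) = (\<integral>(s, \<omega>). (y s \<omega>)\<^sup>2 \<partial>(?U \<Otimes>\<^sub>M M))"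
    by (rule UM.integral_fst[OF yi])
  also have "2 * \<dots> + 2 * expectation (\<lambda>\<omega>. (Q \<omega>)\<^sup>2)
      \<le> 2 * (exp r * (\<integral>(s, \<omega>). (y s \<omega>)\<^sup>2 \<partial>disc r M)) + 2 * (exp r * (\<integral>(s, \<omega>). (q s \<omega>)\<^sup>2 \<partial>disc r M))"
    using upy(2) Q2 by simp
  finally show ?thesis by (simp add: algebra_simps)
qed

end

text \<open>In the applications \<open>S\<close> is the sum of the squared norms, \<open>V\<close>
  the Wasserstein contribution, \<open>e\<close> the mean of the product at time 0, and
  \<open>X\<close> and \<open>Y\<close> are the second moments of the forward and backward
  differences at time 0. Young's inequality puts a small weight on \<open>Y\<close>, so that the
  share of \<open>S\<close> which it brings back fits under \<open>a * S\<close>.\<close>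

lemma absorb:
  fixes a b c S V X Y e :: real
  assumes pos: "a > 0" "b \<ge> 0" "c > 0" "0 \<le> V" "0 \<le> X"
    and 1: "a * S \<le> e + b * V" and 2: "Y \<le> c * (S + V)" and 3: "\<And>\<epsilon>. \<epsilon> > 0 \<Longrightarrow> 2 * e \<le> X / \<epsilon> + \<epsilon> * Y"
  shows "S + Y \<le> ((1 + c) * (4 / (3 * a) * (c / a + b + a / 4)) + c) * (X + V)"
proof -
  \<comment> \<open>The choice \<open>\<epsilon> = a / (2 * c)\<close> makes the part of
    \<open>e\<close> that returns to \<open>S\<close> equal to \<open>a / 4 * S\<close>; three
    quarters of \<open>a * S\<close> remain on the left.\<close>
  have "2 * e \<le> X / (a / (2 * c)) + (a / (2 * c)) * Y" using pos by (intro 3) auto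
  also have "X / (a / (2 * c)) = 2 * (c / a * X)" by simp
  also have "(a / (2 * c)) * Y \<le> (a / (2 * c)) * (c * (S + V))"
    using pos by (intro mult_left_mono 2) auto
  also have "\<dots> = a / 2 * (S + V)" using pos by simp
  finally have e: "e \<le> c / a * X + a / 4 * (S + V)" by simp
  have "3 * a / 4 * S = a * S - a / 4 * S" by simp
  also have "\<dots> \<le> (c / a * X + a / 4 * (S + V) + b * V) - a / 4 * S" using 1 e by linarith
  also have "\<dots> = c / a * X + (b + a / 4) * V" by (simp add: distrib_left distrib_right)
  finally have "3 * a / 4 * S \<le> c / a * X + (b + a / 4) * V" .
  also have "\<dots> \<le> (c / a + b + a / 4) * X + (c / a + b + a / 4) * V"
    using pos by (intro add_mono mult_right_mono) auto
  finally have "4 / (3 * a) * (3 * a / 4 * S) \<le> 4 / (3 * a) * ((c / a + b + a / 4) * (X + V))"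
    using pos by (intro mult_left_mono) (auto simp: distrib_left)
  moreover have "4 / (3 * a) * (3 * a / 4 * S) = S" using pos by simp
  ultimately have S: "S \<le> 4 / (3 * a) * (c / a + b + a / 4) * (X + V)" by (simp only: mult.assoc)
  have "S + Y \<le> (1 + c) * S + c * V" using 2 by (simp add: algebra_simps)
  also have "\<dots> \<le> (1 + c) * (4 / (3 * a) * (c / a + b + a / 4) * (X + V)) + c * (X + V)"
    using S pos by (intro add_mono mult_left_mono) auto
  finally show ?thesis by (simp add: algebra_simps)
qed

subsection \<open>Regularity of the flow of laws\<close>

lemma sq_integrable_fst:
  assumes "prob_space M" "sigma_finite_measure U" "sq_integrable U w"
  shows "sq_integrable (U \<Otimes>\<^sub>M M) (\<lambda>(s, \<omega>). w s)"
proof -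
  interpret prob_space M by fact
  note [measurable] = sq_integrable_measurable[OF assms(3)]
  have "(\<integral>\<^sup>+z. ennreal ((case z of (s, \<omega>) \<Rightarrow> w s)\<^sup>2) \<partial>(U \<Otimes>\<^sub>M M)) = (\<integral>\<^sup>+s. ennreal ((w s)\<^sup>2) \<partial>U)"
    by (subst nn_integral_fst[symmetric]) (auto simp: emeasure_space_1)
  also have "\<dots> < \<infinity>" using assms(3) by (subst (asm) sq_integrable_iff_nn) auto
  finally show ?thesis by (subst sq_integrable_iff_nn) (auto simp: case_prod_unfold)
qed

lemma set_integral_diff_Icc:
  fixes f :: "real \<Rightarrow> real"
  assumes "set_integrable lborel {0..t} f" "0 \<le> s" "s \<le> t"
  shows "(LINT u:{0..t}|lborel. f u) - (LINT u:{0..s}|lborel. f u) = (LINT u:{s..t}|lborel. f u)"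
proof -
  have i: "set_integrable lborel {0..s} f" "set_integrable lborel {s..t} f"
    using assms by (auto intro: set_integrable_subset[OF assms(1)])
  have "(LINT u:{0..t}|lborel. f u) - (LINT u:{0..s}|lborel. f u)
      = (\<integral>u. indicator {0..t} u *\<^sub>R f u - indicator {0..s} u *\<^sub>R f u \<partial>lborel)"
    using assms(1) i by (simp add: set_integrable_def set_lebesgue_integral_def)
  also have "\<dots> = (\<integral>u. indicator {s..t} u *\<^sub>R f u \<partial>lborel)"
  proof (rule integral_cong_AE)
    show "AE u in lborel. indicator {0..t} u *\<^sub>R f u - indicator {0..s} u *\<^sub>R f u = indicator {s..t} u *\<^sub>R f u"
      using AE_lborel_singleton[of s]
      by eventually_elim (use assms in \<open>auto split: split_indicator\<close>)
  qed (use assms(1) i in \<open>auto simp: set_integrable_def dest: borel_measurable_integrable\<close>)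
  finally show ?thesis by (simp add: set_lebesgue_integral_def)
qed

text \<open>Throughout, a process \<open>v\<close> is replaced by \<open>v (max 0 s)\<close>, which is jointly measurable on the whole
  real line; its values at negative times are irrelevant.\<close>

lemma borel_measurable_extend:
  fixes v :: "real \<Rightarrow> 'a \<Rightarrow> real"
  assumes "(\<lambda>(t, \<omega>). v t \<omega>) \<in> borel_measurable (restrict_space borel {0..} \<Otimes>\<^sub>M M)"
  shows "(\<lambda>(s, \<omega>). v (max 0 s) \<omega>) \<in> borel_measurable (borel \<Otimes>\<^sub>M M)"
proof -
  have "(\<lambda>z. (max 0 (fst z) :: real, snd z)) \<in> measurable ((borel :: real measure) \<Otimes>\<^sub>M M) (restrict_space borel {0..} \<Otimes>\<^sub>M M)"
    by (rule measurable_Pair) (auto intro!: measurable_restrict_space2)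
  from measurable_compose[OF this assms] show ?thesis by (simp add: case_prod_unfold)
qed

text \<open>Tonelli turns the integral over time, path by path, into one integral over the product,
  with the discount moved into the time measure.\<close>

lemma sqnorm_r_extend:
  assumes M: "sigma_finite_measure M" and r: "r > 0"
    and v[measurable]: "(\<lambda>(s, \<omega>). v (max 0 s) \<omega>) \<in> borel_measurable (borel \<Otimes>\<^sub>M M)"
  shows "sqnorm_r M r v = (\<integral>\<^sup>+(s, \<omega>). ennreal ((v (max 0 s) \<omega>)\<^sup>2) \<partial>disc r M)"
proof -
  interpret M: sigma_finite_measure M by fact
  interpret U: finite_measure "time_disc r" by (rule finite_time_disc[OF r])
  interpret UM: pair_sigma_finite "time_disc r" M ..
  have "sqnorm_r M r v = (\<integral>\<^sup>+\<omega>. \<integral>\<^sup>+s. ennreal ((v (max 0 s) \<omega>)\<^sup>2) \<partial>time_disc r \<partial>M)"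
    unfolding sqnorm_r_def
  proof (rule nn_integral_cong)
    fix \<omega> assume "\<omega> \<in> space M"
    then have [measurable]: "(\<lambda>s. v (max 0 s) \<omega>) \<in> borel_measurable borel" by measurable
    show "(\<integral>\<^sup>+t\<in>{0..}. ennreal (exp (- r * t) * (v t \<omega>)\<^sup>2) \<partial>lborel)
        = (\<integral>\<^sup>+s. ennreal ((v (max 0 s) \<omega>)\<^sup>2) \<partial>time_disc r)"
      unfolding time_disc_def
      by (subst nn_integral_density) (auto intro!: nn_integral_cong simp: ennreal_mult split: split_indicator)
  qed
  also have "\<dots> = (\<integral>\<^sup>+(s, \<omega>). ennreal ((v (max 0 s) \<omega>)\<^sup>2) \<partial>disc r M)"
    by (subst UM.nn_integral_snd[symmetric]) auto
  finally show ?thesis .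
qed

lemma sqnorm_r_eq_integral:
  assumes "sigma_finite_measure M" "r > 0"
    and "sq_integrable (disc r M) (\<lambda>(s, \<omega>). v (max 0 s) \<omega>)"
  shows "sqnorm_r M r v = ennreal (\<integral>(s, \<omega>). (v (max 0 s) \<omega>)\<^sup>2 \<partial>disc r M)"
proof -
  have "(\<lambda>(s, \<omega>). v (max 0 s) \<omega>) \<in> borel_measurable (borel \<Otimes>\<^sub>M M)"
    using assms(3) by (simp add: sq_integrable_def cong: measurable_cong_sets)
  then have "sqnorm_r M r v = (\<integral>\<^sup>+(s, \<omega>). ennreal ((v (max 0 s) \<omega>)\<^sup>2) \<partial>disc r M)"
    by (rule sqnorm_r_extend[OF assms(1,2)])
  also have "\<dots> = ennreal (\<integral>(s, \<omega>). (v (max 0 s) \<omega>)\<^sup>2 \<partial>disc r M)"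
    using assms(3) by (simp add: case_prod_unfold sq_integrable_def nn_integral_eq_integral)
  finally show ?thesis .
qed

lemma Lr2_sq_integrable:
  assumes "sigma_finite_measure M" "r > 0" "v \<in> Lr2 M Fl r"
  shows "sq_integrable (disc r M) (\<lambda>(s, \<omega>). v (max 0 s) \<omega>)"
proof -
  have m: "(\<lambda>(s, \<omega>). v (max 0 s) \<omega>) \<in> borel_measurable (borel \<Otimes>\<^sub>M M)"
    using assms(3) by (intro borel_measurable_extend) (simp add: Lr2_def)
  have "(\<integral>\<^sup>+(s, \<omega>). ennreal ((v (max 0 s) \<omega>)\<^sup>2) \<partial>disc r M) < \<infinity>"
    using assms(3) unfolding sqnorm_r_extend[OF assms(1,2) m, symmetric] by (simp add: Lr2_def)
  moreover have "(\<lambda>(s, \<omega>). v (max 0 s) \<omega>) \<in> borel_measurable (disc r M)"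
    using m by (simp cong: measurable_cong_sets)
  ultimately show ?thesis by (subst sq_integrable_iff_nn) (auto simp: case_prod_unfold)
qed

lemma (in prob_space) distr_in_P2:
  assumes "sq_integrable M X"
  shows "distr M borel X \<in> P2"
proof -
  note [measurable] = sq_integrable_measurable[OF assms]
  show ?thesis unfolding P2_def
    using sq_integrable_integrable_sq[OF assms]
    by (auto intro!: prob_space_distr simp: integrable_distr_eq)
qed

text \<open>The joint law of \<open>X\<close> and \<open>Y\<close> is a coupling and bounds the
  infimum from above. Since it shows that the set of couplings is nonempty, the infimum of
  nonnegative costs is itself nonnegative.\<close>

lemma (in prob_space) W2_distr_le:
  assumes "sq_integrable M X" "sq_integrable M Y"
  shows "0 \<le> W2 (distr M borel X) (distr M borel Y)"
    and "(W2 (distr M borel X) (distr M borel Y))\<^sup>2 \<le> expectation (\<lambda>\<omega>. (X \<omega> - Y \<omega>)\<^sup>2)"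
proof -
  note [measurable] = assms[THEN sq_integrable_measurable]
  define \<mu> \<nu> where "\<mu> = distr M borel X" and "\<nu> = distr M borel Y"
  define \<pi> where "\<pi> = distr M (borel \<Otimes>\<^sub>M borel) (\<lambda>\<omega>. (X \<omega>, Y \<omega>))"
  define f where "f \<pi> = (\<integral>p. (fst p - snd p)\<^sup>2 \<partial>\<pi>)" for \<pi> :: "(real \<times> real) measure"
  have \<pi>: "\<pi> \<in> couplings \<mu> \<nu>"
    unfolding couplings_def \<pi>_def \<mu>_def \<nu>_def by (auto simp: distr_distr comp_def)
  have "f \<pi> = expectation (\<lambda>\<omega>. (X \<omega> - Y \<omega>)\<^sup>2)"
    unfolding f_def \<pi>_def by (subst integral_distr) auto
  moreover have "0 \<le> f \<rho>" for \<rho> unfolding f_def by simp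
  then have "bdd_below (f ` couplings \<mu> \<nu>)" by (auto intro: bdd_belowI[of _ 0])
  then have "(INF \<pi>\<in>couplings \<mu> \<nu>. f \<pi>) \<le> f \<pi>" using \<pi> by (intro cINF_lower)
  moreover have "0 \<le> (INF \<pi>\<in>couplings \<mu> \<nu>. f \<pi>)"
    using \<pi> \<open>\<And>\<rho>. 0 \<le> f \<rho>\<close> by (intro cINF_greatest) auto
  ultimately have "0 \<le> W2 \<mu> \<nu>" "(W2 \<mu> \<nu>)\<^sup>2 \<le> expectation (\<lambda>\<omega>. (X \<omega> - Y \<omega>)\<^sup>2)"
    unfolding W2_def f_def by auto
  then show "0 \<le> W2 (distr M borel X) (distr M borel Y)"
    "(W2 (distr M borel X) (distr M borel Y))\<^sup>2 \<le> expectation (\<lambda>\<omega>. (X \<omega> - Y \<omega>)\<^sup>2)"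
    by (auto simp: \<mu>_def \<nu>_def)
qed

definition lipschitz_P2 :: "real \<Rightarrow> (real \<Rightarrow> real measure \<Rightarrow> real \<Rightarrow> real) \<Rightarrow> bool" where
  "lipschitz_P2 L h \<longleftrightarrow> (\<forall>x y x' y'. \<forall>\<mu>\<in>P2. \<forall>\<mu>'\<in>P2.
     \<bar>h x \<mu> y - h x' \<mu>' y'\<bar> \<le> L * (\<bar>x - x'\<bar> + \<bar>y - y'\<bar> + W2 \<mu> \<mu>'))"

text \<open>The second condition is Hoelder continuity of order one half on bounded intervals, the
  mean-square regularity of Brownian paths. The third gives the drifts linear growth within the
  discounted space; the function \<open>w\<close> stands in for the distance, whose measurability in
  time is thereby kept out of the definition.\<close>

definition regular_flow :: "real \<Rightarrow> (real \<Rightarrow> real measure) \<Rightarrow> bool" where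
  "regular_flow r m \<longleftrightarrow> (\<forall>t\<ge>0. m t \<in> P2) \<and>
     (\<forall>T\<ge>0. \<exists>C. \<forall>s\<in>{0..T}. \<forall>t\<in>{0..T}. W2 (m s) (m t) \<le> sqrt (C * \<bar>s - t\<bar>)) \<and>
     (\<exists>w. sq_integrable (time_disc r) w \<and> (\<forall>s\<ge>0. 0 \<le> W2 (m s) (m 0) \<and> W2 (m s) (m 0) \<le> w s))"

text \<open>Continuity of the flow in the Wasserstein distance is what makes the drifts jointly measurable.\<close>

lemma regular_flow_continuous:
  assumes m: "regular_flow r m" and h: "lipschitz_P2 L h" and L: "L \<ge> 0"
  shows "continuous_on UNIV (\<lambda>(s, x, y). h x (m (max 0 s)) y)"
proof -
  define g where "g z = h (fst (snd z)) (m (max 0 (fst z))) (snd (snd z))" for z :: "real \<times> real \<times> real"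
  have "isCont g z0" for z0
  proof -
    obtain s x y where z0: "z0 = (s, x, y)" by (cases z0) auto
    \<comment> \<open>The extra 1 places nearby nonnegative times inside \<open>[0, T]\<close>,
      where a single constant \<open>C\<close> serves.\<close>
    define T where "T = max 0 s + 1"
    have "0 \<le> T" by (simp add: T_def)
    with m obtain C where "\<forall>s\<in>{0..T}. \<forall>t\<in>{0..T}. W2 (m s) (m t) \<le> sqrt (C * \<bar>s - t\<bar>)"
      unfolding regular_flow_def by blast
    then have C: "W2 (m s) (m t) \<le> sqrt (C * \<bar>s - t\<bar>)" if "s \<in> {0..T}" "t \<in> {0..T}" for s t
      using that by blast
    define b where "b z = L * (\<bar>fst (snd z) - x\<bar> + \<bar>snd (snd z) - y\<bar> + sqrt (C * \<bar>max 0 (fst z) - max 0 s\<bar>))"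
      for z :: "real \<times> real \<times> real"
    have "isCont b z0" unfolding b_def by (intro continuous_intros)
    then have "(b \<longlongrightarrow> 0) (at z0)" unfolding isCont_def by (simp add: b_def z0)
    moreover have "eventually (\<lambda>z. \<bar>g z - g z0\<bar> \<le> b z) (at z0)"
    proof -
      have "((\<lambda>z. max 0 (fst z)) \<longlongrightarrow> max 0 (fst z0)) (at z0)" by (intro tendsto_intros)
      then have "eventually (\<lambda>z. max 0 (fst z) < T) (at z0)"
        by (rule order_tendstoD) (simp add: T_def z0)
      then show ?thesis
      proof eventually_elim
        case (elim z)
        have "m (max 0 (fst z)) \<in> P2" "m (max 0 s) \<in> P2" using m by (auto simp: regular_flow_def)
        then have "\<bar>g z - g z0\<bar> \<le> L * (\<bar>fst (snd z) - x\<bar> + \<bar>snd (snd z) - y\<bar> + W2 (m (max 0 (fst z))) (m (max 0 s)))"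
          using h by (simp add: lipschitz_P2_def g_def z0)
        also have "\<dots> \<le> b z"
          unfolding b_def using elim by (intro mult_left_mono add_left_mono C L) (auto simp: T_def)
        finally show ?case .
      qed
    qed
    ultimately have "((\<lambda>z. g z - g z0) \<longlongrightarrow> 0) (at z0)"
      using Lim_null_comparison[of "\<lambda>z. g z - g z0" b "at z0"] by simp
    then show ?thesis unfolding isCont_def by (rule LIM_zero_cancel)
  qed
  then have "continuous_on UNIV g" by (simp add: continuous_on_eq_continuous_within)
  then show ?thesis by (simp add: g_def[abs_def] case_prod_unfold)
qed

lemma lipschitz_P2_growth:
  assumes "lipschitz_P2 L h" "L \<ge> 0" "\<mu> \<in> P2" "\<nu> \<in> P2" "W2 \<mu> \<nu> \<le> w"
  shows "\<bar>h x \<mu> y\<bar> \<le> \<bar>h 0 \<nu> 0\<bar> + L * (\<bar>x\<bar> + \<bar>y\<bar> + w)"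
proof -
  have "\<bar>h x \<mu> y - h 0 \<nu> 0\<bar> \<le> L * (\<bar>x - 0\<bar> + \<bar>y - 0\<bar> + W2 \<mu> \<nu>)"
    using assms unfolding lipschitz_P2_def by blast
  also have "\<dots> \<le> L * (\<bar>x\<bar> + \<bar>y\<bar> + w)" using assms by (intro mult_left_mono) auto
  finally show ?thesis by linarith
qed

text \<open>Continuity in \<open>(s, x, y)\<close> gives joint measurability, and comparison with
  the point \<open>(0, m 0, 0)\<close> gives linear growth. The second claim admits any
  sigma-algebra \<open>N\<close>, which yields adaptedness for \<open>N = F t\<close>.\<close>

lemma regular_flow_composition:
  assumes M: "prob_space M" and r: "r > 0" and m: "regular_flow r m" and h: "lipschitz_P2 L h" and L: "L \<ge> 0"
    and X: "sq_integrable (disc r M) (case_prod X)"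
    and Y: "sq_integrable (disc r M) (case_prod Y)"
  shows "sq_integrable (disc r M) (\<lambda>(s, \<omega>). h (X s \<omega>) (m (max 0 s)) (Y s \<omega>))"
    and "0 \<le> t \<Longrightarrow> X t \<in> borel_measurable N \<Longrightarrow> Y t \<in> borel_measurable N
      \<Longrightarrow> (\<lambda>\<omega>. h (X t \<omega>) (m (max 0 t)) (Y t \<omega>)) \<in> borel_measurable N"
proof -
  interpret prob_space M by fact
  interpret U: finite_measure "time_disc r" by (rule finite_time_disc[OF r])
  interpret UM: pair_sigma_finite "time_disc r" M ..
  interpret UM: finite_measure "disc r M" by (rule finite_measure_pair_measure) unfold_locales
  have g: "(\<lambda>(s, x, y). h x (m (max 0 s)) y) \<in> borel_measurable (borel \<Otimes>\<^sub>M (borel \<Otimes>\<^sub>M borel))"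
    using borel_measurable_continuous_onI[OF regular_flow_continuous[OF m h L]]
    by (simp add: borel_prod)
  note [measurable] = X[THEN sq_integrable_measurable] Y[THEN sq_integrable_measurable]
  have "(\<lambda>z. (fst z, case_prod X z, case_prod Y z)) \<in> measurable (disc r M) (borel \<Otimes>\<^sub>M (borel \<Otimes>\<^sub>M borel))"
    by measurable
  from measurable_compose[OF this g]
  have meas: "(\<lambda>(s, \<omega>). h (X s \<omega>) (m (max 0 s)) (Y s \<omega>)) \<in> borel_measurable (disc r M)"
    by (simp add: case_prod_unfold)
  obtain w where w: "sq_integrable (time_disc r) w" "\<And>s. 0 \<le> s \<Longrightarrow> W2 (m s) (m 0) \<le> w s"
    and m_P2: "\<And>s. 0 \<le> s \<Longrightarrow> m s \<in> P2"
    using m by (auto simp: regular_flow_def)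
  have bnd: "sq_integrable (disc r M) (\<lambda>z. \<bar>h 0 (m 0) 0\<bar>
      + L * (\<bar>case z of (s, \<omega>) \<Rightarrow> X s \<omega>\<bar> + \<bar>case z of (s, \<omega>) \<Rightarrow> Y s \<omega>\<bar> + (case z of (s, \<omega>) \<Rightarrow> w s)))"
    by (intro sq_integrable_add sq_integrable_cmult sq_integrable_abs UM.sq_integrable_const X Y
        sq_integrable_fst[OF M] w U.sigma_finite_measure_axioms)
  show "sq_integrable (disc r M) (\<lambda>(s, \<omega>). h (X s \<omega>) (m (max 0 s)) (Y s \<omega>))"
  proof (rule sq_integrable_bound[OF bnd meas])
    show "AE z in disc r M. \<bar>case z of (s, \<omega>) \<Rightarrow> h (X s \<omega>) (m (max 0 s)) (Y s \<omega>)\<bar>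
      \<le> \<bar>\<bar>h 0 (m 0) 0\<bar> + L * (\<bar>case z of (s, \<omega>) \<Rightarrow> X s \<omega>\<bar> + \<bar>case z of (s, \<omega>) \<Rightarrow> Y s \<omega>\<bar>
          + (case z of (s, \<omega>) \<Rightarrow> w s))\<bar>"
      using AE_time_fst(2)[OF sigma_finite_measure_axioms r]
    proof eventually_elim
      case (elim z)
      from lipschitz_P2_growth[OF h L m_P2[OF elim] m_P2[OF order_refl] w(2)[OF elim]] elim show ?case
        by (simp add: case_prod_unfold) (meson abs_ge_self order_trans)
    qed
  qed
  assume t: "0 \<le> t" and [measurable]: "X t \<in> borel_measurable N" "Y t \<in> borel_measurable N"
  have "(\<lambda>\<omega>. (t, X t \<omega>, Y t \<omega>)) \<in> measurable N (borel \<Otimes>\<^sub>M (borel \<Otimes>\<^sub>M borel))" by measurable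
  from measurable_compose[OF this g]
  show "(\<lambda>\<omega>. h (X t \<omega>) (m (max 0 t)) (Y t \<omega>)) \<in> borel_measurable N" by simp
qed

section \<open>Mean-square regularity of the forward component\<close>

context brownian_setting
begin

text \<open>Up to the Brownian increment, \<open>X t - X s\<close> is bounded by the integral of
  \<open>d\<close> from \<open>s\<close> to \<open>t\<close>, and Cauchy-Schwarz in time extracts a
  factor \<open>t - s\<close>. Started from \<open>\<eta>\<close>, this gives second moments at
  every time instead of almost every one. The drift is dominated only at almost all times, because
  the lemma is first applied before the flow is known to stay in \<open>P2\<close>.\<close>

lemma forward_increments:
  assumes r: "r > 0" and X: "\<And>t. 0 \<le> t \<Longrightarrow> X t \<in> borel_measurable M" and \<eta>: "sq_integrable M \<eta>"
    and eq: "AE \<omega> in M. \<forall>t\<ge>0. set_integrable lborel {0..t} (p \<omega>) \<and>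
      X t \<omega> = \<eta> \<omega> + (LINT s:{0..t}|lborel. p \<omega> s) + B t \<omega>"
    and d: "sq_integrable (disc r M) (case_prod d)"
    and le: "AE s in lborel. 0 \<le> s \<longrightarrow> (\<forall>\<omega>\<in>space M. \<bar>p \<omega> s\<bar> \<le> d s \<omega>)"
  shows "AE \<omega> in M. X 0 \<omega> = \<eta> \<omega>"
    and "0 \<le> t \<Longrightarrow> sq_integrable M (X t)"
    and "0 \<le> T \<Longrightarrow> \<exists>C. \<forall>s\<in>{0..T}. \<forall>t\<in>{0..T}. expectation (\<lambda>\<omega>. (X s \<omega> - X t \<omega>)\<^sup>2) \<le> C * \<bar>s - t\<bar>"
proof -
  show X0: "AE \<omega> in M. X 0 \<omega> = \<eta> \<omega>"
    using eq B_start
  proof eventually_elim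
    case (elim \<omega>)
    have "(LINT s:{0..0}|lborel. p \<omega> s) = 0"
      unfolding set_lebesgue_integral_def
      by (rule integral_eq_zero_AE) (use AE_lborel_singleton[of 0] in \<open>eventually_elim, auto split: split_indicator\<close>)
    with elim show ?case by force
  qed
  have sf: "sigma_finite_measure M" ..
  have main: "sq_integrable M (\<lambda>\<omega>. X t \<omega> - X s \<omega>)"
    "expectation (\<lambda>\<omega>. (X t \<omega> - X s \<omega>)\<^sup>2)
      \<le> (2 * (\<integral>(s, \<omega>). (d s \<omega>)\<^sup>2 \<partial>(time_upto T \<Otimes>\<^sub>M M)) + 2) * (t - s)"
    if st: "0 \<le> s" "s \<le> t" "t \<le> T" for s t T
  proof -
    let ?U = "time_upto T"
    interpret U: finite_measure ?U by (rule finite_time_upto)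
    interpret UM: pair_sigma_finite ?U M ..
    note dU = sq_integrable_time_upto(1)[OF sf d r, of T]
    have [measurable]: "case_prod d \<in> borel_measurable (borel \<Otimes>\<^sub>M M)"
      using d by (simp add: sq_integrable_def cong: measurable_cong_sets)
    define R where "R \<omega> = (\<integral>u. indicator {s..t} u * d u \<omega> \<partial>?U)" for \<omega>
    have Rm[measurable]: "R \<in> borel_measurable M" unfolding R_def by measurable
    have ind: "sq_integrable ?U (indicator {s..t} :: real \<Rightarrow> real)"
      by (rule sq_integrable_bound[OF U.sq_integrable_const[of 1]]) (auto split: split_indicator)
    have ind2: "(\<integral>u. (indicator {s..t} u :: real)\<^sup>2 \<partial>?U) = t - s"
    proof -
      have "(\<lambda>u. indicator {0..T} u * (indicator {s..t} u)\<^sup>2) = (indicator {s..t} :: real \<Rightarrow> real)"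
        using st by (auto simp: fun_eq_iff split: split_indicator)
      moreover have "(\<integral>u. (indicator {s..t} u :: real)\<^sup>2 \<partial>?U)
          = (\<integral>u. indicator {0..T} u * (indicator {s..t} u)\<^sup>2 \<partial>lborel)"
        unfolding time_upto_def by (subst integral_density) auto
      ultimately show ?thesis using st by simp
    qed
    have di: "integrable (?U \<Otimes>\<^sub>M M) (\<lambda>(s, \<omega>). (d s \<omega>)\<^sup>2)"
      using dU by (simp add: sq_integrable_def case_prod_unfold)
    note sec = sq_integrable_section_integral(3)[OF finite_time_upto sf dU]
    have R2: "AE \<omega> in M. (R \<omega>)\<^sup>2 \<le> (t - s) * (\<integral>u. (d u \<omega>)\<^sup>2 \<partial>?U)"
      \<comment> \<open>Cauchy-Schwarz against the indicator of \<open>[s, t]\<close>, whose squared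
        norm is \<open>t - s\<close>.\<close>
      using sec by eventually_elim (unfold R_def, drule sq_integral_mult_le[OF ind], simp add: ind2)
    have di2: "integrable M (\<lambda>\<omega>. (t - s) * (\<integral>u. (d u \<omega>)\<^sup>2 \<partial>?U))"
      by (intro integrable_mult_right UM.integrable_snd di)
    have Ri: "integrable M (\<lambda>\<omega>. (R \<omega>)\<^sup>2)"
      by (rule Bochner_Integration.integrable_bound[OF di2])
        (use R2 in \<open>auto elim!: eventually_mono intro: order_trans[OF _ abs_ge_self]\<close>)
    have "expectation (\<lambda>\<omega>. (R \<omega>)\<^sup>2) \<le> expectation (\<lambda>\<omega>. (t - s) * (\<integral>u. (d u \<omega>)\<^sup>2 \<partial>?U))"
      by (rule integral_mono_AE[OF Ri di2 R2])
    also have "\<dots> = (t - s) * (\<integral>(s, \<omega>). (d s \<omega>)\<^sup>2 \<partial>(?U \<Otimes>\<^sub>M M))"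
      using UM.integral_snd[OF di] by simp
    finally have ER: "expectation (\<lambda>\<omega>. (R \<omega>)\<^sup>2) \<le> (t - s) * (\<integral>(s, \<omega>). (d s \<omega>)\<^sup>2 \<partial>(?U \<Otimes>\<^sub>M M))" .
    have inc: "AE \<omega> in M. \<bar>X t \<omega> - X s \<omega> - (B t \<omega> - B s \<omega>)\<bar> \<le> R \<omega>"
      using eq sec AE_space
    proof eventually_elim
      case (elim \<omega>)
      have pt: "set_integrable lborel {0..t} (p \<omega>)" using elim st by auto
      have pst: "set_integrable lborel {s..t} (p \<omega>)"
        by (rule set_integrable_subset[OF pt]) (use st in auto)
      have "X t \<omega> - X s \<omega> - (B t \<omega> - B s \<omega>) = (LINT u:{s..t}|lborel. p \<omega> u)"
        using elim(1) st set_integral_diff_Icc[OF pt st(1,2)] by simp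
      moreover have "\<bar>LINT u:{s..t}|lborel. p \<omega> u\<bar> \<le> (\<integral>u. norm (indicator {s..t} u *\<^sub>R p \<omega> u) \<partial>lborel)"
        unfolding set_lebesgue_integral_def real_norm_def[symmetric] by (rule integral_norm_bound)
      moreover have "(\<integral>u. norm (indicator {s..t} u *\<^sub>R p \<omega> u) \<partial>lborel) \<le> (\<integral>u. indicator {s..t} u * d u \<omega> \<partial>lborel)"
      proof (rule integral_mono_AE)
        show "integrable lborel (\<lambda>u. norm (indicator {s..t} u *\<^sub>R p \<omega> u))"
          using pst by (simp add: set_integrable_def)
        have [measurable]: "(\<lambda>u. d u \<omega>) \<in> borel_measurable borel" using elim(3) by measurable
        have "set_integrable lborel {0..T} (\<lambda>u. d u \<omega>)"
          using U.sq_integrable_imp_integrable[OF elim(2)] by (simp add: integrable_time_upto)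
        then have "set_integrable lborel {s..t} (\<lambda>u. d u \<omega>)"
          by (rule set_integrable_subset) (use st in auto)
        then show "integrable lborel (\<lambda>u. indicator {s..t} u * d u \<omega>)" by (simp add: set_integrable_def)
        show "AE u in lborel. norm (indicator {s..t} u *\<^sub>R p \<omega> u) \<le> indicator {s..t} u * d u \<omega>"
          using le by eventually_elim (use st elim(3) in \<open>auto split: split_indicator\<close>)
      qed
      moreover have "(\<integral>u. indicator {s..t} u * d u \<omega> \<partial>lborel) = R \<omega>"
      proof -
        have [measurable]: "(\<lambda>u. d u \<omega>) \<in> borel_measurable borel" using elim(3) by measurable
        show ?thesis unfolding R_def time_upto_def using st
          by (subst integral_density) (auto intro!: Bochner_Integration.integral_cong split: split_indicator)
      qed
      ultimately show ?case by simp
    qed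
    have "0 \<le> t" using st by simp
    note [measurable] = X[OF \<open>0 \<le> s\<close>] X[OF \<open>0 \<le> t\<close>] B_measurable[OF \<open>0 \<le> s\<close>] B_measurable[OF \<open>0 \<le> t\<close>]
    have Bsq: "sq_integrable M (\<lambda>\<omega>. B t \<omega> - B s \<omega>)"
      using increment_moments(2)[OF st(1,2)] by (simp add: sq_integrable_def)
    have le2: "AE \<omega> in M. (X t \<omega> - X s \<omega>)\<^sup>2 \<le> 2 * (R \<omega>)\<^sup>2 + 2 * (B t \<omega> - B s \<omega>)\<^sup>2"
      using inc
    proof eventually_elim
      case (elim \<omega>)
      then have "(X t \<omega> - X s \<omega> - (B t \<omega> - B s \<omega>))\<^sup>2 \<le> (R \<omega>)\<^sup>2"
        by (meson abs_ge_self abs_le_square_iff order_trans)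
      then show ?case
        using sum_sq_le[of "X t \<omega> - X s \<omega> - (B t \<omega> - B s \<omega>)" "B t \<omega> - B s \<omega>"] by simp
    qed
    have dom: "integrable M (\<lambda>\<omega>. 2 * (R \<omega>)\<^sup>2 + 2 * (B t \<omega> - B s \<omega>)\<^sup>2)"
      using Ri Bsq by (simp add: sq_integrable_def)
    have Xi: "integrable M (\<lambda>\<omega>. (X t \<omega> - X s \<omega>)\<^sup>2)"
      by (rule Bochner_Integration.integrable_bound[OF dom])
        (use le2 in \<open>auto elim!: eventually_mono intro: order_trans[OF _ abs_ge_self]\<close>)
    then show "sq_integrable M (\<lambda>\<omega>. X t \<omega> - X s \<omega>)" by (simp add: sq_integrable_def)
    have "expectation (\<lambda>\<omega>. (X t \<omega> - X s \<omega>)\<^sup>2) \<le> expectation (\<lambda>\<omega>. 2 * (R \<omega>)\<^sup>2 + 2 * (B t \<omega> - B s \<omega>)\<^sup>2)"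
      by (rule integral_mono_AE[OF Xi dom le2])
    also have "\<dots> = 2 * expectation (\<lambda>\<omega>. (R \<omega>)\<^sup>2) + 2 * (t - s)"
      using Ri Bsq increment_moments(4)[OF st(1,2)] by (simp add: sq_integrable_def)
    also have "\<dots> \<le> 2 * ((t - s) * (\<integral>(s, \<omega>). (d s \<omega>)\<^sup>2 \<partial>(?U \<Otimes>\<^sub>M M))) + 2 * (t - s)"
      using ER by simp
    finally show "expectation (\<lambda>\<omega>. (X t \<omega> - X s \<omega>)\<^sup>2)
      \<le> (2 * (\<integral>(s, \<omega>). (d s \<omega>)\<^sup>2 \<partial>(?U \<Otimes>\<^sub>M M)) + 2) * (t - s)" by (simp add: algebra_simps)
  qed
  have X0sq: "sq_integrable M (X 0)"
    by (rule sq_integrable_bound[OF \<eta> X[OF order_refl]]) (use X0 in \<open>auto elim: eventually_mono\<close>)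
  show "sq_integrable M (X t)" if "0 \<le> t"
    using sq_integrable_add[OF main(1)[OF order_refl that order_refl] X0sq] by simp
  show "\<exists>C. \<forall>s\<in>{0..T}. \<forall>t\<in>{0..T}. expectation (\<lambda>\<omega>. (X s \<omega> - X t \<omega>)\<^sup>2) \<le> C * \<bar>s - t\<bar>" if "0 \<le> T"
  proof (intro exI ballI)
    fix s t assume "s \<in> {0..T}" "t \<in> {0..T}"
    then show "expectation (\<lambda>\<omega>. (X s \<omega> - X t \<omega>)\<^sup>2)
      \<le> (2 * (\<integral>(s, \<omega>). (d s \<omega>)\<^sup>2 \<partial>(time_upto T \<Otimes>\<^sub>M M)) + 2) * \<bar>s - t\<bar>"
      using main(2)[of s t T] main(2)[of t s T] by (cases "s \<le> t") (auto simp: power2_commute)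
  qed
qed

end

lemma sq_integrable_sqrt_second_moment:
  assumes "prob_space M" "r > 0" "sq_integrable (disc r M) (case_prod g)"
  shows "sq_integrable (time_disc r) (\<lambda>s. sqrt (\<integral>\<omega>. (g s \<omega>)\<^sup>2 \<partial>M))"
    and "AE s in time_disc r. sq_integrable M (g s)"
proof -
  interpret prob_space M by fact
  interpret U: finite_measure "time_disc r" by (rule finite_time_disc) fact
  interpret UM: pair_sigma_finite "time_disc r" M ..
  have m[measurable]: "case_prod g \<in> borel_measurable (disc r M)"
    using assms(3) by (simp add: sq_integrable_def)
  have i: "integrable (disc r M) (\<lambda>(s, \<omega>). (g s \<omega>)\<^sup>2)"
    using assms(3) by (simp add: sq_integrable_def case_prod_unfold)
  show "sq_integrable (time_disc r) (\<lambda>s. sqrt (\<integral>\<omega>. (g s \<omega>)\<^sup>2 \<partial>M))"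
    using UM.integrable_fst[OF i] by (simp add: sq_integrable_def)
  show "AE s in time_disc r. sq_integrable M (g s)"
    using UM.AE_integrable_fst[OF i] by eventually_elim (auto simp: sq_integrable_def)
qed

lemma sq_integrable_running_integral:
  assumes M: "sigma_finite_measure M" and r: "r > 0"
    and q: "sq_integrable (disc r M) (case_prod q)" and s: "0 \<le> s"
  shows "sq_integrable M (\<lambda>\<omega>. LINT u:{s..t}|lborel. q u \<omega>)"
proof -
  interpret M: sigma_finite_measure M by fact
  note qU = sq_integrable_time_upto(1)[OF M q r, of t]
  have qm[measurable]: "case_prod q \<in> borel_measurable (borel \<Otimes>\<^sub>M M)"
    using q by (simp add: sq_integrable_def cong: measurable_cong_sets)
  have "sq_integrable (time_upto t \<Otimes>\<^sub>M M) (\<lambda>(u, \<omega>). indicator {s..} u * q u \<omega>)"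
    by (rule sq_integrable_bound[OF qU]) (auto split: split_indicator)
  note sec = sq_integrable_section_integral(1)[OF finite_time_upto M this]
  have "sq_integrable M (\<lambda>\<omega>. \<integral>u. indicator {s..} u * q u \<omega> \<partial>time_upto t)"
  proof (rule sq_integrable_bound[OF sec])
    show "AE \<omega> in M. \<bar>\<integral>u. indicator {s..} u * q u \<omega> \<partial>time_upto t\<bar>
        \<le> \<bar>\<integral>u. \<bar>indicator {s..} u * q u \<omega>\<bar> \<partial>time_upto t\<bar>"
      using integral_norm_bound[of "time_upto t" "\<lambda>u. indicator {s..} u * q u _"]
      by (intro AE_I2) (auto intro: order_trans[OF _ abs_ge_self])
    interpret U: finite_measure "time_upto t" by (rule finite_time_upto)
    show "(\<lambda>\<omega>. \<integral>u. indicator {s..} u * q u \<omega> \<partial>time_upto t) \<in> borel_measurable M"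
      by measurable
  qed
  then show ?thesis
  proof (rule sq_integrable_cong)
    fix \<omega> assume "\<omega> \<in> space M"
    then have "(\<lambda>u. q u \<omega>) \<in> borel_measurable borel" by measurable
    then show "(\<integral>u. indicator {s..} u * q u \<omega> \<partial>time_upto t) = (LINT u:{s..t}|lborel. q u \<omega>)"
      by (rule integral_time_upto_after[OF _ s])
  qed
qed

subsection \<open>Solutions of the forward-backward system\<close>

definition drift_y ::
  "(real \<Rightarrow> real measure \<Rightarrow> real \<Rightarrow> real) \<Rightarrow> (real \<Rightarrow> real measure) \<Rightarrow> (real \<Rightarrow> 'a \<Rightarrow> real) \<Rightarrow>
   (real \<Rightarrow> 'a \<Rightarrow> real) \<Rightarrow> real \<Rightarrow> 'a \<Rightarrow> real" where
  "drift_y H m X Y s \<omega> = partial_y H (X (max 0 s) \<omega>) (m (max 0 s)) (Y (max 0 s) \<omega>)"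

text \<open>The term \<open>- r * Y\<close> is included, so the backward drift is minus this
  process; adding \<open>r * y\<close> in the product identity restores the pure difference of
  \<open>partial_x\<close>.\<close>

definition drift_x ::
  "(real \<Rightarrow> real measure \<Rightarrow> real \<Rightarrow> real) \<Rightarrow> real \<Rightarrow> (real \<Rightarrow> real measure) \<Rightarrow> (real \<Rightarrow> 'a \<Rightarrow> real) \<Rightarrow>
   (real \<Rightarrow> 'a \<Rightarrow> real) \<Rightarrow> real \<Rightarrow> 'a \<Rightarrow> real" where
  "drift_x H r m X Y s \<omega> =
     partial_x H (X (max 0 s) \<omega>) (m (max 0 s)) (Y (max 0 s) \<omega>) - r * Y (max 0 s) \<omega>"

lemma set_integral_extend:
  "set_integrable lborel {0..t} (\<lambda>s. f (max 0 s)) \<longleftrightarrow> set_integrable lborel {0..t} (f :: real \<Rightarrow> real)"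
  "0 \<le> u \<Longrightarrow> (LINT s:{u..t}|lborel. f (max 0 s)) = (LINT s:{u..t}|lborel. f s)"
proof -
  have "(\<lambda>s. indicator {u..t} s *\<^sub>R f (max 0 s)) = (\<lambda>s. indicator {u..t} s *\<^sub>R f s)" if "0 \<le> u" for u
    using that by (auto simp: fun_eq_iff split: split_indicator)
  then show "set_integrable lborel {0..t} (\<lambda>s. f (max 0 s)) \<longleftrightarrow> set_integrable lborel {0..t} f"
    "0 \<le> u \<Longrightarrow> (LINT s:{u..t}|lborel. f (max 0 s)) = (LINT s:{u..t}|lborel. f s)"
    unfolding set_integrable_def set_lebesgue_integral_def by simp_all
qed

context brownian_setting
begin

text \<open>Bounds of the drift involve the flow, and the flow is the law of the solution.
  Mean-square distances break this circle: they are measurable in time by Fubini and dominate the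
  Wasserstein distances of the laws. The forward equation then gives moments at all times and the
  Hoelder bound.\<close>

lemma mkv_regular_flow:
  assumes r: "r > 0" and L: "L \<ge> 0" and h: "lipschitz_P2 L (partial_y H)"
    and \<xi>: "\<xi> \<in> L2_rv M (F 0)" and sol: "mkv_solution M B G H r \<xi> X Y Z"
  shows "regular_flow r (law_flow M X)" and "0 \<le> t \<Longrightarrow> sq_integrable M (X t)"
proof -
  have sf: "sigma_finite_measure M" by (rule sigma_finite_measure_axioms)
  have pm: "prob_space M" by (rule prob_space_axioms)
  interpret U: finite_measure "time_disc r" by (rule finite_time_disc[OF r])
  interpret UM: finite_measure "disc r M" by (rule finite_measure_pair_measure) unfold_locales
  have \<xi>sq: "sq_integrable M \<xi>"
    using \<xi> F_measurable unfolding L2_rv_def sq_integrable_def by blast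
  have X: "X \<in> Lr2 M F r" and Y: "Y \<in> Lr2 M F r"
    and eq: "AE \<omega> in M. \<forall>t\<ge>0. set_integrable lborel {0..t} (\<lambda>s. partial_y H (X s \<omega>) (law_flow M X s) (Y s \<omega>)) \<and>
      X t \<omega> = \<xi> \<omega> + (LINT s:{0..t}|lborel. partial_y H (X s \<omega>) (law_flow M X s) (Y s \<omega>)) + B t \<omega>"
    using sol unfolding mkv_solution_def fbsde_solution_def Let_def by blast+
  have Xm: "X t \<in> borel_measurable M" if "0 \<le> t" for t
    using X that F_measurable unfolding Lr2_def by blast
  note XD = Lr2_sq_integrable[OF sf r X] and YD = Lr2_sq_integrable[OF sf r Y]
  have dist: "sq_integrable (disc r M) (\<lambda>(s, \<omega>). X (max 0 s) \<omega> - V \<omega>)"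
    if "sq_integrable M V" for V
    using sq_integrable_diff[OF XD sq_integrable_snd[OF finite_time_disc[OF r] sf that]]
    by (simp add: case_prod_unfold)
  define w where "w V s = sqrt (expectation (\<lambda>\<omega>. (X (max 0 s) \<omega> - V \<omega>)\<^sup>2))" for V s
  have w: "sq_integrable (time_disc r) (w V)" if "sq_integrable M V" for V
    unfolding w_def by (rule sq_integrable_sqrt_second_moment[OF pm r dist[OF that]])
  have W2_w: "0 \<le> W2 (law_flow M X s) (distr M borel V)" "W2 (law_flow M X s) (distr M borel V) \<le> w V s"
    if "0 \<le> s" "sq_integrable M (X s)" "sq_integrable M V" for s V
    using W2_distr_le[OF that(2,3)] that(1) by (auto simp: law_flow_def w_def intro: real_le_rsqrt)
  \<comment> \<open>The law of \<open>\<xi>\<close> is the reference measure at this stage, as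
    \<open>X 0\<close> is not yet known to be square integrable.\<close>
  define c where "c = \<bar>partial_y H 0 (distr M borel \<xi>) 0\<bar>"
  define d where "d s \<omega> = c + L * (\<bar>X (max 0 s) \<omega>\<bar> + \<bar>Y (max 0 s) \<omega>\<bar> + w \<xi> s)" for s \<omega>
  have "sq_integrable (disc r M) (\<lambda>z. c
      + L * (\<bar>case z of (s, \<omega>) \<Rightarrow> X (max 0 s) \<omega>\<bar> + \<bar>case z of (s, \<omega>) \<Rightarrow> Y (max 0 s) \<omega>\<bar>
        + (case z of (s, \<omega>) \<Rightarrow> w \<xi> s)))"
    by (intro sq_integrable_add sq_integrable_cmult sq_integrable_abs UM.sq_integrable_const XD YD
        sq_integrable_fst[OF pm] w U.sigma_finite_measure_axioms \<xi>sq)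
  then have dD: "sq_integrable (disc r M) (case_prod d)"
    by (simp add: d_def case_prod_unfold)
  \<comment> \<open>Square integrability of \<open>X s\<close>, hence a law in \<open>P2\<close>, is
    available at this point only for almost every \<open>s\<close>.\<close>
  have le: "AE s in lborel. 0 \<le> s \<longrightarrow> (\<forall>\<omega>\<in>space M. \<bar>partial_y H (X s \<omega>) (law_flow M X s) (Y s \<omega>)\<bar> \<le> d s \<omega>)"
  proof -
    have "AE s in time_disc r. 0 \<le> s \<longrightarrow>
        (\<forall>\<omega>\<in>space M. \<bar>partial_y H (X s \<omega>) (law_flow M X s) (Y s \<omega>)\<bar> \<le> d s \<omega>)"
      using sq_integrable_sqrt_second_moment(2)[OF pm r XD]
    proof eventually_elim
      case (elim s)
      show ?case
      proof (intro impI ballI)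
        fix \<omega> assume s: "0 \<le> s"
        then have sq: "sq_integrable M (X s)" using elim by simp
        show "\<bar>partial_y H (X s \<omega>) (law_flow M X s) (Y s \<omega>)\<bar> \<le> d s \<omega>"
          using lipschitz_P2_growth[OF h L distr_in_P2[OF sq] distr_in_P2[OF \<xi>sq], of "w \<xi> s"]
            W2_w(2)[OF s sq \<xi>sq] s
          by (simp add: d_def c_def law_flow_def)
      qed
    qed
    from AE_time_disc_imp_lborel[OF this] show ?thesis by eventually_elim simp
  qed
  note fwd = forward_increments[OF r Xm \<xi>sq eq dD le]
  show sq: "sq_integrable M (X t)" if "0 \<le> t" for t by (rule fwd(2)) (use that in auto)
  show "regular_flow r (law_flow M X)"
    unfolding regular_flow_def
  proof (intro conjI allI impI)
    show "law_flow M X t \<in> P2" if "0 \<le> t" for t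
      unfolding law_flow_def by (rule distr_in_P2[OF sq[OF that]])
    show "\<exists>C. \<forall>s\<in>{0..T}. \<forall>t\<in>{0..T}. W2 (law_flow M X s) (law_flow M X t) \<le> sqrt (C * \<bar>s - t\<bar>)"
      if T0: "0 \<le> T" for T
    proof -
      obtain C where C: "\<forall>s\<in>{0..T}. \<forall>t\<in>{0..T}. expectation (\<lambda>\<omega>. (X s \<omega> - X t \<omega>)\<^sup>2) \<le> C * \<bar>s - t\<bar>"
        using fwd(3)[OF _ T0] by auto
      have "W2 (law_flow M X s) (law_flow M X t) \<le> sqrt (C * \<bar>s - t\<bar>)" if "s \<in> {0..T}" "t \<in> {0..T}" for s t
      proof (rule real_le_rsqrt)
        have "(W2 (law_flow M X s) (law_flow M X t))\<^sup>2 \<le> expectation (\<lambda>\<omega>. (X s \<omega> - X t \<omega>)\<^sup>2)"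
          unfolding law_flow_def using that by (intro W2_distr_le sq) auto
        also have "\<dots> \<le> C * \<bar>s - t\<bar>" using C that by blast
        finally show "(W2 (law_flow M X s) (law_flow M X t))\<^sup>2 \<le> C * \<bar>s - t\<bar>" .
      qed
      then show ?thesis by blast
    qed
    show "\<exists>v. sq_integrable (time_disc r) v \<and>
        (\<forall>s\<ge>0. 0 \<le> W2 (law_flow M X s) (law_flow M X 0) \<and> W2 (law_flow M X s) (law_flow M X 0) \<le> v s)"
      \<comment> \<open>With second moments at all times established, \<open>X 0\<close> can serve
        as the reference variable.\<close>
      using w[OF sq[of 0]] W2_w[OF _ sq sq[of 0]]
      by (intro exI[of _ "w (X 0)"]) (auto simp: law_flow_def)
  qed
qed

text \<open>The comparison of two solutions uses each of them only through these facts; the Ito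
  integral survives as the orthogonality in the last one.\<close>

lemma fbsde_solution_facts:
  assumes r: "r > 0" and L: "L \<ge> 0"
    and hy: "lipschitz_P2 L (partial_y H)" and hx: "lipschitz_P2 L (partial_x H)"
    and m: "regular_flow r m" and \<eta>: "sq_integrable M \<eta>" and sol: "fbsde_solution M B G H r m \<eta> X Y Z"
  defines "P \<equiv> drift_y H m X Y" and "Q \<equiv> drift_x H r m X Y"
  shows "sq_integrable (disc r M) (\<lambda>(s, \<omega>). X (max 0 s) \<omega>)"
    and "sq_integrable (disc r M) (\<lambda>(s, \<omega>). Y (max 0 s) \<omega>)"
    and "sq_integrable (disc r M) (case_prod P)"
    and "sq_integrable (disc r M) (case_prod Q)"
    and "0 \<le> t \<Longrightarrow> X t \<in> borel_measurable (F t)" and "0 \<le> t \<Longrightarrow> Y t \<in> borel_measurable (F t)"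
    and "0 \<le> t \<Longrightarrow> P t \<in> borel_measurable (F t)"
    and "0 \<le> t \<Longrightarrow> sq_integrable M (X t)" and "0 \<le> t \<Longrightarrow> sq_integrable M (Y t)"
    and "AE \<omega> in M. X 0 \<omega> = \<eta> \<omega>"
    and "AE \<omega> in M. \<forall>t\<ge>0. set_integrable lborel {0..t} (\<lambda>s. P s \<omega>) \<and>
      X t \<omega> = \<eta> \<omega> + (LINT s:{0..t}|lborel. P s \<omega>) + B t \<omega>"
    and "\<lbrakk>0 \<le> s; s \<le> t; \<phi> \<in> borel_measurable (F s); sq_integrable M \<phi>\<rbrakk> \<Longrightarrow>
      expectation (\<lambda>\<omega>. \<phi> \<omega> * (Y t \<omega> - Y s \<omega> + (LINT u:{s..t}|lborel. Q u \<omega>))) = 0"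
proof -
  have sf: "sigma_finite_measure M" by (rule sigma_finite_measure_axioms)
  have pm: "prob_space M" by (rule prob_space_axioms)
  obtain I where X: "X \<in> Lr2 M F r" and Y: "Y \<in> Lr2 M F r" and Z: "Z \<in> Lr2 M F r"
    and eqX: "AE \<omega> in M. \<forall>t\<ge>0. set_integrable lborel {0..t} (\<lambda>s. partial_y H (X s \<omega>) (m s) (Y s \<omega>)) \<and>
      X t \<omega> = \<eta> \<omega> + (LINT s:{0..t}|lborel. partial_y H (X s \<omega>) (m s) (Y s \<omega>)) + B t \<omega>"
    and I: "ito_integral M F B Z I"
    and eqY: "AE \<omega> in M. \<forall>t\<ge>0. set_integrable lborel {0..t} (\<lambda>s. partial_x H (X s \<omega>) (m s) (Y s \<omega>) - r * Y s \<omega>) \<and>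
      Y t \<omega> = Y 0 \<omega> - (LINT s:{0..t}|lborel. partial_x H (X s \<omega>) (m s) (Y s \<omega>) - r * Y s \<omega>) + I t \<omega>"
    using sol unfolding fbsde_solution_def Let_def by blast
  show XF: "X t \<in> borel_measurable (F t)" and YF: "Y t \<in> borel_measurable (F t)" if "0 \<le> t" for t
    using X Y that unfolding Lr2_def by blast+
  show XD: "sq_integrable (disc r M) (\<lambda>(s, \<omega>). X (max 0 s) \<omega>)"
    by (rule Lr2_sq_integrable[OF sf r X])
  show YD: "sq_integrable (disc r M) (\<lambda>(s, \<omega>). Y (max 0 s) \<omega>)"
    by (rule Lr2_sq_integrable[OF sf r Y])
  show PD: "sq_integrable (disc r M) (case_prod P)"
    unfolding P_def drift_y_def by (rule regular_flow_composition(1)[OF pm r m hy L XD YD])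
  have "sq_integrable (disc r M) (\<lambda>(s, \<omega>). partial_x H (X (max 0 s) \<omega>) (m (max 0 s)) (Y (max 0 s) \<omega>))"
    by (rule regular_flow_composition(1)[OF pm r m hx L XD YD])
  from sq_integrable_diff[OF this sq_integrable_cmult[OF YD, of r]]
  show QD: "sq_integrable (disc r M) (case_prod Q)"
    by (simp add: Q_def drift_x_def case_prod_unfold)
  show "P t \<in> borel_measurable (F t)" if "0 \<le> t" for t
    using regular_flow_composition(2)[OF pm r m hy L XD YD that, of "F t"] XF[OF that] YF[OF that] that
    by (simp add: P_def drift_y_def[abs_def])
  have P_ext: "set_integrable lborel {0..t} (\<lambda>s. P s \<omega>)
        \<longleftrightarrow> set_integrable lborel {0..t} (\<lambda>s. partial_y H (X s \<omega>) (m s) (Y s \<omega>))"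
      "(LINT s:{0..t}|lborel. P s \<omega>) = (LINT s:{0..t}|lborel. partial_y H (X s \<omega>) (m s) (Y s \<omega>))"
    and Q_ext: "set_integrable lborel {0..t} (\<lambda>s. Q s \<omega>)
        \<longleftrightarrow> set_integrable lborel {0..t} (\<lambda>s. partial_x H (X s \<omega>) (m s) (Y s \<omega>) - r * Y s \<omega>)"
      "(LINT s:{0..t}|lborel. Q s \<omega>)
        = (LINT s:{0..t}|lborel. partial_x H (X s \<omega>) (m s) (Y s \<omega>) - r * Y s \<omega>)" for t \<omega>
    unfolding P_def drift_y_def Q_def drift_x_def
    by (rule set_integral_extend(1) set_integral_extend(2)[OF order_refl])+
  show eqP: "AE \<omega> in M. \<forall>t\<ge>0. set_integrable lborel {0..t} (\<lambda>s. P s \<omega>) \<and>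
      X t \<omega> = \<eta> \<omega> + (LINT s:{0..t}|lborel. P s \<omega>) + B t \<omega>"
    using eqX unfolding P_ext .
  have eqQ: "AE \<omega> in M. \<forall>t\<ge>0. set_integrable lborel {0..t} (\<lambda>s. Q s \<omega>) \<and>
      Y t \<omega> = Y 0 \<omega> - (LINT s:{0..t}|lborel. Q s \<omega>) + I t \<omega>"
    using eqY unfolding Q_ext .
  have Pabs: "sq_integrable (disc r M) (\<lambda>(s, \<omega>). \<bar>P s \<omega>\<bar>)"
    using sq_integrable_abs[OF PD] by (simp add: case_prod_unfold)
  have eqP': "AE \<omega> in M. \<forall>t\<ge>0. set_integrable lborel {0..t} ((\<lambda>\<omega> s. P s \<omega>) \<omega>) \<and>
      X t \<omega> = \<eta> \<omega> + (LINT s:{0..t}|lborel. (\<lambda>\<omega> s. P s \<omega>) \<omega> s) + B t \<omega>"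
    using eqP by simp
  note fwd = forward_increments[OF r F_measurable[OF XF] \<eta> eqP' Pabs]
  show "AE \<omega> in M. X 0 \<omega> = \<eta> \<omega>" by (rule fwd(1)) auto
  show "sq_integrable M (X t)" if "0 \<le> t" for t by (rule fwd(2)) (use that in auto)
  have Zm: "(\<lambda>(t, \<omega>). Z t \<omega>) \<in> borel_measurable (restrict_space borel {0..} \<Otimes>\<^sub>M M)"
    using Z by (simp add: Lr2_def)
  note ito = ito_integral_orthogonal[OF Zm I]
  have Isq: "sq_integrable M (I t)" if "0 \<le> t" for t by (rule ito(1)[OF that order_refl])
  note Rsq = sq_integrable_running_integral[OF sf r QD]
  \<comment> \<open>Almost every time is good and \<open>[0, 1]\<close> is not a null set, so a good
    time exists. The backward equation, whose martingale part is square integrable at each time,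
    carries the moment from there to time 0 and then to every time.\<close>
  have "\<exists>t\<ge>0. sq_integrable M (Y t)"
  proof (rule ccontr)
    assume *: "\<not> (\<exists>t\<ge>0. sq_integrable M (Y t))"
    have "AE s in time_disc r. sq_integrable M (Y (max 0 s))"
      by (rule sq_integrable_sqrt_second_moment(2)[OF pm r YD])
    then have "AE s in time_disc r. False" by eventually_elim (use * in \<open>auto dest: spec[of _ "max 0 _"]\<close>)
    from AE_time_disc_imp_lborel[OF this] have "AE s in lborel. (0::real) \<le> s \<longrightarrow> False" .
    then have "emeasure lborel {0::real..1} = 0"
      by (intro AE_iff_null_sets[THEN iffD2, THEN null_setsD1]) (auto elim: eventually_mono)
    then show False by simp
  qed
  then obtain t0 where t0: "0 \<le> t0" "sq_integrable M (Y t0)" by blast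
  have Y0: "sq_integrable M (Y 0)"
  proof (rule sq_integrable_bound[OF sq_integrable_diff[OF sq_integrable_add[OF t0(2) Rsq[OF order_refl, of t0]] Isq[OF t0(1)]]])
    show "Y 0 \<in> borel_measurable M" by (rule F_measurable[OF YF]) simp
    show "AE \<omega> in M. \<bar>Y 0 \<omega>\<bar> \<le> \<bar>Y t0 \<omega> + (LINT u:{0..t0}|lborel. Q u \<omega>) - I t0 \<omega>\<bar>"
      using eqQ
    proof eventually_elim
      case (elim \<omega>)
      then have "Y t0 \<omega> = Y 0 \<omega> - (LINT s:{0..t0}|lborel. Q s \<omega>) + I t0 \<omega>" using t0 by blast
      then show ?case by simp
    qed
  qed
  show Ysq: "sq_integrable M (Y t)" if "0 \<le> t" for t
  proof (rule sq_integrable_bound[OF sq_integrable_add[OF sq_integrable_diff[OF Y0 Rsq[OF order_refl, of t]] Isq[OF that]]])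
    show "Y t \<in> borel_measurable M" by (rule F_measurable[OF YF[OF that]])
    show "AE \<omega> in M. \<bar>Y t \<omega>\<bar> \<le> \<bar>Y 0 \<omega> - (LINT u:{0..t}|lborel. Q u \<omega>) + I t \<omega>\<bar>"
      using eqQ
    proof eventually_elim
      case (elim \<omega>)
      then have "Y t \<omega> = Y 0 \<omega> - (LINT s:{0..t}|lborel. Q s \<omega>) + I t \<omega>" using that by blast
      then show ?case by simp
    qed
  qed
  assume st: "0 \<le> s" "s \<le> t" and \<phi>: "\<phi> \<in> borel_measurable (F s)" "sq_integrable M \<phi>"
  have t: "0 \<le> t" using st by simp
  \<comment> \<open>By the backward equation, the increment of \<open>Y\<close> plus the integral of
    \<open>Q\<close> is the increment of \<open>I\<close>.\<close>
  have "expectation (\<lambda>\<omega>. \<phi> \<omega> * (Y t \<omega> - Y s \<omega> + (LINT u:{s..t}|lborel. Q u \<omega>)))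
      = expectation (\<lambda>\<omega>. \<phi> \<omega> * (I t \<omega> - I s \<omega>))"
  proof (rule integral_cong_AE)
    show "AE \<omega> in M. \<phi> \<omega> * (Y t \<omega> - Y s \<omega> + (LINT u:{s..t}|lborel. Q u \<omega>)) = \<phi> \<omega> * (I t \<omega> - I s \<omega>)"
      using eqQ
    proof eventually_elim
      case (elim \<omega>)
      then have "(LINT u:{0..t}|lborel. Q u \<omega>) - (LINT u:{0..s}|lborel. Q u \<omega>) = (LINT u:{s..t}|lborel. Q u \<omega>)"
        using st t by (intro set_integral_diff_Icc) auto
      moreover have "Y t \<omega> = Y 0 \<omega> - (LINT s:{0..t}|lborel. Q s \<omega>) + I t \<omega>"
        "Y s \<omega> = Y 0 \<omega> - (LINT s:{0..s}|lborel. Q s \<omega>) + I s \<omega>"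
        using elim st t by blast+
      ultimately show ?case by simp
    qed
  qed (use sq_integrable_measurable[OF \<phi>(2)] sq_integrable_measurable[OF Ysq[OF t]] sq_integrable_measurable[OF Ysq[OF st(1)]]
      sq_integrable_measurable[OF Isq[OF t]] sq_integrable_measurable[OF Isq[OF st(1)]]
      sq_integrable_measurable[OF Rsq[OF st(1)]] in auto)
  also have "\<dots> = 0" by (rule ito(2)[OF st \<phi>])
  finally show "expectation (\<lambda>\<omega>. \<phi> \<omega> * (Y t \<omega> - Y s \<omega> + (LINT u:{s..t}|lborel. Q u \<omega>))) = 0" .
qed

end

subsection \<open>Comparison of two solutions\<close>

definition monotone_P2 :: "real \<Rightarrow> real \<Rightarrow> (real \<Rightarrow> real measure \<Rightarrow> real \<Rightarrow> real) \<Rightarrow> bool" where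
  "monotone_P2 \<kappa> C H \<longleftrightarrow> (\<forall>x y x' y'. \<forall>\<mu>\<in>P2. \<forall>\<mu>'\<in>P2.
     - (x - x') * (partial_x H x \<mu> y - partial_x H x' \<mu>' y')
       + (y - y') * (partial_y H x \<mu> y - partial_y H x' \<mu>' y')
     \<le> - \<kappa> * ((x - x')\<^sup>2 + (y - y')\<^sup>2) + C * (W2 \<mu> \<mu>')\<^sup>2)"

text \<open>The function \<open>V\<close> bounds the squared Wasserstein distance of the flows.  The differences are restricted
  to an event \<open>A\<close> of \<open>F 0\<close>, so that the estimates hold conditionally on \<open>F 0\<close>; with them one does not
  need to know that \<open>Y\<^sub>0\<close> is almost surely constant when the initial value is.\<close>

locale fbsde_comparison = brownian_setting M B G
  for M :: "'a measure" and B :: "real \<Rightarrow> 'a \<Rightarrow> real" and G :: "'a measure" +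
  fixes H :: "real \<Rightarrow> real measure \<Rightarrow> real \<Rightarrow> real" and r L \<kappa> C :: real
    and m m' :: "real \<Rightarrow> real measure" and \<eta> \<eta>' :: "'a \<Rightarrow> real"
    and X Y Z X' Y' Z' :: "real \<Rightarrow> 'a \<Rightarrow> real" and V :: "real \<Rightarrow> real" and A :: "'a set"
  assumes r: "r > 0" and L: "L \<ge> 0" and C: "C \<ge> 0"
    and hy: "lipschitz_P2 L (partial_y H)" and hx: "lipschitz_P2 L (partial_x H)"
    and mono: "monotone_P2 \<kappa> C H"
    and m: "regular_flow r m" and m': "regular_flow r m'"
    and \<eta>: "sq_integrable M \<eta>" and \<eta>': "sq_integrable M \<eta>'"
    and sol: "fbsde_solution M B G H r m \<eta> X Y Z" and sol': "fbsde_solution M B G H r m' \<eta>' X' Y' Z'"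
    and V: "integrable (time_disc r) V"
    and W2_V: "0 \<le> s \<Longrightarrow> 0 \<le> W2 (m s) (m' s)" "0 \<le> s \<Longrightarrow> (W2 (m s) (m' s))\<^sup>2 \<le> V s"
    and A: "A \<in> sets (F 0)"
begin

lemmas facts = fbsde_solution_facts[OF r L hy hx m \<eta> sol]
lemmas facts' = fbsde_solution_facts[OF r L hy hx m' \<eta>' sol']

definition "x s \<omega> = indicator A \<omega> * (X (max 0 s) \<omega> - X' (max 0 s) \<omega>)"
definition "y s \<omega> = indicator A \<omega> * (Y (max 0 s) \<omega> - Y' (max 0 s) \<omega>)"
definition "p s \<omega> = indicator A \<omega> * (drift_y H m X Y s \<omega> - drift_y H m' X' Y' s \<omega>)"
definition "q s \<omega> = indicator A \<omega> * (drift_x H r m X Y s \<omega> - drift_x H r m' X' Y' s \<omega>)"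

lemma A_F: "0 \<le> t \<Longrightarrow> A \<in> sets (F t)" and A_M [measurable]: "A \<in> sets M"
  using A F_mono[of 0 t] subalgebra_F[of 0] by (auto simp: subalgebra_def)

lemma indicator_diff_measurable:
  assumes "0 \<le> t" "f \<in> borel_measurable (F t)" "g \<in> borel_measurable (F t)"
  shows "(\<lambda>\<omega>. indicator A \<omega> * (f \<omega> - g \<omega>) :: real) \<in> borel_measurable (F t)"
proof -
  note [measurable] = A_F[OF assms(1)] assms(2,3)
  show ?thesis by measurable
qed

lemma indicator_diff_sq_integrable:
  assumes "sq_integrable M f" "sq_integrable M g"
  shows "sq_integrable M (\<lambda>\<omega>. indicator A \<omega> * (f \<omega> - g \<omega>))"
proof (rule sq_integrable_bound[OF sq_integrable_diff[OF assms]])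
  note [measurable] = assms[THEN sq_integrable_measurable]
  show "(\<lambda>\<omega>. indicator A \<omega> * (f \<omega> - g \<omega>)) \<in> borel_measurable M" by measurable
qed (auto split: split_indicator)

lemma indicator_diff_disc:
  assumes "sq_integrable (disc r M) (case_prod f)"
    and "sq_integrable (disc r M) (case_prod g)"
  shows "sq_integrable (disc r M) (\<lambda>(s, \<omega>). indicator A \<omega> * (f s \<omega> - g s \<omega>))"
proof (rule sq_integrable_bound[OF sq_integrable_diff[OF assms]])
  note [measurable] = assms[THEN sq_integrable_measurable]
  show "(\<lambda>(s, \<omega>). indicator A \<omega> * (f s \<omega> - g s \<omega>)) \<in> borel_measurable (disc r M)"
    by measurable
qed (auto split: split_indicator)

lemma section_integrable:
  assumes "sq_integrable (disc r M) (case_prod f)" "0 \<le> s"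
  shows "AE \<omega> in M. set_integrable lborel {s..t} (\<lambda>u. f u \<omega>)"
proof -
  interpret U: finite_measure "time_upto t" by (rule finite_time_upto)
  note fU = sq_integrable_time_upto(1)[OF sigma_finite_measure_axioms assms(1) r, of t]
  have [measurable]: "case_prod f \<in> borel_measurable (borel \<Otimes>\<^sub>M M)"
    using assms(1) by (simp add: sq_integrable_def cong: measurable_cong_sets)
  show ?thesis
    using sq_integrable_section_integral(3)[OF finite_time_upto sigma_finite_measure_axioms fU] AE_space
  proof eventually_elim
    case (elim \<omega>)
    have [measurable]: "(\<lambda>u. f u \<omega>) \<in> borel_measurable borel" using elim(2) by measurable
    have "set_integrable lborel {0..t} (\<lambda>u. f u \<omega>)"
      using U.sq_integrable_imp_integrable[OF elim(1)] by (simp add: integrable_time_upto)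
    then show ?case by (rule set_integrable_subset) (use assms(2) in auto)
  qed
qed

text \<open>Since \<open>A\<close> is known at time 0, multiplication by its indicator keeps the
  differences adapted and, being constant in time, commutes with the time integrals.\<close>

sublocale pair: discounted_pair M F r x y p q
proof
  show "r > 0" by (rule r)
  show "sq_integrable (disc r M) (case_prod x)"
    unfolding x_def by (rule indicator_diff_disc[OF facts(1) facts'(1)])
  show "sq_integrable (disc r M) (case_prod y)"
    unfolding y_def by (rule indicator_diff_disc[OF facts(2) facts'(2)])
  show "sq_integrable (disc r M) (case_prod p)"
    unfolding p_def by (rule indicator_diff_disc[OF facts(3) facts'(3)])
  show "sq_integrable (disc r M) (case_prod q)"
    unfolding q_def by (rule indicator_diff_disc[OF facts(4) facts'(4)])
  fix t :: real assume t: "0 \<le> t"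
  have mt: "max 0 t = t" using t by simp
  show "x t \<in> borel_measurable (F t)"
    unfolding x_def[abs_def] mt by (rule indicator_diff_measurable[OF t facts(5)[OF t] facts'(5)[OF t]])
  show "y t \<in> borel_measurable (F t)"
    unfolding y_def[abs_def] mt by (rule indicator_diff_measurable[OF t facts(6)[OF t] facts'(6)[OF t]])
  show "p t \<in> borel_measurable (F t)"
    unfolding p_def[abs_def] by (rule indicator_diff_measurable[OF t facts(7)[OF t] facts'(7)[OF t]])
  show "sq_integrable M (x t)"
    unfolding x_def[abs_def] mt by (rule indicator_diff_sq_integrable[OF facts(8)[OF t] facts'(8)[OF t]])
  show "sq_integrable M (y t)"
    unfolding y_def[abs_def] mt by (rule indicator_diff_sq_integrable[OF facts(9)[OF t] facts'(9)[OF t]])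
next
  show "AE \<omega> in M. \<forall>t\<ge>0. set_integrable lborel {0..t} (\<lambda>s. p s \<omega>) \<and>
      x t \<omega> = x 0 \<omega> + (LINT s:{0..t}|lborel. p s \<omega>)"
    using facts(10,11) facts'(10,11)
  proof eventually_elim
    case (elim \<omega>)
    show ?case
    proof (intro allI impI)
      fix t :: real assume t: "0 \<le> t"
      have i: "set_integrable lborel {0..t} (\<lambda>s. drift_y H m X Y s \<omega>)"
        "set_integrable lborel {0..t} (\<lambda>s. drift_y H m' X' Y' s \<omega>)"
        and e: "X t \<omega> = \<eta> \<omega> + (LINT s:{0..t}|lborel. drift_y H m X Y s \<omega>) + B t \<omega>"
        "X' t \<omega> = \<eta>' \<omega> + (LINT s:{0..t}|lborel. drift_y H m' X' Y' s \<omega>) + B t \<omega>"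
        using elim(2,4) t by blast+
      have "(LINT s:{0..t}|lborel. p s \<omega>) = indicator A \<omega> *
          ((LINT s:{0..t}|lborel. drift_y H m X Y s \<omega>) - (LINT s:{0..t}|lborel. drift_y H m' X' Y' s \<omega>))"
        unfolding p_def using i by (simp add: set_integral_diff)
      moreover have "x t \<omega> = indicator A \<omega> * (X t \<omega> - X' t \<omega>)" "x 0 \<omega> = indicator A \<omega> * (\<eta> \<omega> - \<eta>' \<omega>)"
        using t elim(1,3) by (auto simp: x_def)
      moreover have "set_integrable lborel {0..t} (\<lambda>s. p s \<omega>)"
        unfolding p_def using i by (intro set_integrable_mult_right set_integral_diff(1))
      ultimately show "set_integrable lborel {0..t} (\<lambda>s. p s \<omega>) \<and>
          x t \<omega> = x 0 \<omega> + (LINT s:{0..t}|lborel. p s \<omega>)"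
        unfolding e by (simp add: algebra_simps)
    qed
  qed
next
  fix s t :: real and \<phi>
  assume st: "0 \<le> s" "s \<le> t" and \<phi>: "\<phi> \<in> borel_measurable (F s)" "sq_integrable M \<phi>"
  have t: "0 \<le> t" using st by simp
  \<comment> \<open>The indicator is moved from the differences onto the test function, which
    remains measurable for \<open>F s\<close>.\<close>
  define \<psi> where "\<psi> \<omega> = indicator A \<omega> * \<phi> \<omega>" for \<omega>
  have \<psi>: "\<psi> \<in> borel_measurable (F s)" "sq_integrable M \<psi>"
    using indicator_diff_measurable[OF st(1) \<phi>(1), of "\<lambda>_. 0"]
      indicator_diff_sq_integrable[OF \<phi>(2) sq_integrable_const[of 0]] by (simp_all add: \<psi>_def[abs_def])
  define R R' where "R \<omega> = (LINT u:{s..t}|lborel. drift_x H r m X Y u \<omega>)"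
    and "R' \<omega> = (LINT u:{s..t}|lborel. drift_x H r m' X' Y' u \<omega>)" for \<omega>
  have Rsq: "sq_integrable M R" "sq_integrable M R'"
    unfolding R_def R'_def
    by (rule sq_integrable_running_integral[OF sigma_finite_measure_axioms r _ st(1)] facts(4) facts'(4))+
  have qR: "AE \<omega> in M. (LINT u:{s..t}|lborel. q u \<omega>) = indicator A \<omega> * (R \<omega> - R' \<omega>)"
    using section_integrable[OF facts(4) st(1), of t] section_integrable[OF facts'(4) st(1), of t]
    by eventually_elim (simp add: q_def R_def R'_def set_integral_diff)
  have sq: "sq_integrable M (\<lambda>\<omega>. Y t \<omega> - Y s \<omega> + R \<omega>)" "sq_integrable M (\<lambda>\<omega>. Y' t \<omega> - Y' s \<omega> + R' \<omega>)"
    by (intro sq_integrable_add sq_integrable_diff Rsq facts(9) facts'(9) t st)+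
  have qsq: "sq_integrable M (\<lambda>\<omega>. LINT u:{s..t}|lborel. q u \<omega>)"
    unfolding q_def
    by (rule sq_integrable_running_integral[OF sigma_finite_measure_axioms r indicator_diff_disc[OF facts(4) facts'(4)] st(1)])
  have "expectation (\<lambda>\<omega>. \<phi> \<omega> * (y t \<omega> - y s \<omega> + (LINT u:{s..t}|lborel. q u \<omega>)))
      = expectation (\<lambda>\<omega>. \<psi> \<omega> * (Y t \<omega> - Y s \<omega> + R \<omega>) - \<psi> \<omega> * (Y' t \<omega> - Y' s \<omega> + R' \<omega>))"
  proof (rule integral_cong_AE)
    show "AE \<omega> in M. \<phi> \<omega> * (y t \<omega> - y s \<omega> + (LINT u:{s..t}|lborel. q u \<omega>))
        = \<psi> \<omega> * (Y t \<omega> - Y s \<omega> + R \<omega>) - \<psi> \<omega> * (Y' t \<omega> - Y' s \<omega> + R' \<omega>)"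
      using qR
    proof eventually_elim
      case (elim \<omega>)
      show ?case unfolding elim using st t by (simp add: y_def \<psi>_def algebra_simps)
    qed
    have "sq_integrable M (y t)" "sq_integrable M (y s)"
      using indicator_diff_sq_integrable[OF facts(9)[OF t] facts'(9)[OF t]]
        indicator_diff_sq_integrable[OF facts(9)[OF st(1)] facts'(9)[OF st(1)]] st t
      by (simp_all add: y_def[abs_def])
    note [measurable] = this[THEN sq_integrable_measurable] sq_integrable_measurable[OF \<phi>(2)]
      sq_integrable_measurable[OF qsq]
    show "(\<lambda>\<omega>. \<phi> \<omega> * (y t \<omega> - y s \<omega> + (LINT u:{s..t}|lborel. q u \<omega>))) \<in> borel_measurable M"
      by measurable
    show "(\<lambda>\<omega>. \<psi> \<omega> * (Y t \<omega> - Y s \<omega> + R \<omega>) - \<psi> \<omega> * (Y' t \<omega> - Y' s \<omega> + R' \<omega>)) \<in> borel_measurable M"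
      using sq_integrable_mult[OF \<psi>(2) sq(1)] sq_integrable_mult[OF \<psi>(2) sq(2)]
      by (intro borel_measurable_diff borel_measurable_integrable)
  qed
  also have "\<dots> = 0"
    using facts(12)[OF st \<psi>] facts'(12)[OF st \<psi>] sq_integrable_mult[OF \<psi>(2) sq(1)] sq_integrable_mult[OF \<psi>(2) sq(2)]
    by (simp add: R_def R'_def)
  finally show "expectation (\<lambda>\<omega>. \<phi> \<omega> * (y t \<omega> - y s \<omega> + (LINT u:{s..t}|lborel. q u \<omega>))) = 0" .
qed

text \<open>\<open>V\<close> is deterministic, so restriction to \<open>A\<close> makes the
  Wasserstein term proportional to \<open>prob A\<close>. This lets the estimates over all events
  combine into an almost sure one.\<close>

lemma weight:
  shows "integrable (disc r M) (\<lambda>(s, \<omega>). indicator A \<omega> * V s)"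
    and "(\<integral>(s, \<omega>). indicator A \<omega> * V s \<partial>disc r M) = prob A * (\<integral>s. V s \<partial>time_disc r)"
proof -
  note [measurable] = borel_measurable_integrable[OF V]
  show i: "integrable (disc r M) (\<lambda>(s, \<omega>). indicator A \<omega> * V s)"
    by (rule pair.tp.Fubini_integrable) (use V in \<open>auto simp: abs_mult emeasure_eq_measure\<close>)
  show "(\<integral>(s, \<omega>). indicator A \<omega> * V s \<partial>disc r M) = prob A * (\<integral>s. V s \<partial>time_disc r)"
    by (subst pair.tp.integral_fst[symmetric, OF i]) (simp add: Int_absorb2 sets.sets_into_space)
qed

lemma W2_bound: "0 \<le> s \<Longrightarrow> 0 \<le> V s"
  using W2_V(2)[of s] zero_le_power2[of "W2 (m s) (m' s)"] by linarith

lemma drift_monotone: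
  assumes s: "0 \<le> s"
  shows "p s \<omega> * y s \<omega> - x s \<omega> * (q s \<omega> + r * y s \<omega>)
    \<le> - \<kappa> * ((x s \<omega>)\<^sup>2 + (y s \<omega>)\<^sup>2) + C * (indicator A \<omega> * V s)"
proof (cases "\<omega> \<in> A")
  case True
  have P2: "m s \<in> P2" "m' s \<in> P2" using m m' s by (auto simp: regular_flow_def)
  \<comment> \<open>The summand \<open>r * y\<close> cancels the discount term contained in
    \<open>q\<close>, which leaves exactly the left side of the monotonicity condition.\<close>
  have "p s \<omega> * y s \<omega> - x s \<omega> * (q s \<omega> + r * y s \<omega>)
      = - (X s \<omega> - X' s \<omega>) * (partial_x H (X s \<omega>) (m s) (Y s \<omega>) - partial_x H (X' s \<omega>) (m' s) (Y' s \<omega>))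
       + (Y s \<omega> - Y' s \<omega>) * (partial_y H (X s \<omega>) (m s) (Y s \<omega>) - partial_y H (X' s \<omega>) (m' s) (Y' s \<omega>))"
    using True s by (simp add: p_def q_def x_def y_def drift_x_def drift_y_def algebra_simps)
  also have "\<dots> \<le> - \<kappa> * ((X s \<omega> - X' s \<omega>)\<^sup>2 + (Y s \<omega> - Y' s \<omega>)\<^sup>2) + C * (W2 (m s) (m' s))\<^sup>2"
    using mono P2 unfolding monotone_P2_def by blast
  also have "\<dots> \<le> - \<kappa> * ((X s \<omega> - X' s \<omega>)\<^sup>2 + (Y s \<omega> - Y' s \<omega>)\<^sup>2) + C * V s"
    using W2_V(2)[OF s] C by (intro add_left_mono mult_left_mono)
  finally show ?thesis using True s by (simp add: x_def y_def)
qed (simp add: p_def q_def x_def y_def)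

text \<open>Squaring the three terms of the Lipschitz bound costs a factor 3, and splitting off
  \<open>r * y\<close> a factor 2; hence \<open>6 * L\<^sup>2 + 2 * r\<^sup>2\<close>.\<close>

lemma q_bound:
  assumes s: "0 \<le> s"
  shows "(q s \<omega>)\<^sup>2 \<le> (6 * L\<^sup>2 + 2 * r\<^sup>2) * ((x s \<omega>)\<^sup>2 + (y s \<omega>)\<^sup>2 + indicator A \<omega> * V s)"
proof (cases "\<omega> \<in> A")
  case True
  have P2: "m s \<in> P2" "m' s \<in> P2" using m m' s by (auto simp: regular_flow_def)
  define d w where "d = partial_x H (X s \<omega>) (m s) (Y s \<omega>) - partial_x H (X' s \<omega>) (m' s) (Y' s \<omega>)"
    and "w = W2 (m s) (m' s)"
  define a b where "a = X s \<omega> - X' s \<omega>" and "b = Y s \<omega> - Y' s \<omega>"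
  define K where "K = a\<^sup>2 + b\<^sup>2 + V s"
  have "\<bar>d\<bar> \<le> L * (\<bar>a\<bar> + \<bar>b\<bar> + w)"
    using hx P2 unfolding lipschitz_P2_def d_def w_def a_def b_def by blast
  then have "d\<^sup>2 \<le> (L * (\<bar>a\<bar> + \<bar>b\<bar> + w))\<^sup>2" by (meson abs_ge_self abs_le_square_iff order_trans)
  also have "\<dots> = L\<^sup>2 * (\<bar>a\<bar> + \<bar>b\<bar> + w)\<^sup>2" by (rule power_mult_distrib)
  also have "(\<bar>a\<bar> + \<bar>b\<bar> + w)\<^sup>2 \<le> 3 * (a\<^sup>2 + b\<^sup>2 + w\<^sup>2)"
    using sum_squares_bound[of "\<bar>a\<bar>" "\<bar>b\<bar>"] sum_squares_bound[of "\<bar>a\<bar>" w] sum_squares_bound[of "\<bar>b\<bar>" w]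
    by (simp add: power2_eq_square algebra_simps)
  finally have "d\<^sup>2 \<le> L\<^sup>2 * (3 * (a\<^sup>2 + b\<^sup>2 + w\<^sup>2))" by (simp add: mult_left_mono)
  also have "\<dots> \<le> L\<^sup>2 * (3 * K)"
    using W2_V(2)[OF s] by (intro mult_left_mono) (auto simp: w_def K_def)
  finally have "d\<^sup>2 \<le> L\<^sup>2 * (3 * K)" .
  moreover have "(r * b)\<^sup>2 \<le> r\<^sup>2 * K"
    using W2_bound[OF s] unfolding power_mult_distrib K_def by (intro mult_left_mono) auto
  moreover have "(d - r * b)\<^sup>2 \<le> 2 * d\<^sup>2 + 2 * (r * b)\<^sup>2"
    using sum_sq_le[of d "- (r * b)"] by simp
  ultimately have "(d - r * b)\<^sup>2 \<le> (6 * L\<^sup>2 + 2 * r\<^sup>2) * (a\<^sup>2 + b\<^sup>2 + V s)"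
    unfolding K_def[symmetric] distrib_right by linarith
  moreover have "q s \<omega> = d - r * b" "x s \<omega> = a" "y s \<omega> = b"
    using True s by (auto simp: q_def x_def y_def drift_x_def d_def a_def b_def algebra_simps)
  ultimately show ?thesis using True by simp
qed (simp add: q_def x_def y_def)

lemma x_initial: "expectation (\<lambda>\<omega>. (x 0 \<omega>)\<^sup>2) = expectation (\<lambda>\<omega>. indicator A \<omega> * (\<eta> \<omega> - \<eta>' \<omega>)\<^sup>2)"
proof (rule integral_cong_AE)
  show "AE \<omega> in M. (x 0 \<omega>)\<^sup>2 = indicator A \<omega> * (\<eta> \<omega> - \<eta>' \<omega>)\<^sup>2"
    using facts(10) facts'(10) by eventually_elim (simp add: x_def split: split_indicator)
  note [measurable] = sq_integrable_measurable[OF \<eta>] sq_integrable_measurable[OF \<eta>']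
    sq_integrable_measurable[OF pair.x_sq[OF order_refl]]
  show "(\<lambda>\<omega>. (x 0 \<omega>)\<^sup>2) \<in> borel_measurable M" "(\<lambda>\<omega>. indicator A \<omega> * (\<eta> \<omega> - \<eta>' \<omega>)\<^sup>2) \<in> borel_measurable M"
    by measurable
qed

text \<open>\<open>2 * exp r\<close> comes from \<open>initial_estimate\<close>; the other factor
  bounds the squared norms of \<open>y\<close> and \<open>q\<close> together by
  \<open>pair.S\<close> plus the Wasserstein term. The value is the same for all solutions and all
  events \<open>A\<close>.\<close>

definition "c = 2 * exp r * (1 + 6 * L\<^sup>2 + 2 * r\<^sup>2)"

text \<open>These are the inputs of \<open>absorb\<close>, with the weight \<open>\<epsilon>\<close>
  of Young's inequality left free to be chosen there.\<close>

lemma estimates: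
  defines "v \<equiv> prob A * (\<integral>s. V s \<partial>time_disc r)"
  shows "\<kappa> * pair.S \<le> expectation (\<lambda>\<omega>. x 0 \<omega> * y 0 \<omega>) + C * v"
    and "expectation (\<lambda>\<omega>. (y 0 \<omega>)\<^sup>2) \<le> c * (pair.S + v)"
    and "\<epsilon> > 0 \<Longrightarrow> 2 * expectation (\<lambda>\<omega>. x 0 \<omega> * y 0 \<omega>)
      \<le> expectation (\<lambda>\<omega>. indicator A \<omega> * (\<eta> \<omega> - \<eta>' \<omega>)\<^sup>2) / \<epsilon> + \<epsilon> * expectation (\<lambda>\<omega>. (y 0 \<omega>)\<^sup>2)"
    and "0 \<le> v" and "0 \<le> pair.S"
proof -
  let ?D = "disc r M"
  have sf: "sigma_finite_measure M" by (rule sigma_finite_measure_axioms)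
  show "\<kappa> * pair.S \<le> expectation (\<lambda>\<omega>. x 0 \<omega> * y 0 \<omega>) + C * v"
    unfolding v_def weight(2)[symmetric]
    by (rule pair.monotone_estimate[OF weight(1)]) (rule drift_monotone)
  have "0 \<le> (\<integral>s. V s \<partial>time_disc r)"
    by (rule integral_nonneg_AE) (auto intro!: AE_time_disc W2_bound)
  then show v0: "0 \<le> v" by (simp add: v_def)
  show S0: "0 \<le> pair.S"
    unfolding pair.S_def by (intro add_nonneg_nonneg integral_nonneg_AE) (auto simp: case_prod_unfold)
  note ints = pair.sq_disc[OF pair.x_disc] pair.sq_disc[OF pair.y_disc] weight(1)
  have "(\<integral>(s, \<omega>). (q s \<omega>)\<^sup>2 \<partial>?D) \<le> (\<integral>z. (6 * L\<^sup>2 + 2 * r\<^sup>2) * ((case z of (s, \<omega>) \<Rightarrow> (x s \<omega>)\<^sup>2)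
      + (case z of (s, \<omega>) \<Rightarrow> (y s \<omega>)\<^sup>2) + (case z of (s, \<omega>) \<Rightarrow> indicator A \<omega> * V s)) \<partial>?D)"
  proof (rule integral_mono_AE[OF pair.sq_disc[OF pair.q_disc]])
    show "AE z in ?D. (case z of (s, \<omega>) \<Rightarrow> (q s \<omega>)\<^sup>2) \<le> (6 * L\<^sup>2 + 2 * r\<^sup>2) * ((case z of (s, \<omega>) \<Rightarrow> (x s \<omega>)\<^sup>2)
      + (case z of (s, \<omega>) \<Rightarrow> (y s \<omega>)\<^sup>2) + (case z of (s, \<omega>) \<Rightarrow> indicator A \<omega> * V s))"
      using AE_time_fst(2)[OF sf r]
      by eventually_elim (use q_bound in \<open>auto simp: case_prod_unfold\<close>)
  qed (use ints in \<open>intro integrable_mult_right Bochner_Integration.integrable_add\<close>)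
  also have "\<dots> = (6 * L\<^sup>2 + 2 * r\<^sup>2) * (pair.S + v)"
    using ints by (simp add: pair.S_def v_def weight(2)[symmetric])
  finally have q: "(\<integral>(s, \<omega>). (q s \<omega>)\<^sup>2 \<partial>?D) \<le> (6 * L\<^sup>2 + 2 * r\<^sup>2) * (pair.S + v)" .
  have "(\<integral>(s, \<omega>). (y s \<omega>)\<^sup>2 \<partial>?D) \<le> pair.S + v"
  proof -
    have "0 \<le> (\<integral>(s, \<omega>). (x s \<omega>)\<^sup>2 \<partial>?D)" by (rule integral_nonneg_AE) (auto simp: case_prod_unfold)
    then show ?thesis unfolding pair.S_def using v0 by linarith
  qed
  with q have "(\<integral>(s, \<omega>). (y s \<omega>)\<^sup>2 \<partial>?D) + (\<integral>(s, \<omega>). (q s \<omega>)\<^sup>2 \<partial>?D) \<le> (1 + 6 * L\<^sup>2 + 2 * r\<^sup>2) * (pair.S + v)"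
    by (simp add: distrib_right)
  then have "2 * exp r * ((\<integral>(s, \<omega>). (y s \<omega>)\<^sup>2 \<partial>?D) + (\<integral>(s, \<omega>). (q s \<omega>)\<^sup>2 \<partial>?D))
      \<le> 2 * exp r * ((1 + 6 * L\<^sup>2 + 2 * r\<^sup>2) * (pair.S + v))" by (intro mult_left_mono) auto
  from order_trans[OF pair.initial_estimate this] show "expectation (\<lambda>\<omega>. (y 0 \<omega>)\<^sup>2) \<le> c * (pair.S + v)"
    unfolding c_def by (simp only: mult.assoc)
  assume \<epsilon>: "\<epsilon> > 0"
  note sq = pair.x_sq[OF order_refl] pair.y_sq[OF order_refl]
  have "expectation (\<lambda>\<omega>. 2 * (x 0 \<omega> * y 0 \<omega>)) \<le> expectation (\<lambda>\<omega>. (x 0 \<omega>)\<^sup>2 / \<epsilon> + \<epsilon> * (y 0 \<omega>)\<^sup>2)"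
  proof (rule integral_mono)
    fix \<omega>
    have "2 * (x 0 \<omega> / sqrt \<epsilon>) * (sqrt \<epsilon> * y 0 \<omega>) \<le> (x 0 \<omega> / sqrt \<epsilon>)\<^sup>2 + (sqrt \<epsilon> * y 0 \<omega>)\<^sup>2"
      by (rule sum_squares_bound)
    then show "2 * (x 0 \<omega> * y 0 \<omega>) \<le> (x 0 \<omega>)\<^sup>2 / \<epsilon> + \<epsilon> * (y 0 \<omega>)\<^sup>2"
      using \<epsilon> by (simp add: power_divide power_mult_distrib)
  qed (use sq_integrable_mult[OF sq] sq[THEN sq_integrable_integrable_sq] in auto)
  then show "2 * expectation (\<lambda>\<omega>. x 0 \<omega> * y 0 \<omega>)
      \<le> expectation (\<lambda>\<omega>. indicator A \<omega> * (\<eta> \<omega> - \<eta>' \<omega>)\<^sup>2) / \<epsilon> + \<epsilon> * expectation (\<lambda>\<omega>. (y 0 \<omega>)\<^sup>2)"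
    using sq[THEN sq_integrable_integrable_sq] unfolding x_initial[symmetric] by simp
qed

lemma S_whole_space:
  assumes "A = space M"
  shows "pair.S = (\<integral>(s, \<omega>). (X (max 0 s) \<omega> - X' (max 0 s) \<omega>)\<^sup>2 \<partial>disc r M)
    + (\<integral>(s, \<omega>). (Y (max 0 s) \<omega> - Y' (max 0 s) \<omega>)\<^sup>2 \<partial>disc r M)"
proof -
  have "\<omega> \<in> A" if "\<omega> \<in> space M" for \<omega> using assms that by simp
  then show ?thesis
    unfolding pair.S_def
    by (intro arg_cong2[of _ _ _ _ "(+)"] Bochner_Integration.integral_cong refl)
      (auto simp: x_def y_def space_pair_measure)
qed

end

text \<open>The constant delivered by \<open>absorb\<close>: \<open>a\<close> is the coercivity,
  \<open>b\<close> the weight of the Wasserstein term, \<open>c\<close> the factor bounding the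
  second moment of the backward difference at time 0. Depending on these alone, it is uniform over
  initial data and events.\<close>

definition stability_const :: "real \<Rightarrow> real \<Rightarrow> real \<Rightarrow> real" where
  "stability_const a b c = (1 + c) * (4 / (3 * a) * (c / a + b + a / 4)) + c"

lemma stability_const_pos: "a > 0 \<Longrightarrow> b \<ge> 0 \<Longrightarrow> c > 0 \<Longrightarrow> stability_const a b c > 0"
  unfolding stability_const_def
  by (intro add_nonneg_pos mult_nonneg_nonneg add_nonneg_nonneg) auto

section \<open>Stability for prescribed flows and for the coupled system\<close>

context fbsde_comparison
begin

lemma c_pos: "c > 0"
  unfolding c_def by (intro mult_pos_pos add_pos_nonneg) auto

lemma stability:
  assumes "\<kappa> > 0"
  shows "pair.S + expectation (\<lambda>\<omega>. (y 0 \<omega>)\<^sup>2) \<le> stability_const \<kappa> C c *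
    (expectation (\<lambda>\<omega>. indicator A \<omega> * (\<eta> \<omega> - \<eta>' \<omega>)\<^sup>2) + prob A * (\<integral>s. V s \<partial>time_disc r))"
  unfolding stability_const_def
  by (rule absorb[OF assms C c_pos estimates(4) _ estimates(1,2,3)]) auto

lemma y_initial: "(y 0 \<omega>)\<^sup>2 = indicator A \<omega> * (Y 0 \<omega> - Y' 0 \<omega>)\<^sup>2"
  by (simp add: y_def split: split_indicator)

lemma norm_stability:
  assumes "\<kappa> > 0" "A = space M"
  shows "(\<integral>(s, \<omega>). (X (max 0 s) \<omega> - X' (max 0 s) \<omega>)\<^sup>2 \<partial>disc r M)
    + (\<integral>(s, \<omega>). (Y (max 0 s) \<omega> - Y' (max 0 s) \<omega>)\<^sup>2 \<partial>disc r M)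
    \<le> stability_const \<kappa> C c * (expectation (\<lambda>\<omega>. (\<eta> \<omega> - \<eta>' \<omega>)\<^sup>2) + (\<integral>s. V s \<partial>time_disc r))"
proof -
  have "expectation (\<lambda>\<omega>. indicator A \<omega> * (\<eta> \<omega> - \<eta>' \<omega>)\<^sup>2) = expectation (\<lambda>\<omega>. (\<eta> \<omega> - \<eta>' \<omega>)\<^sup>2)"
    by (intro Bochner_Integration.integral_cong refl) (simp add: assms)
  moreover have "0 \<le> expectation (\<lambda>\<omega>. (y 0 \<omega>)\<^sup>2)" by simp
  moreover have "prob A = 1" by (simp add: assms(2) prob_space)
  ultimately show ?thesis
    using stability[OF assms(1)] unfolding S_whole_space[OF assms(2)] by (simp only: mult_1)
qed

end

text \<open>The hypothesis is tested on the event \<open>K < f\<close>: there \<open>f - K\<close>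
  is positive, yet its integral is at most 0.\<close>

lemma (in prob_space) AE_le_of_conditional_expectation_le:
  assumes F: "subalgebra M N" and f: "f \<in> borel_measurable N" "integrable M f"
    and le: "\<And>A. A \<in> sets N \<Longrightarrow> expectation (\<lambda>\<omega>. indicator A \<omega> * f \<omega>) \<le> K * prob A"
  shows "AE \<omega> in M. f \<omega> \<le> K"
proof -
  define A where "A = {\<omega>\<in>space N. K < f \<omega>}"
  note f(1)[measurable]
  have AN: "A \<in> sets N" unfolding A_def by measurable
  then have [measurable]: "A \<in> sets M" using F by (auto simp: subalgebra_def)
  have sp: "space N = space M" using F by (simp add: subalgebra_def)
  define g where "g \<omega> = indicator A \<omega> * (f \<omega> - K)" for \<omega>
  have i: "integrable M (\<lambda>\<omega>. indicator A \<omega> * f \<omega>)"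
    using integrable_mult_indicator[OF _ f(2), of A] by simp
  have gi: "integrable M g" unfolding g_def
    using integrable_mult_indicator[OF _ Bochner_Integration.integrable_diff[OF f(2) integrable_const[of K]], of A]
    by simp
  have g0: "0 \<le> g \<omega>" for \<omega> unfolding g_def A_def by (auto split: split_indicator)
  have "expectation g = expectation (\<lambda>\<omega>. indicator A \<omega> * f \<omega> - K * indicator A \<omega>)"
    unfolding g_def by (simp add: algebra_simps)
  also have "\<dots> = expectation (\<lambda>\<omega>. indicator A \<omega> * f \<omega>) - K * prob A"
    using i by (simp add: Int_absorb2 sets.sets_into_space emeasure_eq_measure)
  finally have "expectation g \<le> 0" using le[OF AN] by simp
  moreover have "0 \<le> expectation g" by (rule integral_nonneg_AE) (use g0 in auto)
  ultimately have "AE \<omega> in M. g \<omega> = 0"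
    using integral_nonneg_eq_0_iff_AE[OF gi] g0 by auto
  then show ?thesis
    using AE_space by eventually_elim (auto simp: g_def A_def sp indicator_def split: if_splits)
qed

text \<open>For a constant squared gap \<open>d\<close> of the initial values, both terms on the
  right of \<open>stability\<close> over an event are multiples of its probability, and
  \<open>Y 0\<close> is measurable for \<open>F 0\<close>. The comparison is therefore repeated over
  every event of \<open>F 0\<close>.\<close>

lemma (in fbsde_comparison) initial_value_stability:
  assumes \<kappa>: "\<kappa> > 0" and d: "\<And>\<omega>. (\<eta> \<omega> - \<eta>' \<omega>)\<^sup>2 = d"
  shows "AE \<omega> in M. (Y 0 \<omega> - Y' 0 \<omega>)\<^sup>2 \<le> stability_const \<kappa> C c * (d + (\<integral>s. V s \<partial>time_disc r))"
proof (rule AE_le_of_conditional_expectation_le[OF subalgebra_F[of 0]])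
  show "(\<lambda>\<omega>. (Y 0 \<omega> - Y' 0 \<omega>)\<^sup>2) \<in> borel_measurable (F 0)"
    using facts(6)[OF order_refl] facts'(6)[OF order_refl] by measurable
  show "integrable M (\<lambda>\<omega>. (Y 0 \<omega> - Y' 0 \<omega>)\<^sup>2)"
    using sq_integrable_diff[OF facts(9)[OF order_refl] facts'(9)[OF order_refl]]
    by (rule sq_integrable_integrable_sq)
  fix A' assume A': "A' \<in> sets (F 0)"
  interpret A': fbsde_comparison M B G H r L \<kappa> C m m' \<eta> \<eta>' X Y Z X' Y' Z' V A'
    by unfold_locales (rule r L C hy hx mono m m' \<eta> \<eta>' sol sol' V W2_V A'; assumption?)+
  have "expectation (\<lambda>\<omega>. indicator A' \<omega> * (Y 0 \<omega> - Y' 0 \<omega>)\<^sup>2)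
      \<le> A'.pair.S + expectation (\<lambda>\<omega>. (A'.y 0 \<omega>)\<^sup>2)"
    using A'.estimates(5) unfolding A'.y_initial by simp
  also have "\<dots> \<le> stability_const \<kappa> C c *
      (expectation (\<lambda>\<omega>. indicator A' \<omega> * (\<eta> \<omega> - \<eta>' \<omega>)\<^sup>2) + prob A' * (\<integral>s. V s \<partial>time_disc r))"
    by (rule A'.stability[OF \<kappa>])
  also have "expectation (\<lambda>\<omega>. indicator A' \<omega> * (\<eta> \<omega> - \<eta>' \<omega>)\<^sup>2) = prob A' * d"
    using sets.sets_into_space[OF A'.A_M] by (simp add: d Int_absorb2)
  finally show "expectation (\<lambda>\<omega>. indicator A' \<omega> * (Y 0 \<omega> - Y' 0 \<omega>)\<^sup>2)
      \<le> stability_const \<kappa> C c * (d + (\<integral>s. V s \<partial>time_disc r)) * prob A'"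
    by (simp add: algebra_simps)
qed

text \<open>Here \<open>V\<close> is the mean-square distance of the forward components, whose time
  integral is itself part of the sum of squared norms. Moving the Wasserstein term to the left
  lowers the coercivity to \<open>\<kappa> - C\<close>, and counting it with the norms doubles
  \<open>c\<close>; hence the arguments \<open>\<kappa> - C\<close>, \<open>0\<close> and
  \<open>2 * c\<close>.\<close>

lemma (in brownian_setting) mkv_stability:
  fixes H :: "real \<Rightarrow> real measure \<Rightarrow> real \<Rightarrow> real"
  assumes r: "r > 0" and L: "L \<ge> 0" and C: "C \<ge> 0" "C < \<kappa>"
    and hy: "lipschitz_P2 L (partial_y H)" and hx: "lipschitz_P2 L (partial_x H)"
    and mono: "monotone_P2 \<kappa> C H"
    and \<xi>: "\<xi> \<in> L2_rv M (F 0)" and \<xi>': "\<xi>' \<in> L2_rv M (F 0)"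
    and sol: "mkv_solution M B G H r \<xi> X Y Z" and sol': "mkv_solution M B G H r \<xi>' X' Y' Z'"
  defines "V \<equiv> \<lambda>s. expectation (\<lambda>\<omega>. (X (max 0 s) \<omega> - X' (max 0 s) \<omega>)\<^sup>2)"
    and "c \<equiv> 2 * exp r * (1 + 6 * L\<^sup>2 + 2 * r\<^sup>2)"
  shows "fbsde_comparison M B G H r L \<kappa> C (law_flow M X) (law_flow M X') \<xi> \<xi>' X Y Z X' Y' Z' V (space M)"
    and "(\<integral>s. V s \<partial>time_disc r)
      = (\<integral>(s, \<omega>). (X (max 0 s) \<omega> - X' (max 0 s) \<omega>)\<^sup>2 \<partial>disc r M)"
    and "expectation (\<lambda>\<omega>. (Y 0 \<omega> - Y' 0 \<omega>)\<^sup>2) + (\<integral>s. V s \<partial>time_disc r)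
      + (\<integral>(s, \<omega>). (Y (max 0 s) \<omega> - Y' (max 0 s) \<omega>)\<^sup>2 \<partial>disc r M)
      \<le> stability_const (\<kappa> - C) 0 (2 * c) * expectation (\<lambda>\<omega>. (\<xi> \<omega> - \<xi>' \<omega>)\<^sup>2)"
proof -
  note flow = mkv_regular_flow[OF r L hy \<xi> sol] and flow' = mkv_regular_flow[OF r L hy \<xi>' sol']
  have fb: "fbsde_solution M B G H r (law_flow M X) \<xi> X Y Z" "fbsde_solution M B G H r (law_flow M X') \<xi>' X' Y' Z'"
    using sol sol' by (simp_all add: mkv_solution_def)
  have sq: "sq_integrable M \<xi>" "sq_integrable M \<xi>'"
    using \<xi> \<xi>' F_measurable unfolding L2_rv_def sq_integrable_def by blast+
  have XD: "sq_integrable (disc r M) (\<lambda>(s, \<omega>). X (max 0 s) \<omega> - X' (max 0 s) \<omega>)"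
    using sq_integrable_diff[OF fbsde_solution_facts(1)[OF r L hy hx flow(1) sq(1) fb(1)]
        fbsde_solution_facts(1)[OF r L hy hx flow'(1) sq(2) fb(2)]]
    by (simp add: case_prod_unfold)
  interpret U: finite_measure "time_disc r" by (rule finite_time_disc[OF r])
  interpret UM: pair_sigma_finite "time_disc r" M ..
  have XDi: "integrable (disc r M) (\<lambda>(s, \<omega>). (X (max 0 s) \<omega> - X' (max 0 s) \<omega>)\<^sup>2)"
    using XD by (simp add: sq_integrable_def case_prod_unfold)
  have V: "integrable (time_disc r) V" unfolding V_def by (rule UM.integrable_fst[OF XDi])
  show V_eq: "(\<integral>s. V s \<partial>time_disc r)
      = (\<integral>(s, \<omega>). (X (max 0 s) \<omega> - X' (max 0 s) \<omega>)\<^sup>2 \<partial>disc r M)"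
    unfolding V_def by (rule UM.integral_fst[OF XDi])
  have W2: "0 \<le> W2 (law_flow M X s) (law_flow M X' s)"
    "(W2 (law_flow M X s) (law_flow M X' s))\<^sup>2 \<le> V s" if "0 \<le> s" for s
    using W2_distr_le[OF flow(2)[OF that] flow'(2)[OF that]] that by (auto simp: law_flow_def V_def)
  have sp: "space M \<in> sets (F 0)" using sets.top[of "F 0"] by simp
  show comp: "fbsde_comparison M B G H r L \<kappa> C (law_flow M X) (law_flow M X') \<xi> \<xi>' X Y Z X' Y' Z' V (space M)"
    by unfold_locales (rule r L C hy hx mono flow(1) flow'(1) sq fb V W2 sp; assumption?)+
  interpret K: fbsde_comparison M B G H r L \<kappa> C "law_flow M X" "law_flow M X'" \<xi> \<xi>' X Y Z X' Y' Z' V "space M"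
    by (rule comp)
  define vY where "vY = (\<integral>(s, \<omega>). (Y (max 0 s) \<omega> - Y' (max 0 s) \<omega>)\<^sup>2 \<partial>disc r M)"
  define vX where "vX = (\<integral>s. V s \<partial>time_disc r)"
  define e where "e = expectation (\<lambda>\<omega>. K.x 0 \<omega> * K.y 0 \<omega>)"
  define E where "E = expectation (\<lambda>\<omega>. (\<xi> \<omega> - \<xi>' \<omega>)\<^sup>2)"
  have S: "K.pair.S = vX + vY" unfolding K.S_whole_space[OF refl] vX_def vY_def V_eq by simp
  have vY0: "0 \<le> vY" unfolding vY_def by (rule integral_nonneg_AE) (auto simp: case_prod_unfold)
  have E_eq: "expectation (\<lambda>\<omega>. indicator (space M) \<omega> * (\<xi> \<omega> - \<xi>' \<omega>)\<^sup>2) = E"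
    unfolding E_def by (intro Bochner_Integration.integral_cong refl) simp
  have Y0: "expectation (\<lambda>\<omega>. (K.y 0 \<omega>)\<^sup>2) = expectation (\<lambda>\<omega>. (Y 0 \<omega> - Y' 0 \<omega>)\<^sup>2)"
    by (intro Bochner_Integration.integral_cong refl) (simp add: K.y_initial)
  have c: "K.c = c" by (simp add: K.c_def c_def)
  \<comment> \<open>The product \<open>0 * 0\<close> fills the Wasserstein slot of
    \<open>absorb\<close>, that term having already been moved to the left.\<close>
  have 1: "(\<kappa> - C) * (vX + vY) \<le> e + 0 * 0"
  proof -
    have "C * vX \<le> C * (vX + vY)" using C vY0 by (intro mult_left_mono) auto
    moreover have "\<kappa> * (vX + vY) \<le> e + C * vX"
      using K.estimates(1) by (simp add: S e_def vX_def prob_space)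
    ultimately show ?thesis by (simp add: left_diff_distrib)
  qed
  have 2: "expectation (\<lambda>\<omega>. (K.y 0 \<omega>)\<^sup>2) \<le> 2 * c * (vX + vY + 0)"
  proof -
    have "expectation (\<lambda>\<omega>. (K.y 0 \<omega>)\<^sup>2) \<le> c * (vX + vY + vX)"
      using K.estimates(2) by (simp add: S c vX_def prob_space)
    also have "\<dots> \<le> c * (2 * (vX + vY))" using vY0 K.c_pos c by (intro mult_left_mono) auto
    finally show ?thesis by (simp add: algebra_simps)
  qed
  have "vX + vY + expectation (\<lambda>\<omega>. (K.y 0 \<omega>)\<^sup>2) \<le> stability_const (\<kappa> - C) 0 (2 * c) * (E + 0)"
    unfolding stability_const_def
  proof (rule absorb[OF _ _ _ _ _ 1 2])
    show "2 * e \<le> E / \<epsilon> + \<epsilon> * expectation (\<lambda>\<omega>. (K.y 0 \<omega>)\<^sup>2)" if "\<epsilon> > 0" for \<epsilon>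
      using K.estimates(3)[OF that] unfolding E_eq e_def .
  qed (use C K.c_pos c in \<open>auto simp: E_def\<close>)
  then show "expectation (\<lambda>\<omega>. (Y 0 \<omega> - Y' 0 \<omega>)\<^sup>2) + (\<integral>s. V s \<partial>time_disc r)
      + (\<integral>(s, \<omega>). (Y (max 0 s) \<omega> - Y' (max 0 s) \<omega>)\<^sup>2 \<partial>disc r M)
      \<le> stability_const (\<kappa> - C) 0 (2 * c) * expectation (\<lambda>\<omega>. (\<xi> \<omega> - \<xi>' \<omega>)\<^sup>2)"
    by (simp add: Y0 vX_def vY_def E_def)
qed

section \<open>A common constant for the coupled and the decoupled estimates\<close>

theorem proposition3p3:
  fixes M G :: "'a measure" and B :: "real \<Rightarrow> 'a \<Rightarrow> real"
    and H :: "real \<Rightarrow> real measure \<Rightarrow> real \<Rightarrow> real"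
    and b\<^sub>0 f\<^sub>0 :: "real \<Rightarrow> real measure \<Rightarrow> real"
    and b\<^sub>1 f\<^sub>1 :: "real \<Rightarrow> real \<Rightarrow> real"
    and \<alpha> :: "real \<Rightarrow> real \<Rightarrow> real"
    and r L \<kappa> C\<^sub>0 :: real
  assumes setting: "brownian_setting M B G"
    and r: "r > 0"
    and hamiltonian: "is_hamiltonian (\<lambda>x \<mu> a. b\<^sub>0 x \<mu> + b\<^sub>1 x a) (\<lambda>x \<mu> a. f\<^sub>0 x \<mu> + f\<^sub>1 x a) \<alpha> H"
    and H_cont: "jointly_continuous H"
    and H_partials: "has_second_partials H"
    and L: "L > 0"
    and lip_y: "\<And>x \<mu> y x' \<mu>' y'. \<mu> \<in> P2 \<Longrightarrow> \<mu>' \<in> P2 \<Longrightarrow>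
      \<bar>partial_y H x \<mu> y - partial_y H x' \<mu>' y'\<bar> \<le> L * (\<bar>x - x'\<bar> + \<bar>y - y'\<bar> + W2 \<mu> \<mu>')"
    and lip_x: "\<And>x \<mu> y x' \<mu>' y'. \<mu> \<in> P2 \<Longrightarrow> \<mu>' \<in> P2 \<Longrightarrow>
      \<bar>partial_x H x \<mu> y - partial_x H x' \<mu>' y'\<bar> \<le> L * (\<bar>x - x'\<bar> + \<bar>y - y'\<bar> + W2 \<mu> \<mu>')"
    and kappa: "\<kappa> > 0" "C\<^sub>0 > 0" "C\<^sub>0 + r / 2 < \<kappa>"
    and monotone: "\<And>x \<mu> y x' \<mu>' y'. \<mu> \<in> P2 \<Longrightarrow> \<mu>' \<in> P2 \<Longrightarrow>
      - (x - x') * (partial_x H x \<mu> y - partial_x H x' \<mu>' y')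
        + (y - y') * (partial_y H x \<mu> y - partial_y H x' \<mu>' y')
      \<le> - \<kappa> * (\<bar>x - x'\<bar>\<^sup>2 + \<bar>y - y'\<bar>\<^sup>2) + C\<^sub>0 * (W2 \<mu> \<mu>')\<^sup>2"
  shows "\<exists>C>0.
    \<forall>\<xi>\<in>L2_rv M (augmented_filtration M B G 0). \<forall>\<xi>'\<in>L2_rv M (augmented_filtration M B G 0).
    \<forall>X\<xi> Y\<xi> Z\<xi> X\<xi>' Y\<xi>' Z\<xi>'.
      mkv_solution M B G H r \<xi> X\<xi> Y\<xi> Z\<xi> \<and> mkv_solution M B G H r \<xi>' X\<xi>' Y\<xi>' Z\<xi>' \<longrightarrow>
      (\<integral>\<^sup>+\<omega>. ennreal (\<bar>Y\<xi> 0 \<omega> - Y\<xi>' 0 \<omega>\<bar>\<^sup>2) \<partial>M)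
          + sqnorm_r M r (\<lambda>t \<omega>. X\<xi> t \<omega> - X\<xi>' t \<omega>) + sqnorm_r M r (\<lambda>t \<omega>. Y\<xi> t \<omega> - Y\<xi>' t \<omega>)
        \<le> ennreal C * (\<integral>\<^sup>+\<omega>. ennreal (\<bar>\<xi> \<omega> - \<xi>' \<omega>\<bar>\<^sup>2) \<partial>M) \<and>
      (\<forall>x x' X Y Z X' Y' Z'.
        decoupled_solution M B G H r X\<xi> x X Y Z \<and> decoupled_solution M B G H r X\<xi>' x' X' Y' Z' \<longrightarrow>
        (AE \<omega> in M.
          ennreal (\<bar>Y 0 \<omega> - Y' 0 \<omega>\<bar>\<^sup>2)
            + sqnorm_r M r (\<lambda>t \<omega>. X t \<omega> - X' t \<omega>) + sqnorm_r M r (\<lambda>t \<omega>. Y t \<omega> - Y' t \<omega>)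
          \<le> ennreal C * (ennreal (\<bar>x - x'\<bar>\<^sup>2)
              + (\<integral>\<^sup>+\<omega>. ennreal (\<bar>\<xi> \<omega> - \<xi>' \<omega>\<bar>\<^sup>2) \<partial>M))))"
proof -
  interpret brownian_setting M B G by (rule setting)
  have sf: "sigma_finite_measure M" by (rule sigma_finite_measure_axioms)
  have hy: "lipschitz_P2 L (partial_y H)" and hx: "lipschitz_P2 L (partial_x H)"
    using lip_y lip_x unfolding lipschitz_P2_def by blast+
  have mono: "monotone_P2 \<kappa> C\<^sub>0 H"
    using monotone unfolding monotone_P2_def by (simp only: power2_abs) blast
  have L0: "L \<ge> 0" and C0: "C\<^sub>0 \<ge> 0" "C\<^sub>0 < \<kappa>" using L kappa r by auto
  define c where "c = 2 * exp r * (1 + 6 * L\<^sup>2 + 2 * r\<^sup>2)"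
  have c: "c > 0" unfolding c_def by (intro mult_pos_pos add_pos_nonneg) auto
  define K1 where "K1 = stability_const (\<kappa> - C\<^sub>0) 0 (2 * c)"
  define K2 where "K2 = stability_const \<kappa> C\<^sub>0 c"
  have K: "K1 > 0" "K2 > 0" unfolding K1_def K2_def using C0 c kappa by (auto intro!: stability_const_pos)
  \<comment> \<open>\<open>K1\<close> serves the coupled estimate. In the decoupled one
    \<open>1 + K1\<close> accounts for the initial gap together with the distance of the flows, and
    the factor 2 counts the bound with \<open>K2\<close> twice: once for the norms, once for the
    value at time 0.\<close>
  define K where "K = K1 + 2 * K2 * (1 + K1)"
  have K_pos: "K > 0" unfolding K_def using K by (intro add_pos_pos mult_pos_pos) auto
  have K1_le: "K1 \<le> K" using K by (simp add: K_def)
  have K2_le: "2 * K2 * (1 + K1) \<le> K" using K by (simp add: K_def)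
  show ?thesis
  proof (intro exI[of _ K] conjI K_pos ballI allI impI, goal_cases)
    case (1 \<xi> \<xi>' X Y Z X' Y' Z')
    then have sol: "mkv_solution M B G H r \<xi> X Y Z" "mkv_solution M B G H r \<xi>' X' Y' Z'" by auto
    note st = mkv_stability[OF r L0 C0 hy hx mono 1(1,2) sol]
    interpret K: fbsde_comparison M B G H r L \<kappa> C\<^sub>0 "law_flow M X" "law_flow M X'" \<xi> \<xi>' X Y Z X' Y' Z'
      "\<lambda>s. expectation (\<lambda>\<omega>. (X (max 0 s) \<omega> - X' (max 0 s) \<omega>)\<^sup>2)" "space M" by (rule st(1))
    have XD: "sq_integrable (disc r M) (\<lambda>(s, \<omega>). X (max 0 s) \<omega> - X' (max 0 s) \<omega>)"
      "sq_integrable (disc r M) (\<lambda>(s, \<omega>). Y (max 0 s) \<omega> - Y' (max 0 s) \<omega>)"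
      using sq_integrable_diff[OF K.facts(1) K.facts'(1)] sq_integrable_diff[OF K.facts(2) K.facts'(2)]
      by (simp_all add: case_prod_unfold)
    have nn: "(\<integral>\<^sup>+\<omega>. ennreal (\<bar>f \<omega> - g \<omega>\<bar>\<^sup>2) \<partial>M) = ennreal (expectation (\<lambda>\<omega>. (f \<omega> - g \<omega>)\<^sup>2))"
      if "sq_integrable M f" "sq_integrable M g" for f g
      using sq_integrable_integrable_sq[OF sq_integrable_diff[OF that]]
      by (subst nn_integral_eq_integral) auto
    note eqs = nn[OF K.\<eta> K.\<eta>'] nn[OF K.facts(9)[OF order_refl] K.facts'(9)[OF order_refl]]
      sqnorm_r_eq_integral[OF sf r, of "\<lambda>t \<omega>. X t \<omega> - X' t \<omega>", OF XD(1)]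
      sqnorm_r_eq_integral[OF sf r, of "\<lambda>t \<omega>. Y t \<omega> - Y' t \<omega>", OF XD(2)]
    define E vX vY vY0 where "E = expectation (\<lambda>\<omega>. (\<xi> \<omega> - \<xi>' \<omega>)\<^sup>2)"
      and "vX = (\<integral>(s, \<omega>). (X (max 0 s) \<omega> - X' (max 0 s) \<omega>)\<^sup>2 \<partial>disc r M)"
      and "vY = (\<integral>(s, \<omega>). (Y (max 0 s) \<omega> - Y' (max 0 s) \<omega>)\<^sup>2 \<partial>disc r M)"
      and "vY0 = expectation (\<lambda>\<omega>. (Y 0 \<omega> - Y' 0 \<omega>)\<^sup>2)"
    have nonneg: "0 \<le> E" "0 \<le> vX" "0 \<le> vY" "0 \<le> vY0"
      unfolding E_def vX_def vY_def vY0_def by (intro integral_nonneg_AE; auto simp: case_prod_unfold)+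
    have "vY0 + vX + vY \<le> K1 * E"
      using st(3) unfolding st(2) E_def vX_def vY_def vY0_def K1_def c_def .
    also have "\<dots> \<le> K * E" using K1_le nonneg by (intro mult_right_mono)
    finally show ?case
      unfolding eqs E_def[symmetric] vX_def[symmetric] vY_def[symmetric] vY0_def[symmetric]
      using nonneg K_pos by (simp add: ennreal_leI flip: ennreal_plus ennreal_mult)
  next
    case (2 \<xi> \<xi>' X\<xi> Y\<xi> Z\<xi> X\<xi>' Y\<xi>' Z\<xi>' x x' X Y Z X' Y' Z')
    then have sol: "mkv_solution M B G H r \<xi> X\<xi> Y\<xi> Z\<xi>" "mkv_solution M B G H r \<xi>' X\<xi>' Y\<xi>' Z\<xi>'"
      and sol2: "fbsde_solution M B G H r (law_flow M X\<xi>) (\<lambda>_. x) X Y Z"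
        "fbsde_solution M B G H r (law_flow M X\<xi>') (\<lambda>_. x') X' Y' Z'"
      by (auto simp: decoupled_solution_def)
    note st = mkv_stability[OF r L0 C0 hy hx mono 2(1,2) sol]
    \<comment> \<open>The flows belong to the coupled solutions, so their distance is measured by
      the coupled forward components, while the comparison itself concerns the decoupled
      solutions.\<close>
    define V where "V s = expectation (\<lambda>\<omega>. (X\<xi> (max 0 s) \<omega> - X\<xi>' (max 0 s) \<omega>)\<^sup>2)" for s
    interpret K: fbsde_comparison M B G H r L \<kappa> C\<^sub>0 "law_flow M X\<xi>" "law_flow M X\<xi>'" \<xi> \<xi>' X\<xi> Y\<xi> Z\<xi> X\<xi>' Y\<xi>' Z\<xi>'
      V "space M" unfolding V_def by (rule st(1))
    interpret D: fbsde_comparison M B G H r L \<kappa> C\<^sub>0 "law_flow M X\<xi>" "law_flow M X\<xi>'" "\<lambda>_. x" "\<lambda>_. x'" X Y Z X' Y' Z'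
      V "space M"
      by unfold_locales (rule r L0 C0 hy hx mono K.m K.m' sq_integrable_const sol2 K.V K.W2_V K.A; assumption?)+
    have XD: "sq_integrable (disc r M) (\<lambda>(s, \<omega>). X (max 0 s) \<omega> - X' (max 0 s) \<omega>)"
      "sq_integrable (disc r M) (\<lambda>(s, \<omega>). Y (max 0 s) \<omega> - Y' (max 0 s) \<omega>)"
      using sq_integrable_diff[OF D.facts(1) D.facts'(1)] sq_integrable_diff[OF D.facts(2) D.facts'(2)]
      by (simp_all add: case_prod_unfold)
    have nn: "(\<integral>\<^sup>+\<omega>. ennreal ((\<xi> \<omega> - \<xi>' \<omega>)\<^sup>2) \<partial>M) = ennreal (expectation (\<lambda>\<omega>. (\<xi> \<omega> - \<xi>' \<omega>)\<^sup>2))"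
      using sq_integrable_integrable_sq[OF sq_integrable_diff[OF K.\<eta> K.\<eta>']]
      by (subst nn_integral_eq_integral) auto
    note eqs = nn
      sqnorm_r_eq_integral[OF sf r, of "\<lambda>t \<omega>. X t \<omega> - X' t \<omega>", OF XD(1)]
      sqnorm_r_eq_integral[OF sf r, of "\<lambda>t \<omega>. Y t \<omega> - Y' t \<omega>", OF XD(2)]
    define E vX vY where "E = expectation (\<lambda>\<omega>. (\<xi> \<omega> - \<xi>' \<omega>)\<^sup>2)"
      and "vX = (\<integral>(s, \<omega>). (X (max 0 s) \<omega> - X' (max 0 s) \<omega>)\<^sup>2 \<partial>disc r M)"
      and "vY = (\<integral>(s, \<omega>). (Y (max 0 s) \<omega> - Y' (max 0 s) \<omega>)\<^sup>2 \<partial>disc r M)"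
    define d where "d = (x - x')\<^sup>2"
    have nonneg: "0 \<le> E" "0 \<le> vX" "0 \<le> vY" "0 \<le> d"
      unfolding E_def vX_def vY_def d_def
      by (rule integral_nonneg_AE zero_le_power2; auto simp: case_prod_unfold)+
    \<comment> \<open>Dropping the nonnegative backward terms of the coupled estimate leaves a bound
      for the distance of the flows.\<close>
    have "0 \<le> (\<integral>(s, \<omega>). (Y\<xi> (max 0 s) \<omega> - Y\<xi>' (max 0 s) \<omega>)\<^sup>2 \<partial>disc r M)"
      "0 \<le> expectation (\<lambda>\<omega>. (Y\<xi> 0 \<omega> - Y\<xi>' 0 \<omega>)\<^sup>2)"
      by (intro integral_nonneg_AE; auto simp: case_prod_unfold)+
    then have V: "(\<integral>s. V s \<partial>time_disc r) \<le> K1 * E"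
      using st(3) unfolding V_def E_def K1_def c_def by linarith
    have bound: "2 * (K2 * (d + (\<integral>s. V s \<partial>time_disc r))) \<le> K * (d + E)"
    proof -
      have "d + (\<integral>s. V s \<partial>time_disc r) \<le> (1 + K1) * (d + E)"
        using V nonneg mult_nonneg_nonneg[of K1 d] K
        unfolding distrib_left distrib_right mult_1 by linarith
      then have "2 * K2 * (d + (\<integral>s. V s \<partial>time_disc r)) \<le> 2 * K2 * ((1 + K1) * (d + E))"
        using K by (intro mult_left_mono) auto
      also have "\<dots> = (2 * K2 * (1 + K1)) * (d + E)" by (simp only: mult.assoc)
      also have "\<dots> \<le> K * (d + E)" using K2_le nonneg by (intro mult_right_mono) auto
      finally show ?thesis by (simp only: mult.assoc)
    qed
    have Dc: "stability_const \<kappa> C\<^sub>0 D.c = K2" by (simp add: K2_def D.c_def c_def)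
    have XY: "vX + vY \<le> K2 * (d + (\<integral>s. V s \<partial>time_disc r))"
      using D.norm_stability[OF kappa(1) refl] unfolding Dc vX_def vY_def by (simp add: d_def prob_space)
    \<comment> \<open>The norms are numbers and are bounded over the whole space; only the value at
      time 0 calls for the estimates over all events of \<open>F 0\<close>.\<close>
    have "AE \<omega> in M. (Y 0 \<omega> - Y' 0 \<omega>)\<^sup>2 \<le> K2 * (d + (\<integral>s. V s \<partial>time_disc r))"
      using D.initial_value_stability[OF kappa(1), of d] unfolding Dc by (simp add: d_def)
    then show ?case
    proof eventually_elim
      case (elim \<omega>)
      with XY bound have "(Y 0 \<omega> - Y' 0 \<omega>)\<^sup>2 + vX + vY \<le> K * (d + E)" by linarith
      then show ?case
        unfolding eqs power2_abs E_def[symmetric] vX_def[symmetric] vY_def[symmetric] d_def[symmetric]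
        using nonneg K_pos by (simp add: ennreal_leI flip: ennreal_plus ennreal_mult)
    qed
  qed
qed

end
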